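(* Let $\beta^*=\frac{\mu}{n}$ where $\mu>4\log 2$ is a constant, and let the number of tempering distributions satisfy $M=\Theta(n)$. Then there are constants $\delta>0$ and $\alpha<0$ (which may depend on $\beta^*$) such that the simulated tempering algorithm on $\Omega_{RGB}$ at $\beta^*$ has mixing time $\Omega(e^{(-\alpha+\delta)n})$, while the Metropolis algorithm on $\Omega_{RGB}$ at inverse temperature $\beta^*$ has mixing time $O(e^{-\alpha n+o(1)})$.
   Context: 3-state mean-field Potts model: $V=\{1,\dots,n\}$ (complete graph), configurations $x\in\{1,2,3\}^V$, $H(x)=\sum_{i<j}\delta_{x_i,x_j}$. For $x$ let $\sigma_m(x)$ be the number of vertices with spin $m$. Let $\Omega_{RGB}=\{x:\sigma_1(x)\ge\sigma_2(x)\ge\sigma_3(x)\}$, and for $\beta\ge0$ let $\pi_\beta(x)=e^{\beta H(x)}/Z_{RGB}(\beta)$ on $\Omega_{RGB}$ (normalized over $\Omega_{RGB}$). Metropolis chain on $\Omega_{RGB}$ for a distribution $\rho$: from $x$ propose $y$ by setting a uniformly random vertex to a uniformly random spin; if $y\notin\Omega_{RGB}$ stay at $x$, otherwise accept with probability $\min(1,\rho(y)/\rho(x))$. Simulated tempering on $\Omega_{RGB}$ at $\beta^*$: inverse temperatures $\beta_i=i\beta^*/M$, $i=0,\dots,M$, distributions $\pi_i=\pi_{\beta_i}$; state space $\Omega_{RGB}\times\{0,\dots,M\}$. With probability $1/2$ a level move $(x,i)\to(x',i)$ with probability $\frac12 M_{\pi_i}(x,x')$ (Metropolis chain above); otherwise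 a temperature move: choose $j=i\pm1$ with probability $1/2$ each (at the endpoints the single neighbor with probability $1/2$) and move to $(x,j)$ with probability $\min(1,\pi_j(x)/\pi_i(x))$. Mixing time (for a fixed $\varepsilon\in(0,1/2)$): $\tau(\varepsilon)=\min\{t:\max_x\frac12\sum_y|P^{t'}(x,y)-\pi(y)|\le\varepsilon\ \forall t'\ge t\}$. *)

theory Defs
  imports "HOL-Probability.Probability" "HOL-Library.Landau_Symbols"
begin

definition num_spins :: "nat \<Rightarrow> (nat \<Rightarrow> nat) \<Rightarrow> nat \<Rightarrow> nat" where
  "num_spins n x m = card {v \<in> {1..n}. x v = m}"

definition \<Omega>_RGB :: "nat \<Rightarrow> (nat \<Rightarrow> nat) set" where
  "\<Omega>_RGB n = {x \<in> {1..n} \<rightarrow>\<^sub>E {1, 2, 3}.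
     num_spins n x 1 \<ge> num_spins n x 2 \<and> num_spins n x 2 \<ge> num_spins n x 3}"

definition energy :: "nat \<Rightarrow> (nat \<Rightarrow> nat) \<Rightarrow> real" where
  "energy n x = (\<Sum>i\<in>{1..n}. \<Sum>j\<in>{i<..n}. if x i = x j then 1 else 0)"

definition Z_RGB :: "nat \<Rightarrow> real \<Rightarrow> real" where
  "Z_RGB n \<beta> = (\<Sum>x\<in>\<Omega>_RGB n. exp (\<beta> * energy n x))"

definition gibbs :: "nat \<Rightarrow> real \<Rightarrow> (nat \<Rightarrow> nat) \<Rightarrow> real" where
  "gibbs n \<beta> x = exp (\<beta> * energy n x) / Z_RGB n \<beta>"

text \<open>Markov chains are given by their one-step kernels. The Metropolis kernel is meaningful for
  \<open>n \<ge> 1\<close>, as it draws a vertex uniformly from \<open>{1..n}\<close>.\<close>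

definition metropolis :: "nat \<Rightarrow> ((nat \<Rightarrow> nat) \<Rightarrow> real) \<Rightarrow> (nat \<Rightarrow> nat) \<Rightarrow> (nat \<Rightarrow> nat) pmf" where
  "metropolis n \<rho> x = do {
     v \<leftarrow> pmf_of_set {1..n};
     s \<leftarrow> pmf_of_set {1, 2, 3};
     let y = x(v := s);
     if y \<notin> \<Omega>_RGB n then return_pmf x
     else do {
       accept \<leftarrow> bernoulli_pmf (min 1 (\<rho> y / \<rho> x));
       return_pmf (if accept then y else x)
     }
   }"

definition inv_temp :: "real \<Rightarrow> nat \<Rightarrow> nat \<Rightarrow> real" where
  "inv_temp \<beta>s M i = real i * \<beta>s / real M"

definition tempering_states :: "nat \<Rightarrow> nat \<Rightarrow> ((nat \<Rightarrow> nat) \<times> nat) set" where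
  "tempering_states n M = \<Omega>_RGB n \<times> {0..M}"

text \<open>Within the level-move branch, which has probability \<open>1/2\<close>, the configuration is updated by the
  lazy chain \<open>1/2 I + 1/2 M\<^bsub>\<pi>\<^sub>i\<^esub>\<close>. At the extreme levels a temperature move proposes the one
  existing neighbour with probability \<open>1/2\<close> and otherwise does nothing.\<close>

definition level_move :: "nat \<Rightarrow> real \<Rightarrow> nat \<Rightarrow> (nat \<Rightarrow> nat) \<times> nat \<Rightarrow> ((nat \<Rightarrow> nat) \<times> nat) pmf" where
  "level_move n \<beta>s M = (\<lambda>(x, i). do {
     move \<leftarrow> bernoulli_pmf (1/2);
     if move then map_pmf (\<lambda>x'. (x', i)) (metropolis n (gibbs n (inv_temp \<beta>s M i)) x)
     else return_pmf (x, i)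
   })"

definition temperature_move ::
    "nat \<Rightarrow> real \<Rightarrow> nat \<Rightarrow> (nat \<Rightarrow> nat) \<times> nat \<Rightarrow> ((nat \<Rightarrow> nat) \<times> nat) pmf" where
  "temperature_move n \<beta>s M = (\<lambda>(x, i). do {
     up \<leftarrow> bernoulli_pmf (1/2);
     if (up \<and> i = M) \<or> (\<not> up \<and> i = 0) then return_pmf (x, i)
     else do {
       let j = (if up then i + 1 else i - 1);
       accept \<leftarrow> bernoulli_pmf
         (min 1 (gibbs n (inv_temp \<beta>s M j) x / gibbs n (inv_temp \<beta>s M i) x));
       return_pmf (if accept then (x, j) else (x, i))
     }
   })"

definition tempering ::
    "nat \<Rightarrow> real \<Rightarrow> nat \<Rightarrow> (nat \<Rightarrow> nat) \<times> nat \<Rightarrow> ((nat \<Rightarrow> nat) \<times> nat) pmf" where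
  "tempering n \<beta>s M xi = do {
     level \<leftarrow> bernoulli_pmf (1/2);
     if level then level_move n \<beta>s M xi else temperature_move n \<beta>s M xi
   }"

definition tempering_stationary :: "nat \<Rightarrow> real \<Rightarrow> nat \<Rightarrow> (nat \<Rightarrow> nat) \<times> nat \<Rightarrow> real" where
  "tempering_stationary n \<beta>s M = (\<lambda>(x, i). gibbs n (inv_temp \<beta>s M i) x / real (M + 1))"

definition step_distr :: "('a \<Rightarrow> 'a pmf) \<Rightarrow> nat \<Rightarrow> 'a \<Rightarrow> 'a pmf" where
  "step_distr K t x = ((\<lambda>p. bind_pmf p K) ^^ t) (return_pmf x)"

definition tv_dist :: "'a set \<Rightarrow> ('a \<Rightarrow> 'a pmf) \<Rightarrow> ('a \<Rightarrow> real) \<Rightarrow> nat \<Rightarrow> 'a \<Rightarrow> real" where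
  "tv_dist S K \<pi> t x = 1/2 * (\<Sum>y\<in>S. \<bar>pmf (step_distr K t x) y - \<pi> y\<bar>)"

text \<open>The minimum exists for the chains considered here, which are irreducible and aperiodic on
  their finite state spaces.\<close>

definition mixing_time :: "'a set \<Rightarrow> ('a \<Rightarrow> 'a pmf) \<Rightarrow> ('a \<Rightarrow> real) \<Rightarrow> real \<Rightarrow> nat" where
  "mixing_time S K \<pi> \<epsilon> = (LEAST t. \<forall>t'\<ge>t. (MAX x\<in>S. tv_dist S K \<pi> t' x) \<le> \<epsilon>)"

definition metropolis_mixing_time :: "nat \<Rightarrow> real \<Rightarrow> real \<Rightarrow> nat" where
  "metropolis_mixing_time n \<beta> \<epsilon> =
     mixing_time (\<Omega>_RGB n) (metropolis n (gibbs n \<beta>)) (gibbs n \<beta>) \<epsilon>"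

definition tempering_mixing_time :: "nat \<Rightarrow> real \<Rightarrow> nat \<Rightarrow> real \<Rightarrow> nat" where
  "tempering_mixing_time n \<beta>s M \<epsilon> =
     mixing_time (tempering_states n M) (tempering n \<beta>s M) (tempering_stationary n \<beta>s M) \<epsilon>"

end

theory Submission
  imports Defs "HOL-Combinatorics.Permutations" "HOL-Real_Asymp.Real_Asymp"
begin

text \<open>
  Both mixing bounds are governed by the mean-field free energy
  \<open>- \<Sum> p\<^sub>i ln p\<^sub>i + l/2 \<Sum> p\<^sub>i\<^sup>2\<close> of the colour proportions at inverse temperature \<open>l / n\<close>.
  At the transition \<open>l = 4 ln 2\<close> the disordered state \<open>(1/3, 1/3, 1/3)\<close> and the ordered state
  \<open>(2/3, 1/6, 1/6)\<close> are equally heavy and are separated by the saddle \<open>(1/2, 1/4, 1/4)\<close>, at depth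
  \<open>barrier = ln 3 - 19/12 ln 2\<close>.

  Tempering must cross the slice \<open>\<sigma>\<^sub>1 = n / 2\<close> at some temperature. At every temperature this slice has
  mass at most \<open>exp (- barrier n)\<close> up to subexponential factors, by comparison with the disordered
  state below the transition and with the ordered state above it, while neither side of the cut has
  exponentially small mass, thanks to the hottest and the coldest level respectively.

  The Metropolis chain at \<open>\<mu> > 4 ln 2\<close> only has to leave the disordered state. From every macrostate
  there is a route to the dominant one along which the weight drops by a factor of at most \<open>exp (B n)\<close> with
  \<open>B < barrier\<close>, since the field favours the saddle over the disordered state.
  A hub version of the canonical path method, with averages over macrostates in place of single
  configurations, turns this into a Poincare inequality.
\<close>

section \<open>Reversible chains: mixing time and bottlenecks\<close>

text \<open>The claim compares two exponents, so only a strict gap between \<open>B\<close> and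
  \<open>barrier\<close> matters and polynomial factors may be wasted: crude Stirling bounds, sums
  over at most (n + 1)^2 macrostates, and powers of n in the Poincare constant are all affordable.
  Strictness of \<open>B < barrier\<close> is a compactness fact: each single dip is below
  \<open>barrier\<close> because the field term a^2 + (1 - a)^2 / 2 increases, and a maximum over a
  compact set of dips makes this uniform. Paths through configurations would have to be spread
  evenly over exponentially many choices. Here the colour counts alone carry the route, and evenness
  comes from counting pairs of a configuration and a vertex. Variance inside one macrostate is
  needed only at the hub; exchanging two colours there costs exp (\<beta> n) = exp \<mu>, a constant
  at \<beta> = \<mu> / n. All temperatures are handled at once because, at fixed proportions, the
  free energy is affine in l: one computes at 4 ln 2 and then compares sums of squares.\<close>

lemma power2_sum_le: "(a + b)\<^sup>2 \<le> 2 * a\<^sup>2 + 2 * b\<^sup>2" for a b :: real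
  using zero_le_power2[of "a - b"] by (simp add: power2_eq_square algebra_simps)

lemma weighted_cauchy_schwarz:
  fixes p g :: "'a \<Rightarrow> real"
  assumes "\<And>x. x \<in> A \<Longrightarrow> p x \<ge> 0"
  shows "(\<Sum>x\<in>A. p x * g x)\<^sup>2 \<le> (\<Sum>x\<in>A. p x) * (\<Sum>x\<in>A. p x * (g x)\<^sup>2)"
proof -
  have "(\<Sum>x\<in>A. p x * g x) = (\<Sum>x\<in>A. sqrt (p x) * (sqrt (p x) * g x))"
    using assms by (intro sum.cong refl) (simp flip: mult.assoc)
  moreover have "(\<Sum>x\<in>A. (sqrt (p x))\<^sup>2) = (\<Sum>x\<in>A. p x)"
    using assms by (intro sum.cong) auto
  moreover have "(\<Sum>x\<in>A. (sqrt (p x) * g x)\<^sup>2) = (\<Sum>x\<in>A. p x * (g x)\<^sup>2)"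
    using assms by (intro sum.cong) (auto simp: power_mult_distrib)
  ultimately show ?thesis
    using Cauchy_Schwarz_ineq_sum[of "\<lambda>x. sqrt (p x)" "\<lambda>x. sqrt (p x) * g x" A] by simp
qed

text \<open>Irreducibility enters later, as a Poincare inequality or as reachability of one state,
  and aperiodicity as a lower bound \<open>\<gamma>\<close> on the diagonal.\<close>

locale reversible_chain =
  fixes S :: "'a set" and K :: "'a \<Rightarrow> 'a pmf" and \<pi> :: "'a \<Rightarrow> real"
  assumes fin: "finite S" and ne: "S \<noteq> {}"
    and closed: "\<And>x. x \<in> S \<Longrightarrow> set_pmf (K x) \<subseteq> S"
    and pos: "\<And>x. x \<in> S \<Longrightarrow> \<pi> x > 0"
    and total: "(\<Sum>x\<in>S. \<pi> x) = 1"
    and rev: "\<And>x y. x \<in> S \<Longrightarrow> y \<in> S \<Longrightarrow> \<pi> x * pmf (K x) y = \<pi> y * pmf (K y) x"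
begin

text \<open>Twice the customary Dirichlet form: both orientations of an edge are counted, without a
  factor 1/2.\<close>

definition dirichlet :: "('a \<Rightarrow> real) \<Rightarrow> real" where
  "dirichlet f = (\<Sum>x\<in>S. \<Sum>y\<in>S. \<pi> x * pmf (K x) y * (f x - f y)\<^sup>2)"

lemma dirichlet_nonneg: "dirichlet f \<ge> 0"
  unfolding dirichlet_def by (intro sum_nonneg mult_nonneg_nonneg) (auto simp: pos less_imp_le)

lemma row_sum: "x \<in> S \<Longrightarrow> (\<Sum>y\<in>S. pmf (K x) y) = 1"
  using sum_pmf_eq_1[OF fin closed] by simp

lemma stationary: "y \<in> S \<Longrightarrow> (\<Sum>x\<in>S. \<pi> x * pmf (K x) y) = \<pi> y"
  by (simp add: rev[of _ y] sum_distrib_left[symmetric] row_sum)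

lemma step_0: "pmf (step_distr K 0 x) y = (if y = x then 1 else 0)"
  by (simp add: step_distr_def indicator_def)

lemma step_distr_Suc: "step_distr K (Suc t) x = bind_pmf (step_distr K t x) K"
  by (simp add: step_distr_def)

lemma step_closed: "x \<in> S \<Longrightarrow> set_pmf (step_distr K t x) \<subseteq> S"
proof (induction t)
  case 0 then show ?case by (simp add: step_distr_def)
next
  case (Suc t) then show ?case using closed by (fastforce simp: step_distr_Suc)
qed

lemma step_sum: "x \<in> S \<Longrightarrow> (\<Sum>y\<in>S. pmf (step_distr K t x) y) = 1"
  using sum_pmf_eq_1[OF fin step_closed] by simp

lemma step_Suc:
  assumes "x \<in> S"
  shows "pmf (step_distr K (Suc t) x) y = (\<Sum>z\<in>S. pmf (step_distr K t x) z * pmf (K z) y)"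
  unfolding step_distr_Suc pmf_bind
  by (subst integral_measure_pmf_real[OF fin])
     (use step_closed[OF assms, of t] in \<open>auto simp: mult.commute\<close>)

lemma stationary_steps:
  assumes "y \<in> S"
  shows "(\<Sum>x\<in>S. \<pi> x * pmf (step_distr K t x) y) = \<pi> y"
  using assms
proof (induction t arbitrary: y)
  case 0 then show ?case using fin by (simp add: step_0 if_distrib cong: if_cong)
next
  case (Suc t)
  have "(\<Sum>x\<in>S. \<pi> x * pmf (step_distr K (Suc t) x) y)
      = (\<Sum>x\<in>S. \<Sum>z\<in>S. \<pi> x * pmf (step_distr K t x) z * pmf (K z) y)"
    by (intro sum.cong refl) (simp add: step_Suc sum_distrib_left mult.assoc)
  also have "\<dots> = (\<Sum>z\<in>S. (\<Sum>x\<in>S. \<pi> x * pmf (step_distr K t x) z) * pmf (K z) y)"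
    by (subst sum.swap) (simp add: sum_distrib_right)
  also have "\<dots> = \<pi> y" using Suc by (simp add: stationary)
  finally show ?case .
qed

text \<open>With \<open>f\<close> started at \<open>x\<close>, only \<open>1 - K x x\<close> of the mass contributes to the mean displacement;
  this is where laziness enters.\<close>

lemma lazy_contraction:
  assumes diag: "\<And>x. x \<in> S \<Longrightarrow> pmf (K x) x \<ge> \<gamma>"
  shows "(\<Sum>x\<in>S. \<pi> x * (\<Sum>y\<in>S. pmf (K x) y * f y)\<^sup>2)
    \<le> (\<Sum>x\<in>S. \<pi> x * (f x)\<^sup>2) - \<gamma> * dirichlet f"
proof -
  have 1: "(\<Sum>y\<in>S. pmf (K x) y * f y)\<^sup>2
      \<le> (\<Sum>y\<in>S. pmf (K x) y * (f y)\<^sup>2) - \<gamma> * (\<Sum>y\<in>S. pmf (K x) y * (f x - f y)\<^sup>2)"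
    if x: "x \<in> S" for x
  proof -
    let ?p = "\<lambda>y. pmf (K x) y"
    define A where "A = (\<Sum>y\<in>S. ?p y * (f y - f x)\<^sup>2)"
    define m where "m = (\<Sum>y\<in>S. ?p y * (f y - f x))"
    have A0: "A \<ge> 0" unfolding A_def by (intro sum_nonneg) auto
    have r: "(\<Sum>y\<in>S-{x}. ?p y) = 1 - ?p x"
      using row_sum[OF x] sum.remove[OF fin x, of ?p] by simp
    have "m = (\<Sum>y\<in>S-{x}. ?p y * (f y - f x))"
      unfolding m_def by (subst sum.remove[OF fin x]) simp
    then have "m\<^sup>2 \<le> (1 - ?p x) * (\<Sum>y\<in>S-{x}. ?p y * (f y - f x)\<^sup>2)"
      using weighted_cauchy_schwarz[of "S-{x}" ?p "\<lambda>y. f y - f x"] r by simp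
    also have "(\<Sum>y\<in>S-{x}. ?p y * (f y - f x)\<^sup>2) = A"
      unfolding A_def using sum.remove[OF fin x, of "\<lambda>y. ?p y * (f y - f x)\<^sup>2"] by simp
    finally have m: "m\<^sup>2 \<le> (1 - \<gamma>) * A"
      using mult_right_mono[OF diag[OF x] A0] by (simp add: algebra_simps)
    have s: "(\<Sum>y\<in>S. ?p y * f y) = f x + m"
      unfolding m_def using row_sum[OF x]
      by (simp add: right_diff_distrib sum_subtractf sum_distrib_right[symmetric])
    have "(\<Sum>y\<in>S. ?p y * (f y)\<^sup>2)
        = (\<Sum>y\<in>S. ?p y * (f y - f x)\<^sup>2 + 2 * f x * (?p y * (f y - f x)) + ?p y * (f x)\<^sup>2)"
      by (intro sum.cong) (auto simp: power2_eq_square algebra_simps)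
    also have "\<dots> = A + 2 * f x * m + (f x)\<^sup>2"
      unfolding A_def m_def using row_sum[OF x]
      by (simp add: sum.distrib sum_distrib_left sum_distrib_right[symmetric])
    finally have q: "(\<Sum>y\<in>S. ?p y * (f y)\<^sup>2) = A + 2 * f x * m + (f x)\<^sup>2" .
    have d: "(\<Sum>y\<in>S. ?p y * (f x - f y)\<^sup>2) = A"
      unfolding A_def by (simp add: power2_commute)
    \<comment> \<open>The second moment minus the squared mean is \<open>A - m\<^sup>2\<close>,
      which is at least \<open>\<gamma> * A\<close>.\<close>
    show ?thesis unfolding s q d using m by (simp add: power2_eq_square algebra_simps)
  qed
  have "(\<Sum>x\<in>S. \<pi> x * (\<Sum>y\<in>S. pmf (K x) y * f y)\<^sup>2)
      \<le> (\<Sum>x\<in>S. \<pi> x * ((\<Sum>y\<in>S. pmf (K x) y * (f y)\<^sup>2)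
            - \<gamma> * (\<Sum>y\<in>S. pmf (K x) y * (f x - f y)\<^sup>2)))"
    using 1 pos by (intro sum_mono mult_left_mono) (auto simp: less_imp_le)
  also have "\<dots> = (\<Sum>y\<in>S. (\<Sum>x\<in>S. \<pi> x * pmf (K x) y) * (f y)\<^sup>2) - \<gamma> * dirichlet f"
    unfolding dirichlet_def
    by (simp add: right_diff_distrib sum_subtractf sum_distrib_left sum_distrib_right mult_ac)
       (rule sum.swap)
  finally show ?thesis by (simp add: stationary)
qed

text \<open>The chi-square argument: by reversibility the relative density \<open>h t\<close>
  evolves under \<open>K\<close> itself, its variance \<open>V t\<close> shrinks by the factor 1 -
  \<gamma> / C per step and starts below 1 / \<pi> x. Cauchy-Schwarz passes from L2 to total
  variation.\<close>

lemma tv_bound: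
  assumes diag: "\<And>x. x \<in> S \<Longrightarrow> pmf (K x) x \<ge> \<gamma>" and \<gamma>: "0 \<le> \<gamma>" "\<gamma> \<le> C" and C: "C > 0"
    and poincare: "\<And>f. \<exists>c. (\<Sum>x\<in>S. \<pi> x * (f x - c)\<^sup>2) \<le> C * dirichlet f"
    and x: "x \<in> S"
  shows "tv_dist S K \<pi> t x \<le> 1/2 * sqrt ((1 - \<gamma> / C) ^ t / \<pi> x)"
proof -
  define h where "h = (\<lambda>t y. pmf (step_distr K t x) y / \<pi> y)"
  define V where "V = (\<lambda>t. (\<Sum>y\<in>S. \<pi> y * (h t y)\<^sup>2) - 1)"
  have mean: "(\<Sum>y\<in>S. \<pi> y * h t y) = 1" for t
  proof -
    have "(\<Sum>y\<in>S. \<pi> y * h t y) = (\<Sum>y\<in>S. pmf (step_distr K t x) y)"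
      unfolding h_def using pos by (intro sum.cong) force+
    then show ?thesis using step_sum[OF x] by simp
  qed
  have hS: "h (Suc t) y = (\<Sum>z\<in>S. pmf (K y) z * h t z)" if "y \<in> S" for t y
  proof -
    have "pmf (step_distr K t x) z * pmf (K z) y / \<pi> y = pmf (K y) z * h t z" if "z \<in> S" for z
      using rev[OF \<open>y \<in> S\<close> \<open>z \<in> S\<close>] pos[OF \<open>y \<in> S\<close>] pos[OF \<open>z \<in> S\<close>]
      unfolding h_def by (simp add: field_simps)
    then show ?thesis unfolding h_def step_Suc[OF x] sum_divide_distrib
      by (intro sum.cong) (auto simp: h_def)
  qed
  \<comment> \<open>The second moment about any centre exceeds the variance by (1 - c)^2, so the
    centre in the Poincare inequality may be arbitrary.\<close>
  have sq: "(\<Sum>y\<in>S. \<pi> y * (h t y - c)\<^sup>2) = V t + (1 - c)\<^sup>2" for t c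
  proof -
    have "(\<Sum>y\<in>S. \<pi> y * (h t y - c)\<^sup>2)
       = (\<Sum>y\<in>S. \<pi> y * (h t y)\<^sup>2 - 2 * c * (\<pi> y * h t y) + \<pi> y * c\<^sup>2)"
      by (intro sum.cong) (auto simp: power2_eq_square algebra_simps)
    also have "\<dots> = V t + 1 - 2 * c + c\<^sup>2"
      using mean[of t] total unfolding V_def
      by (simp add: sum.distrib sum_subtractf sum_distrib_left[symmetric] sum_distrib_right[symmetric])
    finally show ?thesis by (simp add: power2_eq_square algebra_simps)
  qed
  have V: "V t \<le> (1 - \<gamma> / C) ^ t * V 0" for t
  proof (induction t)
    case (Suc t)
    obtain c where c: "(\<Sum>y\<in>S. \<pi> y * (h t y - c)\<^sup>2) \<le> C * dirichlet (h t)"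
      using poincare by blast
    then have "V t \<le> C * dirichlet (h t)"
      using sq[of t c] zero_le_power2[of "1 - c"] by linarith
    then have d: "V t / C \<le> dirichlet (h t)" using C by (simp add: field_simps)
    have "V (Suc t) \<le> V t - \<gamma> * dirichlet (h t)"
      using lazy_contraction[OF diag, of "h t"] unfolding V_def by (simp add: hS)
    also have "\<dots> \<le> V t - \<gamma> * (V t / C)" using mult_left_mono[OF d \<gamma>(1)] by simp
    also have "\<dots> = (1 - \<gamma> / C) * V t" by (simp add: algebra_simps)
    also have "\<dots> \<le> (1 - \<gamma> / C) * ((1 - \<gamma> / C) ^ t * V 0)"
      using Suc \<gamma> C by (intro mult_left_mono) auto
    finally show ?case by simp
  qed simp
  have "V 0 \<le> 1 / \<pi> x"
  proof -
    have "(\<Sum>y\<in>S. \<pi> y * (h 0 y)\<^sup>2) = (\<Sum>y\<in>S. if y = x then 1 / \<pi> y else 0)"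
      unfolding h_def using pos by (intro sum.cong) (force simp: step_0 power2_eq_square)+
    then show ?thesis using fin x by (simp add: V_def)
  qed
  then have Vt: "V t \<le> (1 - \<gamma> / C) ^ t / \<pi> x"
    using V[of t] mult_left_mono[of "V 0" "1 / \<pi> x" "(1 - \<gamma> / C) ^ t"] \<gamma> C by force
  have "\<bar>pmf (step_distr K t x) y - \<pi> y\<bar> = \<pi> y * \<bar>h t y - 1\<bar>" if "y \<in> S" for y
  proof -
    have "pmf (step_distr K t x) y - \<pi> y = \<pi> y * (h t y - 1)"
      unfolding h_def using pos[OF that] by (simp add: field_simps)
    then show ?thesis using pos[OF that] by (simp add: abs_mult)
  qed
  then have "(\<Sum>y\<in>S. \<bar>pmf (step_distr K t x) y - \<pi> y\<bar>) = (\<Sum>y\<in>S. \<pi> y * \<bar>h t y - 1\<bar>)"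
    by simp
  also have "\<dots> \<le> sqrt (V t)"
  proof (rule real_le_rsqrt)
    have "(\<Sum>y\<in>S. \<pi> y * \<bar>h t y - 1\<bar>)\<^sup>2 \<le> (\<Sum>y\<in>S. \<pi> y) * (\<Sum>y\<in>S. \<pi> y * \<bar>h t y - 1\<bar>\<^sup>2)"
      by (rule weighted_cauchy_schwarz) (simp add: pos less_imp_le)
    then show "(\<Sum>y\<in>S. \<pi> y * \<bar>h t y - 1\<bar>)\<^sup>2 \<le> V t" using sq[of t 1] total by simp
  qed
  also have "\<dots> \<le> sqrt ((1 - \<gamma> / C) ^ t / \<pi> x)" using Vt by simp
  finally show ?thesis unfolding tv_dist_def by simp
qed

lemma Max_tv_le_iff:
  "(MAX x\<in>S. tv_dist S K \<pi> t x) \<le> \<epsilon> \<longleftrightarrow> (\<forall>x\<in>S. tv_dist S K \<pi> t x \<le> \<epsilon>)"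
  using fin ne by auto

lemma mixing_time_le:
  assumes "\<And>t x. t \<ge> T \<Longrightarrow> x \<in> S \<Longrightarrow> tv_dist S K \<pi> t x \<le> \<epsilon>"
  shows "mixing_time S K \<pi> \<epsilon> \<le> T"
  unfolding mixing_time_def Max_tv_le_iff by (rule Least_le) (use assms in auto)

text \<open>\<open>T\<close> makes exp (- T \<gamma> / C) exp R at most \<epsilon>^2. The smallest
  stationary mass enters only through its logarithm, so a crude bound on it is cheap.\<close>

lemma mixing_time_bound:
  assumes diag: "\<And>x. x \<in> S \<Longrightarrow> pmf (K x) x \<ge> \<gamma>" and \<gamma>: "0 < \<gamma>" "\<gamma> \<le> C"
    and poincare: "\<And>f. \<exists>c. (\<Sum>x\<in>S. \<pi> x * (f x - c)\<^sup>2) \<le> C * dirichlet f"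
    and \<pi>_min: "\<And>x. x \<in> S \<Longrightarrow> \<pi> x \<ge> exp (- R)" and \<epsilon>: "\<epsilon> > 0"
    and T: "real T \<ge> C / \<gamma> * (R + 2 * ln (1 / \<epsilon>))"
  shows "mixing_time S K \<pi> \<epsilon> \<le> T"
proof (rule mixing_time_le)
  fix t x assume t: "T \<le> t" and x: "x \<in> S"
  have C: "C > 0" using \<gamma> by simp
  have g: "0 \<le> 1 - \<gamma> / C" "1 - \<gamma> / C \<le> exp (- (\<gamma> / C))"
    using \<gamma> C exp_ge_add_one_self[of "- (\<gamma> / C)"] by auto
  have "R + 2 * ln (1 / \<epsilon>) \<le> real t * (\<gamma> / C)"
    using T t \<gamma> C order_trans[OF T, of "real t"] by (simp add: field_simps)
  then have e: "- (real t * (\<gamma> / C)) + R \<le> 2 * ln \<epsilon>" using \<epsilon> by (simp add: ln_div)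
  have "(1 - \<gamma> / C) ^ t / \<pi> x \<le> exp (- (\<gamma> / C)) ^ t / exp (- R)"
    using g pos[OF x] \<pi>_min[OF x] by (intro frac_le power_mono) auto
  also have "\<dots> = exp (real t * (- (\<gamma> / C)) - (- R))"
    by (simp only: exp_of_nat_mult exp_diff)
  also have "\<dots> \<le> exp (2 * ln \<epsilon>)" using e by simp
  also have "\<dots> = \<epsilon>\<^sup>2" using \<epsilon> by (simp add: exp_double)
  finally have "sqrt ((1 - \<gamma> / C) ^ t / \<pi> x) \<le> \<epsilon>" using \<epsilon> by (intro real_le_lsqrt) auto
  then show "tv_dist S K \<pi> t x \<le> \<epsilon>"
    using tv_bound[OF diag _ _ _ poincare x, of t] \<gamma> C \<epsilon> by fastforce
qed

text \<open>\<open>mixing_time\<close> is a LEAST, so lower bounds on it need that some time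
  qualifies. For this any finite Poincare constant will do; it is obtained by telescoping along a
  path to \<open>h\<close>, however wasteful.\<close>

lemma mixing_time_attained:
  assumes diag: "\<And>x. x \<in> S \<Longrightarrow> pmf (K x) x \<ge> \<gamma>" and \<gamma>: "0 < \<gamma>"
    and conn: "\<And>x. x \<in> S \<Longrightarrow> (\<lambda>x y. x \<in> S \<and> y \<in> S \<and> pmf (K x) y > 0)\<^sup>*\<^sup>* x h"
    and \<epsilon>: "\<epsilon> > 0" and x: "x \<in> S"
  shows "tv_dist S K \<pi> (mixing_time S K \<pi> \<epsilon>) x \<le> \<epsilon>"
proof -
  have "\<exists>C\<ge>0. \<forall>f. (f x - f h)\<^sup>2 \<le> C * dirichlet f"
    if "(\<lambda>x y. x \<in> S \<and> y \<in> S \<and> pmf (K x) y > 0)\<^sup>*\<^sup>* x h" for x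
    using that
  proof (induction rule: converse_rtranclp_induct)
    case base then show ?case using dirichlet_nonneg by (intro exI[of _ 0]) auto
  next
    case (step x y)
    then obtain C where C: "C \<ge> 0" "\<And>f. (f y - f h)\<^sup>2 \<le> C * dirichlet f" by blast
    define w where "w = \<pi> x * pmf (K x) y"
    have w: "w > 0" using step pos unfolding w_def by simp
    have "(f x - f y)\<^sup>2 \<le> 1 / w * dirichlet f" for f
    proof -
      have "w * (f x - f y)\<^sup>2 \<le> (\<Sum>b\<in>S. \<pi> x * pmf (K x) b * (f x - f b)\<^sup>2)"
        unfolding w_def using fin step pos
        by (intro member_le_sum[where f = "\<lambda>b. \<pi> x * pmf (K x) b * (f x - f b)\<^sup>2"])
           (auto simp: less_imp_le)
      also have "\<dots> \<le> dirichlet f"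
        unfolding dirichlet_def using fin step pos
        by (intro member_le_sum[where f = "\<lambda>a. \<Sum>b\<in>S. \<pi> a * pmf (K a) b * (f a - f b)\<^sup>2"])
           (auto simp: less_imp_le intro!: sum_nonneg)
      finally show ?thesis using w by (simp add: field_simps)
    qed
    moreover have "(f x - f h)\<^sup>2 \<le> 2 * (f x - f y)\<^sup>2 + 2 * (f y - f h)\<^sup>2" for f :: "'a \<Rightarrow> real"
      using power2_sum_le[of "f x - f y" "f y - f h"] by simp
    ultimately have "(f x - f h)\<^sup>2 \<le> 2 * (1 / w * dirichlet f) + 2 * (C * dirichlet f)" for f
      using C(2) by (smt (verit))
    then have bound: "(f x - f h)\<^sup>2 \<le> (2 / w + 2 * C) * dirichlet f" for f
      by (simp add: distrib_right mult.assoc)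
    show ?case
    proof (intro exI conjI allI)
      show "0 \<le> 2 / w + 2 * C" using C(1) w by simp
    qed (rule bound)
  qed
  then have "\<forall>x\<in>S. \<exists>C. C \<ge> 0 \<and> (\<forall>f. (f x - f h)\<^sup>2 \<le> C * dirichlet f)"
    using conn by blast
  from bchoice[OF this] obtain C where C: "\<And>x. x \<in> S \<Longrightarrow> C x \<ge> 0"
      "\<And>x f. x \<in> S \<Longrightarrow> (f x - f h)\<^sup>2 \<le> C x * dirichlet f"
    by blast
  \<comment> \<open>Adding \<open>\<gamma>\<close> makes \<open>D\<close> positive and at least
    \<open>\<gamma>\<close>, as \<open>tv_bound\<close> demands.\<close>
  define D where "D = (\<Sum>x\<in>S. \<pi> x * C x) + \<gamma>"
  have D: "\<gamma> \<le> D" "0 < D" unfolding D_def using \<gamma> C(1) pos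
    by (auto intro!: sum_nonneg add_nonneg_pos simp: less_imp_le)
  have "\<exists>c. (\<Sum>x\<in>S. \<pi> x * (f x - c)\<^sup>2) \<le> D * dirichlet f" for f
  proof (intro exI[of _ "f h"])
    have "(\<Sum>x\<in>S. \<pi> x * (f x - f h)\<^sup>2) \<le> (\<Sum>x\<in>S. \<pi> x * (C x * dirichlet f))"
      using C pos by (intro sum_mono mult_left_mono) (auto simp: less_imp_le)
    also have "\<dots> \<le> D * dirichlet f"
      unfolding D_def using \<gamma> dirichlet_nonneg by (simp add: sum_distrib_right distrib_right mult.assoc)
    finally show "(\<Sum>x\<in>S. \<pi> x * (f x - f h)\<^sup>2) \<le> D * dirichlet f" .
  qed
  note tv = tv_bound[OF diag _ D(1) D(2) this]
  have "(\<lambda>t. 1/2 * sqrt ((1 - \<gamma> / D) ^ t / \<pi> x)) \<longlonglongrightarrow> 1/2 * sqrt (0 / \<pi> x)" if "x \<in> S" for x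
    using D \<gamma> pos[OF that] by (intro tendsto_intros LIMSEQ_realpow_zero) auto
  then have "\<forall>\<^sub>F t in sequentially. 1/2 * sqrt ((1 - \<gamma> / D) ^ t / \<pi> x) < \<epsilon>" if "x \<in> S" for x
    using order_tendstoD(2)[of _ _ _ \<epsilon>] \<epsilon> that by fastforce
  then have "\<forall>\<^sub>F t in sequentially. \<forall>x\<in>S. 1/2 * sqrt ((1 - \<gamma> / D) ^ t / \<pi> x) < \<epsilon>"
    using fin by (simp add: eventually_ball_finite)
  then obtain T where "\<And>t x. t \<ge> T \<Longrightarrow> x \<in> S \<Longrightarrow> 1/2 * sqrt ((1 - \<gamma> / D) ^ t / \<pi> x) < \<epsilon>"
    unfolding eventually_sequentially by blast
  then have "\<forall>t\<ge>T. \<forall>x\<in>S. tv_dist S K \<pi> t x \<le> \<epsilon>"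
    using tv \<gamma> by (meson less_imp_le order_trans)
  from LeastI[of "\<lambda>T. \<forall>t\<ge>T. \<forall>x\<in>S. tv_dist S K \<pi> t x \<le> \<epsilon>", OF this] show ?thesis
    using x unfolding mixing_time_def Max_tv_le_iff by blast
qed

section \<open>Bottleneck lower bound for the mixing time\<close>

definition flow :: "'a set \<Rightarrow> 'a set \<Rightarrow> real" where
  "flow A B = (\<Sum>x\<in>A. \<Sum>y\<in>B. \<pi> x * pmf (K x) y)"

lemma flow_sym: "A \<subseteq> S \<Longrightarrow> B \<subseteq> S \<Longrightarrow> flow A B = flow B A"
  unfolding flow_def by (subst sum.swap) (auto intro!: sum.cong rev)

text \<open>Start from \<pi> restricted to \<open>A\<close>: at every time the mass located in
  \<open>A\<close> is dominated by \<pi>, so no single step leaks more than the stationary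
  flow.\<close>

lemma escape_bound:
  assumes A: "A \<subseteq> S"
  shows "(\<Sum>x\<in>A. \<pi> x * (\<Sum>y\<in>S-A. pmf (step_distr K t x) y)) \<le> real t * flow A (S - A)"
proof (induction t)
  case 0
  have "(\<Sum>x\<in>A. \<pi> x * (\<Sum>y\<in>S-A. pmf (step_distr K 0 x) y)) = 0"
    by (intro sum.neutral ballI) (auto simp: step_0 intro!: sum.neutral)
  then show ?case by simp
next
  case (Suc t)
  define out where "out = (\<lambda>z. \<Sum>y\<in>S-A. pmf (K z) y)"
  have out: "out z \<le> 1" "out z \<ge> 0" if "z \<in> S" for z
    unfolding out_def using sum_mono2[OF fin, of "S - A" "pmf (K z)"] row_sum[OF that]
    by (auto intro: sum_nonneg)
  let ?p = "\<lambda>x z. pmf (step_distr K t x) z"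
  have "(\<Sum>y\<in>S-A. pmf (step_distr K (Suc t) x) y)
      \<le> (\<Sum>z\<in>S-A. ?p x z) + (\<Sum>z\<in>A. ?p x z * out z)" if "x \<in> A" for x
  proof -
    have "(\<Sum>y\<in>S-A. pmf (step_distr K (Suc t) x) y) = (\<Sum>z\<in>S. ?p x z * out z)"
      using that A unfolding out_def
      by (simp add: step_Suc sum_distrib_left subset_iff) (rule sum.swap)
    also have "\<dots> = (\<Sum>z\<in>S-A. ?p x z * out z) + (\<Sum>z\<in>A. ?p x z * out z)"
      using A fin by (simp add: sum.subset_diff)
    also have "(\<Sum>z\<in>S-A. ?p x z * out z) \<le> (\<Sum>z\<in>S-A. ?p x z)"
      using out by (intro sum_mono mult_left_le) auto
    finally show ?thesis by simp
  qed
  then have "(\<Sum>x\<in>A. \<pi> x * (\<Sum>y\<in>S-A. pmf (step_distr K (Suc t) x) y))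
      \<le> (\<Sum>x\<in>A. \<pi> x * ((\<Sum>z\<in>S-A. ?p x z) + (\<Sum>z\<in>A. ?p x z * out z)))"
    using A pos by (intro sum_mono mult_left_mono) (auto simp: less_imp_le subset_iff)
  also have "\<dots> = (\<Sum>x\<in>A. \<pi> x * (\<Sum>z\<in>S-A. ?p x z)) + (\<Sum>z\<in>A. (\<Sum>x\<in>A. \<pi> x * ?p x z) * out z)"
    by (simp add: distrib_left sum.distrib sum_distrib_left sum_distrib_right mult.assoc)
       (rule sum.swap)
  also have "(\<Sum>z\<in>A. (\<Sum>x\<in>A. \<pi> x * ?p x z) * out z) \<le> (\<Sum>z\<in>A. \<pi> z * out z)"
  proof (intro sum_mono mult_right_mono)
    fix z assume z: "z \<in> A"
    have "(\<Sum>x\<in>A. \<pi> x * ?p x z) \<le> (\<Sum>x\<in>S. \<pi> x * ?p x z)"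
      using A fin pos by (intro sum_mono2) (auto simp: less_imp_le)
    then show "(\<Sum>x\<in>A. \<pi> x * ?p x z) \<le> \<pi> z" using stationary_steps z A by auto
  qed (use out A in auto)
  also have "(\<Sum>z\<in>A. \<pi> z * out z) = flow A (S - A)"
    unfolding flow_def out_def by (simp add: sum_distrib_left)
  finally show ?case using Suc by (simp add: algebra_simps)
qed

text \<open>Near stationarity a start in \<open>A\<close> is found outside \<open>A\<close> with
  probability at least 1/2 - \<epsilon>, while \<open>escape_bound\<close> limits the average
  escape.\<close>

lemma bottleneck:
  assumes A: "A \<subseteq> S" and half: "(\<Sum>x\<in>A. \<pi> x) \<le> 1/2"
    and tv: "\<And>x. x \<in> S \<Longrightarrow> tv_dist S K \<pi> t x \<le> \<epsilon>"
  shows "(1/2 - \<epsilon>) * (\<Sum>x\<in>A. \<pi> x) \<le> real t * flow A (S - A)"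
proof -
  have finA: "finite A" using A fin finite_subset by blast
  have c: "(\<Sum>y\<in>S-A. \<pi> y) \<ge> 1/2" using half total sum.subset_diff[OF A fin, of \<pi>] by simp
  have "1/2 - \<epsilon> \<le> (\<Sum>y\<in>S-A. pmf (step_distr K t x) y)" if "x \<in> A" for x
  proof -
    have x: "x \<in> S" using that A by auto
    let ?d = "\<lambda>y. pmf (step_distr K t x) y - \<pi> y"
    \<comment> \<open>Since the deviations sum to zero, those on \<open>A\<close> and those off
      \<open>A\<close> cancel, and each group is at most half the l1 norm.\<close>
    have z: "(\<Sum>y\<in>S. ?d y) = 0" using step_sum[OF x] total by (simp add: sum_subtractf)
    have "(\<Sum>y\<in>S. \<bar>?d y\<bar>) = (\<Sum>y\<in>S-A. \<bar>?d y\<bar>) + (\<Sum>y\<in>A. \<bar>?d y\<bar>)"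
      using A fin by (simp add: sum.subset_diff)
    moreover have "(\<Sum>y\<in>S. ?d y) = (\<Sum>y\<in>S-A. ?d y) + (\<Sum>y\<in>A. ?d y)"
      using A fin by (rule sum.subset_diff)
    moreover have "\<bar>\<Sum>y\<in>S-A. ?d y\<bar> \<le> (\<Sum>y\<in>S-A. \<bar>?d y\<bar>)" "\<bar>\<Sum>y\<in>A. ?d y\<bar> \<le> (\<Sum>y\<in>A. \<bar>?d y\<bar>)"
      by (rule sum_abs)+
    ultimately have "\<bar>\<Sum>y\<in>S-A. ?d y\<bar> \<le> \<epsilon>" using tv[OF x] z unfolding tv_dist_def by argo
    then show ?thesis using c by (simp add: sum_subtractf)
  qed
  then have "(\<Sum>x\<in>A. \<pi> x * (1/2 - \<epsilon>)) \<le> (\<Sum>x\<in>A. \<pi> x * (\<Sum>y\<in>S-A. pmf (step_distr K t x) y))"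
    using A pos by (intro sum_mono mult_left_mono) (auto simp: less_imp_le subset_iff)
  then show ?thesis using escape_bound[OF A, of t] by (simp add: sum_distrib_right mult.commute)
qed

end

section \<open>Macrostates\<close>

definition spins :: "nat set" where "spins = {1, 2, 3}"

lemma spins_simps [simp]: "finite spins" "Suc 0 \<in> spins" "2 \<in> spins" "3 \<in> spins" "card spins = 3" "spins \<noteq> {}"
  by (auto simp: spins_def)

definition "macrostate n k = {x \<in> {1..n} \<rightarrow>\<^sub>E spins. \<forall>m\<in>spins. num_spins n x m = k m}"

definition respin :: "nat \<Rightarrow> nat \<Rightarrow> (nat \<Rightarrow> nat) \<Rightarrow> nat \<Rightarrow> nat" where
  "respin i j k = k(i := k i - 1, j := k j + 1)"

text \<open>These pairs index the edges from one macrostate to a neighbour, a pair standing for the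
  recolouring of its vertex. Sums over either macrostate become sums over this one set, with
  constant multiplicity.\<close>

definition "incidences n i k = (SIGMA x : macrostate n k. {v \<in> {1..n}. x v = i})"

lemma finite_macrostate [simp]: "finite (macrostate n k)"
  unfolding macrostate_def by (rule finite_subset[of _ "{1..n} \<rightarrow>\<^sub>E spins"]) (auto intro!: finite_PiE)

lemma num_spins_upd:
  assumes "v \<in> {1..n}" "x v = i" "i \<noteq> j"
  shows "num_spins n (x(v := j)) m = respin i j (num_spins n x) m"
proof -
  consider "m = i" | "m = j" | "m \<noteq> i" "m \<noteq> j" by blast
  then show ?thesis
  proof cases
    case 1
    have "{u \<in> {1..n}. (x(v := j)) u = i} = {u \<in> {1..n}. x u = i} - {v}" using assms by auto
    then show ?thesis using 1 assms by (simp add: num_spins_def respin_def)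
  next
    case 2
    have "{u \<in> {1..n}. (x(v := j)) u = j} = insert v {u \<in> {1..n}. x u = j}" using assms by auto
    then show ?thesis using 2 assms by (simp add: num_spins_def respin_def)
  next
    case 3
    have "{u \<in> {1..n}. (x(v := j)) u = m} = {u \<in> {1..n}. x u = m}" using assms 3 by auto
    then show ?thesis using 3 by (simp add: num_spins_def respin_def)
  qed
qed

lemma macrostate_upd:
  assumes "x \<in> macrostate n k" "v \<in> {1..n}" "x v = i" "i \<noteq> j" "j \<in> spins"
  shows "x(v := j) \<in> macrostate n (respin i j k)"
proof -
  have "x(v := j) \<in> {1..n} \<rightarrow>\<^sub>E spins" using assms by (auto simp: macrostate_def PiE_iff extensional_def)
  moreover have "i \<in> spins" using assms by (auto simp: macrostate_def PiE_iff)
  then have "num_spins n (x(v := j)) m = respin i j k m" if "m \<in> spins" for m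
    using assms that num_spins_upd[of v n x i j m] by (auto simp: macrostate_def respin_def)
  ultimately show ?thesis by (auto simp: macrostate_def)
qed

lemma respin_respin: "i \<noteq> j \<Longrightarrow> k i > 0 \<Longrightarrow> respin j i (respin i j k) = k"
  by (auto simp: respin_def fun_eq_iff)

lemma bij_incidences:
  assumes "i \<noteq> j" "i \<in> spins" "j \<in> spins" "k i > 0"
  shows "bij_betw (\<lambda>(x, v). (x(v := j), v)) (incidences n i k) (incidences n j (respin i j k))"
proof (rule bij_betwI[where g = "\<lambda>(y, v). (y(v := i), v)"])
  show "(\<lambda>(x, v). (x(v := j), v)) \<in> incidences n i k \<rightarrow> incidences n j (respin i j k)"
    using assms macrostate_upd by (auto simp: incidences_def)
  show "(\<lambda>(y, v). (y(v := i), v)) \<in> incidences n j (respin i j k) \<rightarrow> incidences n i k"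
    using assms macrostate_upd[of _ n "respin i j k" _ j i] by (auto simp: incidences_def respin_respin)
qed (auto simp: incidences_def)

lemma finite_incidences [simp]: "finite (incidences n i k)"
  by (auto simp: incidences_def)

lemma sum_incidences:
  assumes "i \<in> spins"
  shows "(\<Sum>(x, v)\<in>incidences n i k. F x) = real (k i) * (\<Sum>x\<in>macrostate n k. F x)"
proof -
  have "(\<Sum>(x, v)\<in>incidences n i k. F x)
      = (\<Sum>x\<in>macrostate n k. real (card {v \<in> {1..n}. x v = i}) * F x)"
    unfolding incidences_def by (subst sum.Sigma[symmetric]) auto
  also have "\<dots> = (\<Sum>x\<in>macrostate n k. real (k i) * F x)"
    using assms by (intro sum.cong) (auto simp: macrostate_def num_spins_def)
  finally show ?thesis by (simp add: sum_distrib_left)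
qed

lemma sum_incidences_respin:
  assumes "i \<noteq> j" "i \<in> spins" "j \<in> spins" "k i > 0"
  shows "(\<Sum>(x, v)\<in>incidences n i k. F (x(v := j)))
    = real (k j + 1) * (\<Sum>x\<in>macrostate n (respin i j k). F x)"
proof -
  have "(\<Sum>(x, v)\<in>incidences n i k. F (x(v := j))) = (\<Sum>(y, v)\<in>incidences n j (respin i j k). F y)"
    using sum.reindex_bij_betw[OF bij_incidences[of i j k n, OF assms], of "\<lambda>(y, v). F y"]
    by (simp add: case_prod_beta)
  then show ?thesis using assms by (simp add: sum_incidences) (simp add: respin_def)
qed

text \<open>Double counting of the edges between two neighbouring macrostates. This yields both the
  multinomial formula and the single-step ratio of weights.\<close>

lemma card_macrostate_respin:
  assumes "i \<noteq> j" "i \<in> spins" "j \<in> spins" "k i > 0"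
  shows "real (k i) * card (macrostate n k) = real (k j + 1) * card (macrostate n (respin i j k))"
  using sum_incidences_respin[where F = "\<lambda>_. 1" and n = n and k = k, OF assms] sum_incidences[OF assms(2), of "\<lambda>_. 1" n k]
  by simp

section \<open>Energy as a function of the colour counts\<close>

lemma num_spins_Suc:
  "num_spins (Suc n) x m = num_spins n x m + (if x (Suc n) = m then 1 else 0)"
proof -
  have "{v \<in> {1..Suc n}. x v = m}
      = (if x (Suc n) = m then insert (Suc n) {v \<in> {1..n}. x v = m} else {v \<in> {1..n}. x v = m})"
    using le_Suc_eq by auto
  then show ?thesis by (simp add: num_spins_def)
qed

lemma energy_Suc: "energy (Suc n) x = energy n x + num_spins n x (x (Suc n))"
proof -
  have "{i<..Suc n} = insert (Suc n) {i<..n}" if "i \<in> {1..n}" for i using that by auto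
  then have "energy (Suc n) x
      = (\<Sum>i\<in>{1..n}. (if x i = x (Suc n) then 1 else 0) + (\<Sum>j\<in>{i<..n}. if x i = x j then 1 else 0))"
    by (simp add: energy_def)
  also have "\<dots> = energy n x + (\<Sum>i\<in>{1..n}. if x i = x (Suc n) then 1 else 0)"
    by (simp add: energy_def sum.distrib)
  also have "(\<Sum>i\<in>{1..n}. if x i = x (Suc n) then 1 else 0) = real (num_spins n x (x (Suc n)))"
    by (simp add: num_spins_def sum.If_cases Int_def)
  finally show ?thesis .
qed

text \<open>The number of monochromatic pairs, a sum of binomials k m choose 2, written over the
  reals to stay clear of truncated subtraction.\<close>

definition pair_energy :: "(nat \<Rightarrow> nat) \<Rightarrow> real" where
  "pair_energy k = (\<Sum>m\<in>spins. real (k m) * (real (k m) - 1) / 2)"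

lemma energy_eq:
  assumes "\<And>v. v \<in> {1..n} \<Longrightarrow> x v \<in> spins"
  shows "energy n x = pair_energy (num_spins n x)"
  using assms
proof (induction n)
  case 0 then show ?case by (simp add: energy_def pair_energy_def num_spins_def)
next
  case (Suc n)
  have s: "x (Suc n) \<in> spins" using Suc by simp
  have "pair_energy (num_spins (Suc n) x)
     = (\<Sum>m\<in>spins. real (num_spins n x m) * (real (num_spins n x m) - 1) / 2
          + (if m = x (Suc n) then real (num_spins n x m) else 0))"
    unfolding pair_energy_def by (intro sum.cong) (auto simp: num_spins_Suc field_simps)
  also have "\<dots> = pair_energy (num_spins n x) + num_spins n x (x (Suc n))"
    using s by (simp add: pair_energy_def sum.distrib)
  finally show ?case using Suc by (simp add: energy_Suc)
qed

lemma pair_energy_respin: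
  assumes "i \<noteq> j" "i \<in> spins" "j \<in> spins" "k i > 0"
  shows "pair_energy (respin i j k) = pair_energy k + real (k j) - real (k i) + 1"
proof -
  have "pair_energy (respin i j k) = (\<Sum>m\<in>spins. real (k m) * (real (k m) - 1) / 2
      + ((if m = j then real (k m) else 0) + (if m = i then 1 - real (k m) else 0)))"
    unfolding pair_energy_def using assms
    by (intro sum.cong) (auto simp: respin_def field_simps of_nat_diff)
  then show ?thesis using assms by (simp add: pair_energy_def sum.distrib)
qed

definition boltzmann :: "real \<Rightarrow> (nat \<Rightarrow> nat) \<Rightarrow> real" where
  "boltzmann \<beta> k = exp (\<beta> * pair_energy k)"

definition weight :: "nat \<Rightarrow> real \<Rightarrow> (nat \<Rightarrow> nat) \<Rightarrow> real" where
  "weight n \<beta> k = card (macrostate n k) * boltzmann \<beta> k"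

lemma weight_nonneg [simp]: "weight n \<beta> k \<ge> 0" by (simp add: weight_def boltzmann_def)

lemma pair_energy_cong: "(\<And>m. m \<in> spins \<Longrightarrow> k m = k' m) \<Longrightarrow> pair_energy k = pair_energy k'"
  by (simp add: pair_energy_def cong: sum.cong)

lemma energy_macrostate: "x \<in> macrostate n k \<Longrightarrow> energy n x = pair_energy k"
  by (subst energy_eq) (auto simp: macrostate_def PiE_iff intro: pair_energy_cong)

text \<open>The value 0 off the three colours makes a count vector one definite function, so that
  macrostates can be compared through equality of \<open>k\<close>.\<close>

definition triple :: "nat \<Rightarrow> nat \<Rightarrow> nat \<Rightarrow> nat \<Rightarrow> nat" where
  "triple a b c = (\<lambda>_. 0)(1 := a, 2 := b, 3 := c)"

lemma triple_simps [simp]: "triple a b c (Suc 0) = a" "triple a b c 2 = b" "triple a b c 3 = c"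
  by (auto simp: triple_def)

lemma triple_inj [simp]: "triple a b c = triple a' b' c' \<longleftrightarrow> a = a' \<and> b = b' \<and> c = c'"
  by (metis triple_simps)

lemma respin_triple [simp]:
  "respin 2 (Suc 0) (triple a b c) = triple (Suc a) (b - 1) c"
  "respin 3 (Suc 0) (triple a b c) = triple (Suc a) b (c - 1)"
  "respin (Suc 0) 2 (triple a b c) = triple (a - 1) (Suc b) c"
  "respin (Suc 0) 3 (triple a b c) = triple (a - 1) b (Suc c)"
  "respin 2 3 (triple a b c) = triple a (b - 1) (Suc c)"
  "respin 3 2 (triple a b c) = triple a (Suc b) (c - 1)"
  by (auto simp: respin_def triple_def fun_eq_iff)

section \<open>Decomposition of the state space by ordered colour counts\<close>

definition "types n = (\<lambda>(a, b, c). triple a b c) ` {(a, b, c). b \<le> a \<and> c \<le> b \<and> a + b + c = n}"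

lemma triple_in_types: "triple a b c \<in> types n \<longleftrightarrow> b \<le> a \<and> c \<le> b \<and> a + b + c = n"
  by (auto simp: types_def image_iff)

lemma types_E:
  assumes "k \<in> types n"
  obtains a b c where "k = triple a b c" "b \<le> a" "c \<le> b" "a + b + c = n"
  using assms by (auto simp: types_def)

lemma types_subset: "types n \<subseteq> (\<lambda>(b, c). triple (n - b - c) b c) ` ({0..n} \<times> {0..n})"
  by (auto simp: types_def image_iff intro!: bexI)

lemma finite_types [simp]: "finite (types n)"
  by (rule finite_subset[OF types_subset]) auto

text \<open>Two counts determine the third, so there are only polynomially many macrostates; every
  passage from one macrostate to all of them costs this factor.\<close>

lemma card_types: "card (types n) \<le> (n + 1)\<^sup>2"
proof -
  have "card (types n) \<le> card ((\<lambda>(b, c). triple (n - b - c) b c) ` ({0..n} \<times> {0..n}))"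
    by (rule card_mono[OF _ types_subset]) auto
  also have "\<dots> \<le> card ({0..n} \<times> {0..n})" by (rule card_image_le) auto
  finally show ?thesis by (simp add: power2_eq_square)
qed

lemma spins_set: "{1, 2, 3} = spins" by (simp add: spins_def)

lemma sum_num_spins:
  assumes "x \<in> {1..n} \<rightarrow>\<^sub>E spins"
  shows "num_spins n x 1 + num_spins n x 2 + num_spins n x 3 = n"
proof -
  have "(\<Sum>m\<in>spins. num_spins n x m) = card (\<Union>m\<in>spins. {v \<in> {1..n}. x v = m})"
    unfolding num_spins_def by (rule card_UN_disjoint[symmetric]) auto
  also have "(\<Union>m\<in>spins. {v \<in> {1..n}. x v = m}) = {1..n}" using assms by auto
  finally show ?thesis by (simp add: spins_def add.assoc)
qed

lemma Omega_eq: "\<Omega>_RGB n = (\<Union>k\<in>types n. macrostate n k)"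
proof (intro set_eqI iffI)
  fix x assume x: "x \<in> \<Omega>_RGB n"
  let ?k = "triple (num_spins n x 1) (num_spins n x 2) (num_spins n x 3)"
  have "?k \<in> types n" using x sum_num_spins[of x n] by (auto simp: triple_in_types \<Omega>_RGB_def spins_def)
  moreover have "x \<in> macrostate n ?k" using x
    by (auto simp: macrostate_def \<Omega>_RGB_def spins_set) (auto simp: spins_def)
  ultimately show "x \<in> (\<Union>k\<in>types n. macrostate n k)" by blast
next
  fix x assume "x \<in> (\<Union>k\<in>types n. macrostate n k)"
  then obtain a b c where "x \<in> macrostate n (triple a b c)" "b \<le> a" "c \<le> b"
    by (auto elim: types_E)
  then show "x \<in> \<Omega>_RGB n" by (simp add: \<Omega>_RGB_def macrostate_def spins_set) (simp add: spins_def)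
qed

lemma macrostate_disjoint:
  assumes "k \<in> types n" "k' \<in> types n" "x \<in> macrostate n k" "x \<in> macrostate n k'"
  shows "k = k'"
  using assms by (auto simp: types_def macrostate_def spins_def)

lemma finite_Omega [simp]: "finite (\<Omega>_RGB n)" by (simp add: Omega_eq)

lemma sum_Omega: "(\<Sum>x\<in>\<Omega>_RGB n. F x) = (\<Sum>k\<in>types n. \<Sum>x\<in>macrostate n k. F x)"
  unfolding Omega_eq by (rule sum.UNION_disjoint) (auto dest: macrostate_disjoint)

lemma Z_eq: "Z_RGB n \<beta> = (\<Sum>k\<in>types n. weight n \<beta> k)"
  unfolding Z_RGB_def sum_Omega by (simp add: energy_macrostate weight_def boltzmann_def)

lemma all_ones_in_Omega: "(\<lambda>v\<in>{1..n}. 1) \<in> \<Omega>_RGB n"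
proof -
  have *: "{v \<in> {1..n}. restrict (\<lambda>v. 1) {1..n} v = m} = (if m = 1 then {1..n} else {})" for m
    by auto
  have "num_spins n (\<lambda>v\<in>{1..n}. 1) m = (if m = 1 then n else 0)" for m
    unfolding num_spins_def * by simp
  then show ?thesis by (auto simp: \<Omega>_RGB_def)
qed

lemma Z_pos: "Z_RGB n \<beta> > 0"
  unfolding Z_RGB_def using all_ones_in_Omega by (intro sum_pos) auto

lemma gibbs_pos: "gibbs n \<beta> x > 0" by (simp add: gibbs_def Z_pos)

lemma gibbs_macrostate: "x \<in> macrostate n k \<Longrightarrow> gibbs n \<beta> x = boltzmann \<beta> k / Z_RGB n \<beta>"
  by (simp add: gibbs_def boltzmann_def energy_macrostate)

lemma sum_gibbs: "(\<Sum>x\<in>\<Omega>_RGB n. gibbs n \<beta> x) = 1"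
  using Z_pos[of n \<beta>] by (simp add: gibbs_def sum_divide_distrib[symmetric] Z_RGB_def)

lemma sum_gibbs_macrostate: "(\<Sum>x\<in>macrostate n k. gibbs n \<beta> x) = weight n \<beta> k / Z_RGB n \<beta>"
  by (simp add: gibbs_macrostate weight_def)

section \<open>The Metropolis and tempering kernels\<close>

text \<open>For \<open>x \<noteq> y\<close> there is at most one such vertex; keeping the
  cardinality in the kernel formula covers neighbours and non-neighbours alike.\<close>

definition sites :: "nat \<Rightarrow> (nat \<Rightarrow> nat) \<Rightarrow> (nat \<Rightarrow> nat) \<Rightarrow> nat set" where
  "sites n x y = {v \<in> {1..n}. \<forall>u. u \<noteq> v \<longrightarrow> x u = y u}"

lemma finite_sites [simp]: "finite (sites n x y)"
  by (rule finite_subset[of _ "{1..n}"]) (auto simp: sites_def)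

lemma sites_sym: "sites n x y = sites n y x"
  by (auto simp: sites_def)

lemma Omega_spin: "x \<in> \<Omega>_RGB n \<Longrightarrow> v \<in> {1..n} \<Longrightarrow> x v \<in> spins"
  unfolding \<Omega>_RGB_def spins_set by (blast dest: PiE_mem)

lemma pmf_coin:
  "pmf (bind_pmf (bernoulli_pmf (1/2)) g) z = (pmf (g True) z + pmf (g False) z) / 2"
  by (simp add: pmf_bind)

lemma pmf_accept:
  assumes "0 \<le> p" "p \<le> 1"
  shows "pmf (bind_pmf (bernoulli_pmf p) (\<lambda>b. return_pmf (if b then y else x))) z
    = p * (if y = z then 1 else 0) + (1 - p) * (if x = z then 1 else 0)"
  using assms by (simp add: pmf_bind indicator_def)

lemma set_metropolis:
  assumes "n \<ge> 1" "x \<in> \<Omega>_RGB n"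
  shows "set_pmf (metropolis n \<rho> x) \<subseteq> \<Omega>_RGB n"
  using assms unfolding metropolis_def by (auto simp: Let_def split: if_splits)

lemma pmf_metropolis:
  assumes n: "n \<ge> 1" and xy: "x \<in> \<Omega>_RGB n" "y \<in> \<Omega>_RGB n" "x \<noteq> y"
    and \<rho>: "\<And>x. x \<in> \<Omega>_RGB n \<Longrightarrow> \<rho> x > 0"
  shows "pmf (metropolis n \<rho> x) y = card (sites n x y) / (3 * real n) * min 1 (\<rho> y / \<rho> x)"
proof -
  let ?a = "min 1 (\<rho> y / \<rho> x)"
  let ?f = "\<lambda>v s. let y = x(v := s) in if y \<notin> \<Omega>_RGB n then return_pmf x
     else do { accept \<leftarrow> bernoulli_pmf (min 1 (\<rho> y / \<rho> x)); return_pmf (if accept then y else x) }"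
  have a: "0 \<le> ?a" "?a \<le> 1" using \<rho>[OF xy(1)] \<rho>[OF xy(2)] by auto
  have f: "pmf (?f v s) y = (if s = y v \<and> (\<forall>u. u \<noteq> v \<longrightarrow> x u = y u) then ?a else 0)" for v s
  proof (cases "x(v := s) = y")
    case True
    then have "s = y v \<and> (\<forall>u. u \<noteq> v \<longrightarrow> x u = y u)" by auto
    then show ?thesis using True xy a by (simp add: Let_def pmf_accept)
  next
    case False
    then have "x(v := s) \<noteq> y" .
    moreover have "x(v := s) = y" if "s = y v \<and> (\<forall>u. u \<noteq> v \<longrightarrow> x u = y u)"
      by (rule ext) (use that in auto)
    ultimately have no: "(s = y v \<and> (\<forall>u. u \<noteq> v \<longrightarrow> x u = y u)) = False" by blast
    have "0 \<le> min 1 (\<rho> (x(v := s)) / \<rho> x)" if "x(v := s) \<in> \<Omega>_RGB n"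
      using \<rho>[OF that] \<rho>[OF xy(1)] by auto
    then show ?thesis unfolding no if_False using False xy by (simp add: Let_def pmf_accept)
  qed
  have "pmf (metropolis n \<rho> x) y = (\<Sum>v\<in>{1..n}. (\<Sum>s\<in>spins. pmf (?f v s) y) / 3) / real n"
    unfolding metropolis_def spins_set using n by (simp add: pmf_bind_pmf_of_set)
  also have "(\<Sum>v\<in>{1..n}. (\<Sum>s\<in>spins. pmf (?f v s) y) / 3) = (\<Sum>v\<in>sites n x y. ?a / 3)"
  proof -
    have "(\<Sum>s\<in>spins. pmf (?f v s) y) = (if v \<in> sites n x y then ?a else 0)" if "v \<in> {1..n}" for v
    proof -
      have "(\<Sum>s\<in>spins. pmf (?f v s) y) = (\<Sum>s\<in>spins. if s = y v then (if v \<in> sites n x y then ?a else 0) else 0)"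
        unfolding f using that by (intro sum.cong) (auto simp: sites_def)
      then show ?thesis using Omega_spin[OF xy(2) that] by simp
    qed
    then have "(\<Sum>v\<in>{1..n}. (\<Sum>s\<in>spins. pmf (?f v s) y) / 3)
        = (\<Sum>v\<in>{1..n}. if v \<in> sites n x y then ?a / 3 else 0)" by (intro sum.cong) auto
    also have "\<dots> = (\<Sum>v\<in>sites n x y. ?a / 3)"
      by (rule sum.mono_neutral_cong_right) (auto simp: sites_def)
    finally show ?thesis .
  qed
  finally show ?thesis by (simp add: field_simps)
qed

text \<open>Whatever vertex is drawn, its present colour is proposed with probability 1/3. This
  inherent laziness replaces an explicit lazy step.\<close>

lemma pmf_metropolis_self:
  assumes n: "n \<ge> 1" and x: "x \<in> \<Omega>_RGB n"
  shows "pmf (metropolis n \<rho> x) x \<ge> 1/3"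
proof -
  let ?f = "\<lambda>v s. let y = x(v := s) in if y \<notin> \<Omega>_RGB n then return_pmf x
     else do { accept \<leftarrow> bernoulli_pmf (min 1 (\<rho> y / \<rho> x)); return_pmf (if accept then y else x) }"
  define X where "X = (\<Sum>v\<in>{1..n}. (\<Sum>s\<in>spins. pmf (?f v s) x) / 3)"
  have "1 \<le> (\<Sum>s\<in>spins. pmf (?f v s) x)" if "v \<in> {1..n}" for v
  proof -
    have "pmf (?f v (x v)) x \<le> (\<Sum>s\<in>spins. pmf (?f v s) x)"
      using Omega_spin[OF x that] by (intro member_le_sum) auto
    then show ?thesis using x by (simp add: Let_def)
  qed
  then have "(\<Sum>v\<in>{1..n}. 1 / 3) \<le> X"
    unfolding X_def by (intro sum_mono divide_right_mono) auto
  then have "real n / 3 \<le> X" by simp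
  moreover have "pmf (metropolis n \<rho> x) x = X / real n"
    unfolding X_def metropolis_def spins_set using n by (simp add: pmf_bind_pmf_of_set)
  ultimately show ?thesis using n divide_right_mono[of "real n / 3" X "real n"] by simp
qed

lemma min_ratio_symmetric:
  fixes a b :: real
  assumes "a > 0" "b > 0"
  shows "a * min 1 (b / a) = min a b"
  using assms by (auto simp: min_def field_simps)

lemma metropolis_reversible:
  assumes "n \<ge> 1" "x \<in> \<Omega>_RGB n" "y \<in> \<Omega>_RGB n"
  shows "gibbs n \<beta> x * pmf (metropolis n (gibbs n \<beta>) x) y
    = gibbs n \<beta> y * pmf (metropolis n (gibbs n \<beta>) y) x"
proof (cases "x = y")
  case False
  then show ?thesis
    using min_ratio_symmetric[of "gibbs n \<beta> x" "gibbs n \<beta> y"]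
      min_ratio_symmetric[of "gibbs n \<beta> y" "gibbs n \<beta> x"] assms
    by (simp add: pmf_metropolis gibbs_pos sites_sym[of n y x] min.commute)
qed simp

lemma metropolis_chain:
  assumes "n \<ge> 1"
  shows "reversible_chain (\<Omega>_RGB n) (metropolis n (gibbs n \<beta>)) (gibbs n \<beta>)"
  using assms all_ones_in_Omega[of n]
  by unfold_locales
     (auto simp: gibbs_pos sum_gibbs metropolis_reversible[OF assms]
       dest: set_metropolis[OF assms, THEN subsetD])

lemma gibbs_metropolis_ge:
  assumes n: "n \<ge> 1" and x: "x \<in> \<Omega>_RGB n" "x(v := s) \<in> \<Omega>_RGB n" and v: "v \<in> {1..n}" "x v \<noteq> s"
  shows "gibbs n \<beta> x * pmf (metropolis n (gibbs n \<beta>) x) (x(v := s))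
    \<ge> min (gibbs n \<beta> x) (gibbs n \<beta> (x(v := s))) / (3 * real n)"
proof -
  have ne: "x \<noteq> x(v := s)" using v by (metis fun_upd_same)
  have "v \<in> sites n x (x(v := s))" using v by (simp add: sites_def)
  then have "card (sites n x (x(v := s))) \<ge> 1"
    using card_gt_0_iff[of "sites n x (x(v := s))"] by (auto simp: Suc_le_eq)
  then have "min (gibbs n \<beta> x) (gibbs n \<beta> (x(v := s))) * 1
      \<le> min (gibbs n \<beta> x) (gibbs n \<beta> (x(v := s))) * card (sites n x (x(v := s)))"
    by (intro mult_left_mono) (auto simp: gibbs_pos less_imp_le)
  also have "\<dots> = gibbs n \<beta> x * min 1 (gibbs n \<beta> (x(v := s)) / gibbs n \<beta> x)
      * card (sites n x (x(v := s)))"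
    by (simp add: min_ratio_symmetric gibbs_pos)
  finally show ?thesis
    using n x ne by (simp add: pmf_metropolis gibbs_pos divide_right_mono mult_ac)
qed

section \<open>One-step probabilities and reversibility of tempering\<close>

lemma pmf_tag: "pmf (map_pmf (\<lambda>x'. (x', i)) p) (y, j) = (if j = i then pmf p y else 0)"
proof (cases "j = i")
  case True then show ?thesis by (simp add: pmf_map_inj'[of "\<lambda>x'. (x', i)" p y] inj_def)
next
  case False
  then have "(y, j) \<notin> set_pmf (map_pmf (\<lambda>x'. (x', i)) p)" by auto
  then show ?thesis using False pmf_eq_0_set_pmf[of "map_pmf (\<lambda>x'. (x', i)) p" "(y, j)"] by simp
qed

text \<open>Off the diagonal all rejections drop out. Each 1/4 is the branch coin times the laziness
  coin or the direction coin; \<open>i = j + 1\<close> already excludes a downward move from level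
  0.\<close>

lemma pmf_tempering:
  assumes "(y, j) \<noteq> (x, i)"
  shows "pmf (tempering n \<beta>s M (x, i)) (y, j) =
    (if j = i then 1/4 * pmf (metropolis n (gibbs n (inv_temp \<beta>s M i)) x) y else 0) +
    (if y = x \<and> (j = i + 1 \<and> i \<noteq> M \<or> i = j + 1)
     then 1/4 * min 1 (gibbs n (inv_temp \<beta>s M j) x / gibbs n (inv_temp \<beta>s M i) x) else 0)"
proof -
  have acc: "0 \<le> min 1 (gibbs n b x / gibbs n c x)" "min 1 (gibbs n b x / gibbs n c x) \<le> 1" for b c
    using gibbs_pos[of n b x] gibbs_pos[of n c x] by auto
  have acc': "pmf (bind_pmf (bernoulli_pmf (min 1 (gibbs n b x / gibbs n c x)))
      (\<lambda>a. return_pmf (if a then (x, k) else (x, i)))) (y, j)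
    = (if k = j \<and> y = x then min 1 (gibbs n b x / gibbs n c x) else 0)" for b c k
    using assms by (subst pmf_accept[OF acc]) auto
  have 1: "pmf (level_move n \<beta>s M (x, i)) (y, j)
      = (if j = i then 1/2 * pmf (metropolis n (gibbs n (inv_temp \<beta>s M i)) x) y else 0)"
    using assms by (auto simp: level_move_def pmf_coin pmf_tag)
  have 2: "pmf (temperature_move n \<beta>s M (x, i)) (y, j)
      = (if y = x \<and> (j = i + 1 \<and> i \<noteq> M \<or> i = j + 1)
     then 1/2 * min 1 (gibbs n (inv_temp \<beta>s M j) x / gibbs n (inv_temp \<beta>s M i) x) else 0)"
  proof -
    let ?a = "\<lambda>k. min 1 (gibbs n (inv_temp \<beta>s M k) x / gibbs n (inv_temp \<beta>s M i) x)"
    have "pmf (temperature_move n \<beta>s M (x, i)) (y, j)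
        = ((if i \<noteq> M \<and> i + 1 = j \<and> y = x then ?a (i + 1) else 0)
          + (if i \<noteq> 0 \<and> i - 1 = j \<and> y = x then ?a (i - 1) else 0)) / 2"
      unfolding temperature_move_def case_prod_conv pmf_coin
      by (cases "i = M"; cases "i = 0")
         (use assms in \<open>auto simp: Let_def acc' indicator_def\<close>)
    also have "\<dots> = (if y = x \<and> (j = i + 1 \<and> i \<noteq> M \<or> i = j + 1) then 1/2 * ?a j else 0)"
      by (cases "y = x"; cases "j = i + 1"; cases "i = j + 1") auto
    finally show ?thesis .
  qed
  show ?thesis by (auto simp: tempering_def pmf_coin 1 2)
qed

lemma set_tempering:
  assumes n: "n \<ge> 1" and z: "z \<in> tempering_states n M"
  shows "set_pmf (tempering n \<beta>s M z) \<subseteq> tempering_states n M"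
proof -
  obtain x i where [simp]: "z = (x, i)" and x: "x \<in> \<Omega>_RGB n" and i: "i \<le> M"
    using z by (auto simp: tempering_states_def)
  have "set_pmf (level_move n \<beta>s M z) \<subseteq> tempering_states n M"
    using x i
    by (auto simp: level_move_def tempering_states_def split: if_splits
        dest: set_metropolis[OF n x, THEN subsetD])
  moreover have "set_pmf (temperature_move n \<beta>s M z) \<subseteq> tempering_states n M"
    using x i by (auto simp: temperature_move_def tempering_states_def Let_def split: if_splits)
  ultimately show ?thesis by (auto simp: tempering_def split: if_splits)
qed

lemma tempering_chain:
  assumes n: "n \<ge> 1"
  shows "reversible_chain (tempering_states n M) (tempering n \<beta>s M) (tempering_stationary n \<beta>s M)"
proof
  show "finite (tempering_states n M)" by (simp add: tempering_states_def)
  show "tempering_states n M \<noteq> {}" using all_ones_in_Omega[of n] by (auto simp: tempering_states_def)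
  show "set_pmf (tempering n \<beta>s M z) \<subseteq> tempering_states n M" if "z \<in> tempering_states n M" for z
    by (rule set_tempering[OF n that])
  show "tempering_stationary n \<beta>s M z > 0" for z
    by (cases z) (simp add: tempering_stationary_def gibbs_pos)
  have "(\<Sum>z\<in>tempering_states n M. tempering_stationary n \<beta>s M z)
      = (\<Sum>i\<in>{0..M}. \<Sum>x\<in>\<Omega>_RGB n. gibbs n (inv_temp \<beta>s M i) x / real (M + 1))"
    unfolding tempering_states_def tempering_stationary_def
    by (subst sum.swap) (simp add: sum.cartesian_product case_prod_beta)
  also have "\<dots> = 1" unfolding sum_divide_distrib[symmetric] sum_gibbs by simp
  finally show "(\<Sum>z\<in>tempering_states n M. tempering_stationary n \<beta>s M z) = 1" .
  fix z z' assume z: "z \<in> tempering_states n M" "z' \<in> tempering_states n M"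
  obtain x i y j where [simp]: "z = (x, i)" "z' = (y, j)"
    and x: "x \<in> \<Omega>_RGB n" "y \<in> \<Omega>_RGB n" and i: "i \<le> M" "j \<le> M"
    using z by (auto simp: tempering_states_def)
  show "tempering_stationary n \<beta>s M z * pmf (tempering n \<beta>s M z) z'
      = tempering_stationary n \<beta>s M z' * pmf (tempering n \<beta>s M z') z"
  proof (cases "z = z'")
    case False
    let ?g = "\<lambda>i. gibbs n (inv_temp \<beta>s M i) x"
    have g: "?g i * min 1 (?g j / ?g i) = ?g j * min 1 (?g i / ?g j)"
      using min_ratio_symmetric[of "?g i" "?g j"] min_ratio_symmetric[of "?g j" "?g i"]
      by (simp add: gibbs_pos min.commute)
    have "(x, i) \<noteq> (y, j)" "(y, j) \<noteq> (x, i)" using False by auto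
    note p = pmf_tempering[OF this(1), of n \<beta>s M] pmf_tempering[OF this(2), of n \<beta>s M]
    consider "i = j" "x \<noteq> y" | "i \<noteq> j" "x = y" | "i \<noteq> j" "x \<noteq> y" using False by auto
    then show ?thesis
    proof cases
      case 1
      then show ?thesis using metropolis_reversible[OF n x, of "inv_temp \<beta>s M i"]
        unfolding \<open>z = (x, i)\<close> \<open>z' = (y, j)\<close> p
        by (simp add: tempering_stationary_def field_simps)
    next
      case 2
      \<comment> \<open>For levels between 0 and \<open>M\<close> the upper boundary test holds by
        itself, so adjacency is symmetric.\<close>
      have s: "(j = i + 1 \<and> i \<noteq> M \<or> i = j + 1) = (i = j + 1 \<and> j \<noteq> M \<or> j = i + 1)"
        using i by auto
      show ?thesis using 2 g unfolding \<open>z = (x, i)\<close> \<open>z' = (y, j)\<close> p s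
        by (simp add: tempering_stationary_def field_simps)
    qed (simp add: p)
  qed simp
qed

lemma pmf_tempering_self:
  assumes "z \<in> tempering_states n M"
  shows "pmf (tempering n \<beta>s M z) z \<ge> 1/4"
proof -
  have "1/2 \<le> pmf (level_move n \<beta>s M z) z"
    by (cases z) (simp add: level_move_def pmf_coin)
  also have "\<dots> \<le> 2 * pmf (tempering n \<beta>s M z) z"
    by (simp add: tempering_def pmf_coin)
  finally show ?thesis by simp
qed

section \<open>Poincare inequality for the Metropolis chain\<close>

lemma (in reversible_chain) sum_edges_le_dirichlet:
  assumes "finite A" "inj_on g A" "g ` A \<subseteq> S \<times> S"
    and "\<And>a x y. a \<in> A \<Longrightarrow> g a = (x, y) \<Longrightarrow> F a \<le> \<pi> x * pmf (K x) y * (f x - f y)\<^sup>2"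
  shows "(\<Sum>a\<in>A. F a) \<le> dirichlet f"
proof -
  let ?w = "\<lambda>(x, y). \<pi> x * pmf (K x) y * (f x - f y)\<^sup>2"
  have "(\<Sum>a\<in>A. F a) \<le> (\<Sum>a\<in>A. ?w (g a))"
    using assms(4) by (intro sum_mono) (auto split: prod.split)
  also have "\<dots> = (\<Sum>e\<in>g ` A. ?w e)" using assms(2) by (simp add: sum.reindex)
  also have "\<dots> \<le> (\<Sum>e\<in>S \<times> S. ?w e)"
    using assms fin pos by (intro sum_mono2) (auto simp: less_imp_le)
  also have "\<dots> = dirichlet f" by (simp add: dirichlet_def sum.cartesian_product)
  finally show ?thesis .
qed

abbreviation "metropolis_dirichlet n \<beta> \<equiv>
  reversible_chain.dirichlet (\<Omega>_RGB n) (metropolis n (gibbs n \<beta>)) (gibbs n \<beta>)"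

text \<open>The square root turns the average into an L2 norm, so that losses along a route add up
  by the triangle inequality.\<close>

definition rms :: "nat \<Rightarrow> ((nat \<Rightarrow> nat) \<Rightarrow> real) \<Rightarrow> real \<Rightarrow> (nat \<Rightarrow> nat) \<Rightarrow> real" where
  "rms n f c k = sqrt ((\<Sum>x\<in>macrostate n k. (f x - c)\<^sup>2) / card (macrostate n k))"

lemma macrostate_subset_Omega: "k \<in> types n \<Longrightarrow> macrostate n k \<subseteq> \<Omega>_RGB n"
  by (auto simp: Omega_eq)

lemma sum_incidences_le_dirichlet:
  assumes n: "n \<ge> 1" and ij: "i \<noteq> j" "i \<in> spins" "j \<in> spins" "k i > 0"
    and k: "k \<in> types n" "respin i j k \<in> types n"
    and g: "g \<le> boltzmann \<beta> k / Z_RGB n \<beta>" "g \<le> boltzmann \<beta> (respin i j k) / Z_RGB n \<beta>"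
  shows "g * (\<Sum>(x, v)\<in>incidences n i k. (f x - f (x(v := j)))\<^sup>2) \<le> 3 * real n * metropolis_dirichlet n \<beta> f"
proof -
  interpret reversible_chain "\<Omega>_RGB n" "metropolis n (gibbs n \<beta>)" "gibbs n \<beta>"
    by (rule metropolis_chain[OF n])
  let ?e = "\<lambda>(x, v). (x, x(v := j))"
  have *: "g / (3 * real n) * (f x - f (x(v := j)))\<^sup>2
      \<le> gibbs n \<beta> x * pmf (metropolis n (gibbs n \<beta>) x) (x(v := j)) * (f x - f (x(v := j)))\<^sup>2"
    if "(x, v) \<in> incidences n i k" for x v
  proof (rule mult_right_mono)
    have x: "x \<in> macrostate n k" "v \<in> {1..n}" "x v = i" using that by (auto simp: incidences_def)
    have y: "x(v := j) \<in> macrostate n (respin i j k)" using x ij by (intro macrostate_upd)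
    have "g / (3 * real n) \<le> min (gibbs n \<beta> x) (gibbs n \<beta> (x(v := j))) / (3 * real n)"
      using g by (intro divide_right_mono) (auto simp: gibbs_macrostate[OF x(1)] gibbs_macrostate[OF y])
    also have "\<dots> \<le> gibbs n \<beta> x * pmf (metropolis n (gibbs n \<beta>) x) (x(v := j))"
      using x y k ij macrostate_subset_Omega by (intro gibbs_metropolis_ge n) auto
    finally show "g / (3 * real n) \<le> gibbs n \<beta> x * pmf (metropolis n (gibbs n \<beta>) x) (x(v := j))" .
  qed simp
  have "(\<Sum>a\<in>incidences n i k. case a of (x, v) \<Rightarrow> g / (3 * real n) * (f x - f (x(v := j)))\<^sup>2) \<le> dirichlet f"
  proof (rule sum_edges_le_dirichlet[where g = ?e])
    \<comment> \<open>The vertex is recovered as the place where the two configurations differ,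
      because \<open>i \<noteq> j\<close>.\<close>
    show "inj_on ?e (incidences n i k)"
    proof (rule inj_onI, clarsimp)
      fix x v w assume "(x, v) \<in> incidences n i k" "(x, w) \<in> incidences n i k" "x(v := j) = x(w := j)"
      then show "v = w" using ij(1) by (auto simp: incidences_def dest: fun_cong[of _ _ v] split: if_splits)
    qed
    show "?e ` incidences n i k \<subseteq> \<Omega>_RGB n \<times> \<Omega>_RGB n"
      using macrostate_subset_Omega k macrostate_upd ij by (fastforce simp: incidences_def)
  qed (use * in auto)
  also have "(\<Sum>a\<in>incidences n i k. case a of (x, v) \<Rightarrow> g / (3 * real n) * (f x - f (x(v := j)))\<^sup>2)
     = g * (\<Sum>(x, v)\<in>incidences n i k. (f x - f (x(v := j)))\<^sup>2) / (3 * real n)"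
    by (simp add: sum_distrib_left sum_divide_distrib case_prod_beta)
  finally show ?thesis using n by (simp add: field_simps)
qed

text \<open>The uniform measure on the incidences projects to the uniform measure on each of the two
  macrostates. Both values of \<open>rms\<close> are therefore norms over the same set with the same
  factor 1 / sqrt M, and the triangle inequality leaves only differences of \<open>f\<close> across
  edges.\<close>

lemma rms_step:
  assumes n: "n \<ge> 1" and ij: "i \<noteq> j" "i \<in> spins" "j \<in> spins" "k i > 0"
    and k: "k \<in> types n" "respin i j k \<in> types n"
    and m: "0 < m" "m \<le> weight n \<beta> k" "m \<le> weight n \<beta> (respin i j k)"
  shows "rms n f c k \<le> rms n f c (respin i j k)
    + sqrt (3 * real n * Z_RGB n \<beta> * metropolis_dirichlet n \<beta> f / m)"
proof -
  let ?k' = "respin i j k" and ?E = "incidences n i k"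
  define N where "N = real (card (macrostate n k))"
  define N' where "N' = real (card (macrostate n ?k'))"
  define M where "M = real (k i) * N"
  have "weight n \<beta> k > 0" "weight n \<beta> ?k' > 0" using m by auto
  then have N: "N > 0" "N' > 0" by (auto simp: N_def N'_def weight_def zero_less_mult_iff)
  have M': "M = real (k j + 1) * N'"
    using card_macrostate_respin[of i j k n, OF ij] by (simp add: M_def N_def N'_def)
  have M: "M > 0" "N \<le> M" "N' \<le> M"
    using N ij M_def mult_right_mono[of 1 "real (k i)" N] mult_right_mono[of 1 "real (k j + 1)" N'] M'
    by auto
  have 1: "rms n f c k = L2_set (\<lambda>(x, v). f x - c) ?E / sqrt M"
  proof -
    have "L2_set (\<lambda>(x, v). f x - c) ?E = sqrt (real (k i) * (\<Sum>x\<in>macrostate n k. (f x - c)\<^sup>2))"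
      unfolding L2_set_def using sum_incidences[OF ij(2), of "\<lambda>x. (f x - c)\<^sup>2" n k]
      by (simp add: case_prod_beta)
    then show ?thesis using ij unfolding M_def N_def rms_def
      by (simp add: real_sqrt_mult real_sqrt_divide)
  qed
  have 2: "rms n f c ?k' = L2_set (\<lambda>(x, v). f (x(v := j)) - c) ?E / sqrt M"
  proof -
    have "L2_set (\<lambda>(x, v). f (x(v := j)) - c) ?E
        = sqrt (real (k j + 1) * (\<Sum>x\<in>macrostate n ?k'. (f x - c)\<^sup>2))"
      unfolding L2_set_def
      using sum_incidences_respin[of i j k "\<lambda>x. (f x - c)\<^sup>2" n, OF ij] by (simp add: case_prod_beta)
    then show ?thesis unfolding M' N'_def rms_def
      by (simp add: real_sqrt_mult real_sqrt_divide)
  qed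
  define g where "g = min (boltzmann \<beta> k) (boltzmann \<beta> ?k') / Z_RGB n \<beta>"
  have Z: "Z_RGB n \<beta> > 0" by (rule Z_pos)
  have g: "g > 0" "g \<le> boltzmann \<beta> k / Z_RGB n \<beta>" "g \<le> boltzmann \<beta> ?k' / Z_RGB n \<beta>"
    using Z by (auto simp: g_def boltzmann_def intro!: divide_right_mono)
  \<comment> \<open>There are at least as many edges as configurations on either side, so the
    smaller Boltzmann factor, counted per edge, still reaches \<open>m\<close>.\<close>
  have "m \<le> M * min (boltzmann \<beta> k) (boltzmann \<beta> ?k')"
  proof (cases "boltzmann \<beta> k \<le> boltzmann \<beta> ?k'")
    case True
    have "N * boltzmann \<beta> k \<le> M * boltzmann \<beta> k"
      using M(2) by (intro mult_right_mono) (auto simp: boltzmann_def)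
    then show ?thesis using m(2) True by (simp add: weight_def N_def min_def)
  next
    case False
    have "N' * boltzmann \<beta> ?k' \<le> M * boltzmann \<beta> ?k'"
      using M(3) by (intro mult_right_mono) (auto simp: boltzmann_def)
    then show ?thesis using m(3) False by (simp add: weight_def N'_def min_def)
  qed
  then have gM: "m \<le> M * g * Z_RGB n \<beta>" using Z by (simp add: g_def)
  let ?D = "metropolis_dirichlet n \<beta> f"
  have D: "?D \<ge> 0" by (rule reversible_chain.dirichlet_nonneg[OF metropolis_chain[OF n]])
  have "g * (\<Sum>(x, v)\<in>?E. (f x - f (x(v := j)))\<^sup>2) \<le> 3 * real n * ?D"
    by (rule sum_incidences_le_dirichlet[OF n ij k g(2,3)])
  then have "(\<Sum>(x, v)\<in>?E. (f x - f (x(v := j)))\<^sup>2) \<le> 3 * real n * ?D / g"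
    using g by (simp add: field_simps)
  then have "(\<Sum>(x, v)\<in>?E. (f x - f (x(v := j)))\<^sup>2) / M \<le> 3 * real n * ?D / g / M"
    using M by (intro divide_right_mono) auto
  also have "\<dots> = 3 * real n * ?D * Z_RGB n \<beta> / (M * g * Z_RGB n \<beta>)" using Z by simp
  also have "\<dots> \<le> 3 * real n * ?D * Z_RGB n \<beta> / m"
    using gM D Z m M g by (intro divide_left_mono) auto
  finally have "sqrt ((\<Sum>(x, v)\<in>?E. (f x - f (x(v := j)))\<^sup>2) / M) \<le> sqrt (3 * real n * Z_RGB n \<beta> * ?D / m)"
    by (simp add: mult_ac)
  then have 3: "L2_set (\<lambda>(x, v). f x - f (x(v := j))) ?E / sqrt M \<le> sqrt (3 * real n * Z_RGB n \<beta> * ?D / m)"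
    by (simp add: L2_set_def real_sqrt_divide case_prod_beta)
  have "L2_set (\<lambda>(x, v). f x - c) ?E
      = L2_set (\<lambda>a. (case a of (x, v) \<Rightarrow> f (x(v := j)) - c) + (case a of (x, v) \<Rightarrow> f x - f (x(v := j)))) ?E"
    by (intro L2_set_cong) auto
  also have "\<dots> \<le> L2_set (\<lambda>(x, v). f (x(v := j)) - c) ?E + L2_set (\<lambda>(x, v). f x - f (x(v := j))) ?E"
    by (rule L2_set_triangle_ineq)
  finally have "L2_set (\<lambda>(x, v). f x - c) ?E / sqrt M
      \<le> (L2_set (\<lambda>(x, v). f (x(v := j)) - c) ?E + L2_set (\<lambda>(x, v). f x - f (x(v := j))) ?E) / sqrt M"
    using M by (intro divide_right_mono) auto
  then show ?thesis using 3 unfolding 1 2 by (simp add: add_divide_distrib)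
qed

text \<open>The floor \<open>m\<close> on the weights and the length \<open>l\<close> are the only
  features of a path that the Poincare constant sees.\<close>

inductive route :: "nat \<Rightarrow> real \<Rightarrow> real \<Rightarrow> nat \<Rightarrow> (nat \<Rightarrow> nat) \<Rightarrow> (nat \<Rightarrow> nat) \<Rightarrow> bool" for n \<beta> m where
  route_refl: "route n \<beta> m 0 k k"
| route_step: "i \<noteq> j \<Longrightarrow> i \<in> spins \<Longrightarrow> j \<in> spins \<Longrightarrow> k i > 0 \<Longrightarrow> respin i j k \<in> types n \<Longrightarrow>
    m \<le> weight n \<beta> k \<Longrightarrow> m \<le> weight n \<beta> (respin i j k) \<Longrightarrow> route n \<beta> m l (respin i j k) k' \<Longrightarrow>
    route n \<beta> m (Suc l) k k'"

lemma route_trans: "route n \<beta> m l k k' \<Longrightarrow> route n \<beta> m l' k' k'' \<Longrightarrow> route n \<beta> m (l + l') k k''"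
  by (induction rule: route.induct) (auto intro: route_step)

lemma route_mono: "route n \<beta> m l k k' \<Longrightarrow> m' \<le> m \<Longrightarrow> route n \<beta> m' l k k'"
  by (induction rule: route.induct) (auto intro: route_refl route_step)

lemma rms_route:
  assumes n: "n \<ge> 1" and m: "0 < m" and r: "route n \<beta> m l k h" and k: "k \<in> types n"
  shows "rms n f c k \<le> rms n f c h
    + real l * sqrt (3 * real n * Z_RGB n \<beta> * metropolis_dirichlet n \<beta> f / m)"
  using r k
proof (induction rule: route.induct)
  case (route_step i j k l k')
  then show ?case using rms_step[OF n, of i j k m \<beta> f c] m by (simp add: algebra_simps)
qed simp

section \<open>Variance within a single macrostate\<close>

lemma macrostate_permute:
  assumes "\<sigma> permutes {1..n}" "x \<in> macrostate n k"
  shows "x \<circ> \<sigma> \<in> macrostate n k"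
proof -
  have "num_spins n (x \<circ> \<sigma>) m = num_spins n x m" for m
  proof -
    have im: "\<sigma> ` {v \<in> {1..n}. (x \<circ> \<sigma>) v = m} = {v \<in> {1..n}. x v = m}"
    proof (intro equalityI subsetI)
      fix w assume w: "w \<in> {v \<in> {1..n}. x v = m}"
      then obtain v where "v \<in> {1..n}" "w = \<sigma> v" using permutes_image[OF assms(1)] by blast
      then show "w \<in> \<sigma> ` {v \<in> {1..n}. (x \<circ> \<sigma>) v = m}" using w by auto
    qed (use permutes_in_image[OF assms(1)] in auto)
    have "inj_on \<sigma> {v \<in> {1..n}. (x \<circ> \<sigma>) v = m}"
      using permutes_inj[OF assms(1)] by (rule inj_on_subset) auto
    from card_image[OF this] show ?thesis unfolding im num_spins_def by (rule sym)
  qed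
  moreover have "x \<circ> \<sigma> \<in> {1..n} \<rightarrow>\<^sub>E spins"
  proof (rule PiE_I)
    fix v assume "v \<in> {1..n}"
    then have "\<sigma> v \<in> {1..n}" by (simp only: permutes_in_image[OF assms(1)])
    then show "(x \<circ> \<sigma>) v \<in> spins" using assms(2) by (auto simp: macrostate_def PiE_iff)
  next
    fix v assume v: "v \<notin> {1..n}"
    then have "\<sigma> v = v" by (rule permutes_not_in[OF assms(1)])
    then show "(x \<circ> \<sigma>) v = undefined" using v assms(2) by (auto simp: macrostate_def PiE_iff extensional_def)
  qed
  ultimately show ?thesis using assms(2) by (simp add: macrostate_def)
qed

lemma bij_macrostate_permute:
  assumes "\<sigma> permutes {1..n}"
  shows "bij_betw (\<lambda>x. x \<circ> \<sigma>) (macrostate n k) (macrostate n k)"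
  by (rule bij_betwI[where g = "\<lambda>x. x \<circ> inv \<sigma>"])
     (use assms in \<open>auto simp: o_assoc[symmetric] permutes_inv_o permutes_inv
        intro!: macrostate_permute simp del: o_apply\<close>)

text \<open>Equal colour counts mean equal multisets of values, and equal multisets are related by a
  permutation of the positions.\<close>

lemma macrostate_transitive:
  assumes "x \<in> macrostate n k" "y \<in> macrostate n k"
  obtains \<sigma> where "\<sigma> permutes {1..n}" "y = x \<circ> \<sigma>"
proof -
  have "image_mset y (mset_set {1..n}) = image_mset x (mset_set {1..n})"
  proof (rule multiset_eqI)
    fix m
    have "{v \<in> {1..n}. m = y v} = {v \<in> {1..n}. y v = m}" "{v \<in> {1..n}. m = x v} = {v \<in> {1..n}. x v = m}"
      by auto
    then have *: "count (image_mset y (mset_set {1..n})) m = num_spins n y m"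
      "count (image_mset x (mset_set {1..n})) m = num_spins n x m"
      by (simp_all add: num_spins_def count_image_mset' Int_def conj_commute)
    show "count (image_mset y (mset_set {1..n})) m = count (image_mset x (mset_set {1..n})) m"
    proof (cases "m \<in> spins")
      case True then show ?thesis using assms unfolding * by (simp add: macrostate_def)
    next
      case False
      then have "{v \<in> {1..n}. y v = m} = {}" "{v \<in> {1..n}. x v = m} = {}"
        using assms by (auto simp: macrostate_def PiE_iff)
      then show ?thesis unfolding * num_spins_def by (simp only: card.empty)
    qed
  qed
  then obtain p where p: "p permutes {1..n}" "\<forall>v\<in>{1..n}. y v = x (p v)"
    using image_mset_eq_implies_permutes[of "{1..n}" y x] by auto
  have "y v = (x \<circ> p) v" for v
    using p permutes_not_in[OF p(1)] assms
    by (cases "v \<in> {1..n}") (auto simp: macrostate_def PiE_iff extensional_def)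
  then show ?thesis using that[OF p(1)] by (simp add: fun_eq_iff)
qed

text \<open>The distance \<open>\<sigma> \<mapsto> \<parallel>f - f \<circ> \<sigma>\<parallel>\<close> is subadditive on the symmetric group, so it suffices to
  control it on transpositions; averaging over the group then bounds the variance of \<open>f\<close>.\<close>

lemma L2_set_mean_le:
  assumes D: "\<And>u w. u \<in> {1..n} \<Longrightarrow> w \<in> {1..n} \<Longrightarrow> u \<noteq> w \<Longrightarrow>
      L2_set (\<lambda>x. f x - f (x \<circ> Transposition.transpose u w)) (macrostate n k) \<le> D"
    and D0: "D \<ge> 0"
  shows "\<exists>c. L2_set (\<lambda>x. f x - c) (macrostate n k) \<le> real n * D"
proof -
  let ?M = "macrostate n k" and ?P = "{\<sigma>. \<sigma> permutes {1..n}}"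
  define L where "L = (\<lambda>\<sigma>. L2_set (\<lambda>x. f x - f (x \<circ> \<sigma>)) ?M)"
  have L_comp: "L (\<sigma> \<circ> \<tau>) \<le> L \<sigma> + L \<tau>" if "\<sigma> permutes {1..n}" for \<sigma> \<tau>
  proof -
    have "L (\<sigma> \<circ> \<tau>) = L2_set (\<lambda>x. (f x - f (x \<circ> \<sigma>)) + (f (x \<circ> \<sigma>) - f ((x \<circ> \<sigma>) \<circ> \<tau>))) ?M"
      unfolding L_def by (simp add: o_assoc)
    also have "\<dots> \<le> L \<sigma> + L2_set (\<lambda>x. f (x \<circ> \<sigma>) - f ((x \<circ> \<sigma>) \<circ> \<tau>)) ?M"
      unfolding L_def by (rule L2_set_triangle_ineq)
    also have "L2_set (\<lambda>x. f (x \<circ> \<sigma>) - f ((x \<circ> \<sigma>) \<circ> \<tau>)) ?M = L \<tau>"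
      unfolding L_def L2_set_def
      using sum.reindex_bij_betw[OF bij_macrostate_permute[OF that, of k], of "\<lambda>x. (f x - f (x \<circ> \<tau>))\<^sup>2"]
      by simp
    finally show ?thesis .
  qed
  have L_le: "L \<sigma> \<le> real (card A) * D" if "finite A" "A \<subseteq> {1..n}" "\<sigma> permutes A" for A \<sigma>
    using that
  proof (induction A arbitrary: \<sigma>)
    case empty
    then show ?case by (simp add: L_def L2_set_def o_def)
  next
    case (insert a A)
    \<comment> \<open>\<open>\<tau>\<close> brings the image of \<open>a\<close> back to
      \<open>a\<close>, so \<open>p\<close> fixes \<open>a\<close> and the induction peels off one
      transposition per point.\<close>
    define \<tau> where "\<tau> = Transposition.transpose a (\<sigma> a)"
    define p where "p = \<tau> \<circ> \<sigma>"
    have p: "p permutes A" unfolding p_def \<tau>_def using insert by (intro permutes_insert_lemma)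
    have sa: "\<sigma> a \<in> {1..n}" using insert permutes_in_image[OF insert.prems(2), of a] by auto
    have \<tau>: "\<tau> permutes {1..n}" unfolding \<tau>_def using insert sa by (intro permutes_swap_id) auto
    have \<sigma>: "\<sigma> = \<tau> \<circ> p" by (simp add: p_def \<tau>_def o_assoc)
    have "L \<tau> \<le> D"
    proof (cases "a = \<sigma> a")
      case True
      then have "\<tau> = id" unfolding \<tau>_def by (metis transpose_same)
      then show ?thesis using D0 by (simp add: L_def L2_set_def)
    next
      case False
      then show ?thesis unfolding L_def \<tau>_def using insert sa by (intro D) auto
    qed
    moreover have "L \<sigma> \<le> L \<tau> + L p" unfolding \<sigma> by (rule L_comp[OF \<tau>])
    ultimately show ?case using insert.IH[OF _ p] insert.hyps insert.prems
      by (simp add: algebra_simps)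
  qed
  have finP: "finite ?P" by (rule finite_permutations) simp
  have P: "card ?P > 0" using finP permutes_id card_gt_0_iff by blast
  show ?thesis
  proof (cases "?M = {}")
    case False
    then obtain x0 where x0: "x0 \<in> ?M" by blast
    \<comment> \<open>The average of \<open>f\<close> over the orbit of \<open>x0\<close>; by
      transitivity it is the same for every base point, so it can serve as a common centre.\<close>
    define c where "c = (\<Sum>\<sigma>\<in>?P. f (x0 \<circ> \<sigma>)) / card ?P"
    have c: "c = (\<Sum>\<sigma>\<in>?P. f (x \<circ> \<sigma>)) / card ?P" if x: "x \<in> ?M" for x
    proof -
      obtain \<rho> where \<rho>: "\<rho> permutes {1..n}" "x = x0 \<circ> \<rho>" using macrostate_transitive[OF x0 x] .
      show ?thesis unfolding c_def \<rho>(2)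
        using setum_permutations_compose_left[OF \<rho>(1), of "\<lambda>\<sigma>. f (x0 \<circ> \<sigma>)"] by (simp add: o_assoc)
    qed
    have "(f x - c)\<^sup>2 \<le> (\<Sum>\<sigma>\<in>?P. (f x - f (x \<circ> \<sigma>))\<^sup>2) / card ?P" if "x \<in> ?M" for x
    proof -
      have "f x - c = (\<Sum>\<sigma>\<in>?P. 1 / card ?P * (f x - f (x \<circ> \<sigma>)))"
        unfolding c[OF that] using P
        by (simp add: sum_divide_distrib[symmetric] sum_subtractf diff_divide_distrib)
      then have "(f x - c)\<^sup>2 \<le> (\<Sum>\<sigma>\<in>?P. 1 / card ?P) * (\<Sum>\<sigma>\<in>?P. 1 / card ?P * (f x - f (x \<circ> \<sigma>))\<^sup>2)"
        using weighted_cauchy_schwarz[of ?P "\<lambda>_. 1 / card ?P" "\<lambda>\<sigma>. f x - f (x \<circ> \<sigma>)"] by simp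
      then show ?thesis using P by (simp add: sum_divide_distrib)
    qed
    then have "(\<Sum>x\<in>?M. (f x - c)\<^sup>2) \<le> (\<Sum>x\<in>?M. (\<Sum>\<sigma>\<in>?P. (f x - f (x \<circ> \<sigma>))\<^sup>2) / card ?P)"
      by (rule sum_mono)
    also have "\<dots> = (\<Sum>\<sigma>\<in>?P. (L \<sigma>)\<^sup>2) / card ?P"
      unfolding sum_divide_distrib[symmetric] L_def L2_set_def
      by (subst sum.swap) (simp add: sum_nonneg)
    also have "\<dots> \<le> (\<Sum>\<sigma>\<in>?P. (real n * D)\<^sup>2) / card ?P"
      using L_le[of "{1..n}"] by (intro divide_right_mono sum_mono power_mono) (auto simp: L_def)
    also have "\<dots> = (real n * D)\<^sup>2" using P by simp
    finally have "L2_set (\<lambda>x. f x - c) ?M \<le> real n * D"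
      unfolding L2_set_def using D0 by (intro real_le_lsqrt) (auto intro: sum_nonneg)
    then show ?thesis ..
  qed (use D0 in simp)
qed

text \<open>One recolouring lowers the energy by at most n, which at \<beta> = \<mu> / n is a
  constant factor.\<close>

lemma boltzmann_respin_ge:
  assumes "i \<noteq> j" "i \<in> spins" "j \<in> spins" "k i > 0" "k i \<le> n" "\<beta> \<ge> 0"
  shows "boltzmann \<beta> k * exp (- \<beta> * real n) \<le> boltzmann \<beta> (respin i j k)"
proof -
  have "- \<beta> * real n \<le> \<beta> * (real (k j) - real (k i) + 1)"
    using mult_left_mono[of "- real n" "real (k j) - real (k i) + 1" \<beta>] assms by simp
  then show ?thesis unfolding boltzmann_def pair_energy_respin[of i j k, OF assms(1-4)]
    by (simp add: exp_add[symmetric] algebra_simps)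
qed

text \<open>Exchanging two colours takes two recolourings, and the order in which they are made
  decides whether the intermediate counts stay ordered. The gap \<open>b + 2 \<le> a\<close> is what
  a move from colour 1 to colour 2 needs.\<close>

lemma swap_two_steps:
  assumes n: "n \<ge> 1" and \<beta>: "\<beta> \<ge> 0" and h: "h = triple a b c" "h \<in> types n" "b + 2 \<le> a"
    and x: "x \<in> macrostate n h" and uw: "u \<in> {1..n}" "w \<in> {1..n}" "u \<noteq> w"
  defines "y \<equiv> x \<circ> Transposition.transpose u w"
  defines "g \<equiv> boltzmann \<beta> h * exp (- \<beta> * real n) / Z_RGB n \<beta> / (3 * real n)"
  shows "\<exists>z\<in>\<Omega>_RGB n. (z = x \<or> g \<le> gibbs n \<beta> x * pmf (metropolis n (gibbs n \<beta>) x) z) \<and>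
    (z = y \<or> g \<le> gibbs n \<beta> z * pmf (metropolis n (gibbs n \<beta>) z) y)"
proof -
  have x\<Omega>: "x \<in> \<Omega>_RGB n" using x h macrostate_subset_Omega by blast
  have y: "y \<in> macrostate n h" unfolding y_def using x uw by (intro macrostate_permute permutes_swap_id)
  then have y\<Omega>: "y \<in> \<Omega>_RGB n" using h macrostate_subset_Omega by blast
  have "a \<le> n" "b \<le> n" "c \<le> n" using h by (auto simp: triple_in_types)
  then have hn: "h i \<le> n" for i unfolding h(1) by (simp add: triple_def)
  \<comment> \<open>The vertex \<open>v\<close> is recoloured first. The listed changes 1 to 2, 3 to
    1 and 3 to 2 all preserve the order of the counts; for any two distinct colours one of the two
    orders is listed.\<close>
  have main: ?thesis
    if ij: "(x v, x v') \<in> {(1, 2), (3, 1), (3, 2)}" and v: "v \<in> {1..n}" "v' \<in> {1..n}" "v \<noteq> v'"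
      and yv: "y = x(v := x v', v' := x v)" for v v'
  proof -
    define i j z where "i = x v" and "j = x v'" and "z = x(v := j)"
    have ij': "i \<noteq> j" "i \<in> spins" "j \<in> spins" using ij by (auto simp: i_def j_def spins_def)
    have "num_spins n x i = h i" using x ij' by (auto simp: macrostate_def)
    moreover have "num_spins n x i > 0" unfolding num_spins_def using v i_def by (auto simp: card_gt_0_iff)
    ultimately have hi: "h i > 0" by simp
    have t: "respin i j h \<in> types n"
      using ij hi h by (auto simp: i_def[symmetric] j_def[symmetric] triple_in_types)
    have z: "z \<in> macrostate n (respin i j h)" unfolding z_def using x v ij' by (intro macrostate_upd) (auto simp: i_def)
    then have z\<Omega>: "z \<in> \<Omega>_RGB n" using t macrostate_subset_Omega by blast
    have yz: "y = z(v' := i)" using yv by (simp add: z_def i_def j_def)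
    have "boltzmann \<beta> h * exp (- \<beta> * real n) \<le> boltzmann \<beta> (respin i j h)"
      using boltzmann_respin_ge[of i j h n \<beta>] ij' hi hn \<beta> by blast
    moreover have "boltzmann \<beta> h * exp (- \<beta> * real n) \<le> boltzmann \<beta> h"
      using \<beta> by (simp add: boltzmann_def)
    ultimately have b: "boltzmann \<beta> h * exp (- \<beta> * real n) / Z_RGB n \<beta> \<le> min (gibbs n \<beta> x) (gibbs n \<beta> z)"
      using Z_pos[of n \<beta>] by (auto simp: gibbs_macrostate[OF z] gibbs_macrostate[OF x] intro!: divide_right_mono)
    have gy: "gibbs n \<beta> y = gibbs n \<beta> x" using gibbs_macrostate[OF x] gibbs_macrostate[OF y] by simp
    have "g \<le> min (gibbs n \<beta> x) (gibbs n \<beta> z) / (3 * real n)"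
      unfolding g_def using b by (intro divide_right_mono) auto
    also have "\<dots> \<le> gibbs n \<beta> x * pmf (metropolis n (gibbs n \<beta>) x) z"
      using gibbs_metropolis_ge[OF n x\<Omega>, of v j \<beta>] z\<Omega> v ij' by (simp add: z_def i_def)
    finally have 1: "g \<le> gibbs n \<beta> x * pmf (metropolis n (gibbs n \<beta>) x) z" .
    have "g \<le> min (gibbs n \<beta> z) (gibbs n \<beta> y) / (3 * real n)"
      unfolding g_def gy using b by (intro divide_right_mono) (auto simp: min.commute)
    also have "\<dots> \<le> gibbs n \<beta> z * pmf (metropolis n (gibbs n \<beta>) z) y"
      using gibbs_metropolis_ge[OF n z\<Omega>, of v' i \<beta>] y\<Omega> v ij' unfolding yz by (simp add: z_def j_def)
    finally show ?thesis using 1 z\<Omega> by blast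
  qed
  have xs: "x u \<in> spins" "x w \<in> spins" using Omega_spin[OF x\<Omega>] uw by auto
  consider "x u = x w" | "(x u, x w) \<in> {(1, 2), (3, 1), (3, 2)}" | "(x w, x u) \<in> {(1, 2), (3, 1), (3, 2)}"
    using xs by (auto simp: spins_def)
  then show ?thesis
  proof cases
    case 1
    then have "y = x" by (auto simp: y_def fun_eq_iff Transposition.transpose_def)
    then show ?thesis using x\<Omega> by auto
  next
    case 2
    then show ?thesis
      by (rule main) (use uw in \<open>auto simp: y_def fun_eq_iff Transposition.transpose_def\<close>)
  next
    case 3
    then show ?thesis
      by (rule main) (use uw in \<open>auto simp: y_def fun_eq_iff Transposition.transpose_def\<close>)
  qed
qed

text \<open>Each transposition uses two edges of conductance at least \<open>g\<close>, and
  \<open>L2_set_mean_le\<close> multiplies the resulting distance by n. In the constant, 3 n stems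
  from the proposal probability and n^2 from squaring the number of transpositions.\<close>

lemma rms_hub:
  assumes n: "n \<ge> 1" and \<beta>: "\<beta> \<ge> 0" and h: "h = triple a b c" "h \<in> types n" "b + 2 \<le> a"
    and W: "weight n \<beta> h > 0"
  shows "\<exists>e. (rms n f e h)\<^sup>2
    \<le> 12 * real n ^ 3 * exp (\<beta> * real n) * Z_RGB n \<beta> * metropolis_dirichlet n \<beta> f / weight n \<beta> h"
proof -
  interpret reversible_chain "\<Omega>_RGB n" "metropolis n (gibbs n \<beta>)" "gibbs n \<beta>"
    by (rule metropolis_chain[OF n])
  let ?M = "macrostate n h" and ?P = "\<lambda>x. pmf (metropolis n (gibbs n \<beta>) x)"
  define g where "g = boltzmann \<beta> h * exp (- \<beta> * real n) / Z_RGB n \<beta> / (3 * real n)"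
  have g: "g > 0" using n Z_pos[of n \<beta>] by (simp add: g_def boltzmann_def)
  \<comment> \<open>The 4 is two edges per swap times the factor 2 of
    \<open>power2_sum_le\<close>.\<close>
  define D where "D = sqrt (4 * dirichlet f / g)"
  have D: "D \<ge> 0" using g dirichlet_nonneg by (simp add: D_def)
  have M\<Omega>: "?M \<subseteq> \<Omega>_RGB n" by (rule macrostate_subset_Omega[OF h(2)])
  have "L2_set (\<lambda>x. f x - f (x \<circ> Transposition.transpose u w)) ?M \<le> D"
    if uw: "u \<in> {1..n}" "w \<in> {1..n}" "u \<noteq> w" for u w
  proof -
    let ?y = "\<lambda>x. x \<circ> Transposition.transpose u w"
    have y: "?y x \<in> ?M" if "x \<in> ?M" for x
      using that uw by (intro macrostate_permute permutes_swap_id)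
    have "\<forall>x\<in>?M. \<exists>z. z \<in> \<Omega>_RGB n \<and> (z = x \<or> g \<le> gibbs n \<beta> x * ?P x z) \<and>
        (z = ?y x \<or> g \<le> gibbs n \<beta> z * ?P z (?y x))"
      using swap_two_steps[OF n \<beta> h _ uw] unfolding g_def by blast
    from bchoice[OF this] obtain z where z: "\<And>x. x \<in> ?M \<Longrightarrow> z x \<in> \<Omega>_RGB n"
      "\<And>x. x \<in> ?M \<Longrightarrow> z x = x \<or> g \<le> gibbs n \<beta> x * ?P x (z x)"
      "\<And>x. x \<in> ?M \<Longrightarrow> z x = ?y x \<or> g \<le> gibbs n \<beta> (z x) * ?P (z x) (?y x)" by blast
    have inj: "inj_on ?y ?M"
      using bij_macrostate_permute[OF permutes_swap_id[OF uw(1,2)], of h] by (rule bij_betw_imp_inj_on)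
    have "(\<Sum>x\<in>?M. g * (f x - f (z x))\<^sup>2) \<le> dirichlet f"
    proof (rule sum_edges_le_dirichlet[where g = "\<lambda>x. (x, z x)"])
      fix x a b assume "x \<in> ?M" "(x, z x) = (a, b)"
      then show "g * (f x - f (z x))\<^sup>2 \<le> gibbs n \<beta> a * ?P a b * (f a - f b)\<^sup>2"
        using z(2)[of x] by (auto intro: mult_right_mono)
    qed (use M\<Omega> z in \<open>auto simp: inj_on_def\<close>)
    moreover have "(\<Sum>x\<in>?M. g * (f (z x) - f (?y x))\<^sup>2) \<le> dirichlet f"
    proof (rule sum_edges_le_dirichlet[where g = "\<lambda>x. (z x, ?y x)"])
      fix x a b assume "x \<in> ?M" "(z x, ?y x) = (a, b)"
      then show "g * (f (z x) - f (?y x))\<^sup>2 \<le> gibbs n \<beta> a * ?P a b * (f a - f b)\<^sup>2"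
        using z(3)[of x] by (auto intro: mult_right_mono)
    qed (use M\<Omega> z y inj in \<open>auto simp: inj_on_def\<close>)
    moreover have "(\<Sum>x\<in>?M. g * (f x - f (?y x))\<^sup>2)
        \<le> (\<Sum>x\<in>?M. 2 * (g * (f x - f (z x))\<^sup>2) + 2 * (g * (f (z x) - f (?y x))\<^sup>2))"
    proof (rule sum_mono)
      fix x
      have "(f x - f (?y x))\<^sup>2 \<le> 2 * (f x - f (z x))\<^sup>2 + 2 * (f (z x) - f (?y x))\<^sup>2"
        using power2_sum_le[of "f x - f (z x)" "f (z x) - f (?y x)"] by simp
      from mult_left_mono[OF this, of g] g
      show "g * (f x - f (?y x))\<^sup>2 \<le> 2 * (g * (f x - f (z x))\<^sup>2) + 2 * (g * (f (z x) - f (?y x))\<^sup>2)"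
        by (simp add: algebra_simps)
    qed
    ultimately have "g * (\<Sum>x\<in>?M. (f x - f (?y x))\<^sup>2) \<le> 4 * dirichlet f"
      by (simp add: sum.distrib sum_distrib_left[symmetric])
    then show ?thesis unfolding L2_set_def D_def using g by (simp add: field_simps)
  qed
  then obtain e where e: "L2_set (\<lambda>x. f x - e) ?M \<le> real n * D"
    using L2_set_mean_le[of n f h D] D by blast
  define N where "N = real (card ?M)"
  have N: "N > 0" using W by (simp add: N_def weight_def zero_less_mult_iff)
  have "(\<Sum>x\<in>?M. (f x - e)\<^sup>2) = (L2_set (\<lambda>x. f x - e) ?M)\<^sup>2"
    by (simp add: L2_set_def sum_nonneg)
  also have "\<dots> \<le> (real n * D)\<^sup>2" using e by (intro power_mono) auto
  also have "\<dots> = real n ^ 2 * (4 * dirichlet f / g)"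
    using g dirichlet_nonneg by (simp add: D_def power_mult_distrib)
  finally have "(\<Sum>x\<in>?M. (f x - e)\<^sup>2) / N \<le> real n ^ 2 * (4 * dirichlet f / g) / N"
    using N by (intro divide_right_mono) auto
  also have "\<dots> = 12 * real n ^ 3 * exp (\<beta> * real n) * Z_RGB n \<beta> * dirichlet f / weight n \<beta> h"
    using N Z_pos[of n \<beta>] n
    by (simp add: g_def weight_def N_def[symmetric] boltzmann_def exp_minus field_simps power3_eq_cube power2_eq_square)
  also have "(\<Sum>x\<in>?M. (f x - e)\<^sup>2) / N = (rms n f e h)\<^sup>2"
    using N by (simp add: rms_def N_def sum_nonneg)
  finally show ?thesis ..
qed

text \<open>The floor \<open>q * weight n \<beta> k\<close> scales with the starting macrostate, so
  after averaging its weight cancels and every route contributes the same amount. The variance at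
  the hub is charged to all macrostates and costs only
  \<open>Z_RGB n \<beta> / weight n \<beta> h\<close>, at most the number of types divided by
  \<open>q\<close>.\<close>

lemma metropolis_poincare:
  assumes n: "n \<ge> 1" and \<beta>: "\<beta> \<ge> 0" and h: "h = triple a b c" "h \<in> types n" "b + 2 \<le> a"
    and q: "q > 0" and W: "\<And>k. k \<in> types n \<Longrightarrow> q * weight n \<beta> k \<le> weight n \<beta> h"
    and routes: "\<And>k. k \<in> types n \<Longrightarrow> weight n \<beta> k > 0 \<Longrightarrow> \<exists>l\<le>L. route n \<beta> (q * weight n \<beta> k) l k h"
  shows "\<exists>e. (\<Sum>x\<in>\<Omega>_RGB n. gibbs n \<beta> x * (f x - e)\<^sup>2)
    \<le> (real n + 1)\<^sup>2 / q * (24 * real n ^ 3 * exp (\<beta> * real n) + 6 * real n * (real L)\<^sup>2)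
        * metropolis_dirichlet n \<beta> f"
proof -
  let ?D = "metropolis_dirichlet n \<beta> f" and ?Z = "Z_RGB n \<beta>"
  have D: "?D \<ge> 0" by (rule reversible_chain.dirichlet_nonneg[OF metropolis_chain[OF n]])
  have Z: "?Z > 0" by (rule Z_pos)
  define T where "T = real (card (types n))"
  have T: "0 \<le> T" "T \<le> (real n + 1)\<^sup>2" using card_types[of n]
    by (auto simp: T_def add.commute simp flip: of_nat_le_iff[where 'a = real])
  have qZ: "q * ?Z \<le> T * weight n \<beta> h"
    unfolding Z_eq sum_distrib_left T_def using W by (rule sum_bounded_above)
  then have "weight n \<beta> h \<noteq> 0" using mult_pos_pos[OF q Z] by auto
  then have Wh: "weight n \<beta> h > 0" using weight_nonneg[of n \<beta> h] by (simp only: less_le) simp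
  have ZW: "?Z / weight n \<beta> h \<le> T / q" using qZ q Wh by (simp add: field_simps)
  obtain e where e: "(rms n f e h)\<^sup>2 \<le> 12 * real n ^ 3 * exp (\<beta> * real n) * ?Z * ?D / weight n \<beta> h"
    using rms_hub[OF n \<beta> h Wh] by blast
  define R where "R = 12 * real n ^ 3 * exp (\<beta> * real n) * ?D * (T / q)"
  have e': "(rms n f e h)\<^sup>2 \<le> R"
  proof -
    have "(rms n f e h)\<^sup>2 \<le> 12 * real n ^ 3 * exp (\<beta> * real n) * ?D * (?Z / weight n \<beta> h)"
      using e by (simp add: mult_ac)
    also have "\<dots> \<le> R" unfolding R_def using D ZW by (intro mult_left_mono) auto
    finally show ?thesis .
  qed
  have "(\<Sum>x\<in>macrostate n k. gibbs n \<beta> x * (f x - e)\<^sup>2)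
      \<le> weight n \<beta> k / ?Z * (2 * R) + 6 * real n * (real L)\<^sup>2 * ?D / q" if k: "k \<in> types n" for k
  proof (cases "weight n \<beta> k > 0")
    case True
    then have N: "card (macrostate n k) > 0" by (simp add: weight_def zero_less_mult_iff)
    obtain l where l: "l \<le> L" "route n \<beta> (q * weight n \<beta> k) l k h" using routes[OF k True] by blast
    let ?s = "3 * real n * ?Z * ?D / (q * weight n \<beta> k)"
    have s: "?s \<ge> 0" using D Z q True by simp
    have "rms n f e k \<le> rms n f e h + real l * sqrt ?s"
      using rms_route[OF n _ l(2) k] q True by simp
    also have "\<dots> \<le> rms n f e h + real L * sqrt ?s"
      using l(1) s by (intro add_left_mono mult_right_mono) auto
    finally have "(rms n f e k)\<^sup>2 \<le> (rms n f e h + real L * sqrt ?s)\<^sup>2"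
      by (intro power_mono) (auto simp: rms_def intro!: sum_nonneg divide_nonneg_nonneg)
    also have "\<dots> \<le> 2 * (rms n f e h)\<^sup>2 + 2 * (real L * sqrt ?s)\<^sup>2"
      by (rule power2_sum_le)
    also have "\<dots> \<le> 2 * R + 2 * ((real L)\<^sup>2 * ?s)" using e' s by (simp add: power_mult_distrib)
    finally have *: "(rms n f e k)\<^sup>2 \<le> 2 * R + 2 * ((real L)\<^sup>2 * ?s)" .
    have "(\<Sum>x\<in>macrostate n k. gibbs n \<beta> x * (f x - e)\<^sup>2) = weight n \<beta> k / ?Z * (rms n f e k)\<^sup>2"
      using N by (auto simp: gibbs_macrostate sum_distrib_left sum_divide_distrib rms_def sum_nonneg weight_def
          intro!: sum.cong)
    also have "\<dots> \<le> weight n \<beta> k / ?Z * (2 * R + 2 * ((real L)\<^sup>2 * ?s))"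
      using * True Z by (intro mult_left_mono) auto
    also have "\<dots> = weight n \<beta> k / ?Z * (2 * R) + 6 * real n * (real L)\<^sup>2 * ?D / q"
      using True Z q by (simp add: field_simps)
    finally show ?thesis .
  next
    case False
    then have "macrostate n k = {}"
      by (auto simp: weight_def boltzmann_def zero_less_mult_iff card_gt_0_iff)
    then show ?thesis using D q Z e' order_trans[OF zero_le_power2 e'] by simp
  qed
  then have "(\<Sum>x\<in>\<Omega>_RGB n. gibbs n \<beta> x * (f x - e)\<^sup>2)
      \<le> (\<Sum>k\<in>types n. weight n \<beta> k / ?Z * (2 * R) + 6 * real n * (real L)\<^sup>2 * ?D / q)"
    unfolding sum_Omega by (rule sum_mono)
  also have "\<dots> = (\<Sum>k\<in>types n. weight n \<beta> k) / ?Z * (2 * R) + T * (6 * real n * (real L)\<^sup>2 * ?D / q)"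
    by (simp add: sum.distrib sum_divide_distrib sum_distrib_right T_def)
  also have "\<dots> = T * ((24 * real n ^ 3 * exp (\<beta> * real n) + 6 * real n * (real L)\<^sup>2) * ?D / q)"
    using Z unfolding Z_eq[symmetric] R_def by (simp add: add_divide_distrib algebra_simps)
  also have "\<dots> \<le> (real n + 1)\<^sup>2 * ((24 * real n ^ 3 * exp (\<beta> * real n) + 6 * real n * (real L)\<^sup>2) * ?D / q)"
    using T D q by (intro mult_right_mono) auto
  finally show ?thesis by (intro exI[of _ e]) (simp add: mult_ac)
qed

section \<open>Free energy landscape\<close>

definition ent :: "real \<Rightarrow> real" where "ent x = - x * ln x"

definition free :: "real \<Rightarrow> real \<Rightarrow> real \<Rightarrow> real \<Rightarrow> real" where
  "free l a b c = ent a + ent b + ent c + l / 2 * (a\<^sup>2 + b\<^sup>2 + c\<^sup>2)"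

definition sym_free :: "real \<Rightarrow> real \<Rightarrow> real" where
  "sym_free l a = free l a ((1 - a) / 2) ((1 - a) / 2)"

definition slope :: "real \<Rightarrow> real \<Rightarrow> real" where
  "slope l a = ln (1 - a) - ln a - ln 2 + l / 2 * (3 * a - 1)"

definition barrier :: real where "barrier = ln 3 - 19 / 12 * ln 2"

lemma DERIV_ent: "x > 0 \<Longrightarrow> (ent has_real_derivative - ln x - 1) (at x)"
  unfolding ent_def[abs_def] by (auto intro!: derivative_eq_intros)

text \<open>At 0 the convention \<open>ln 0 = 0\<close> gives the value 0, which is also the
  right-hand limit of - x ln x.\<close>

lemma continuous_ent: "continuous_on {0..} ent"
  unfolding continuous_on_eq_continuous_within
proof
  fix x :: real assume "x \<in> {0..}"
  then consider "x = 0" | "x > 0" by fastforce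
  then show "continuous (at x within {0..}) ent"
  proof cases
    case 1
    have "((\<lambda>x::real. - x * ln x) \<longlongrightarrow> 0) (at_right 0)" by real_asymp
    then have "((\<lambda>x::real. - x * ln x) \<longlongrightarrow> 0) (at 0 within {0..})"
      by (simp add: at_within_Ici_at_right)
    then show ?thesis using 1 by (simp add: continuous_within ent_def[abs_def])
  next
    case 2
    show ?thesis
      by (rule continuous_at_imp_continuous_at_within, rule DERIV_isCont, rule DERIV_ent) fact
  qed
qed

lemma continuous_sym_free: "continuous_on {0..1} (sym_free l)"
proof -
  have "continuous_on {0..1} (\<lambda>a. ent ((1 - a) / 2))"
    by (rule continuous_on_compose2[OF continuous_ent]) (auto intro!: continuous_intros)
  moreover have "continuous_on {0..1} ent" by (rule continuous_on_subset[OF continuous_ent]) auto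
  ultimately show ?thesis unfolding sym_free_def[abs_def] free_def
    by (intro continuous_intros) auto
qed

text \<open>Entropy does not depend on the field. Facts proved at 4 ln 2 are transported to other
  fields through this quadratic correction.\<close>

lemma sym_free_shift: "sym_free l a = sym_free l' a + (l - l') / 2 * (a\<^sup>2 + (1 - a)\<^sup>2 / 2)"
  by (simp add: sym_free_def free_def field_simps power2_eq_square)

lemma DERIV_sym_free:
  assumes "0 < a" "a < 1"
  shows "(sym_free l has_real_derivative slope l a) (at a)"
proof -
  have *: "((\<lambda>a. ent ((1 - a) / 2)) has_real_derivative (- ln ((1 - a) / 2) - 1) * (- 1 / 2)) (at a)"
    by (rule DERIV_chain2[OF DERIV_ent]) (use assms in \<open>auto intro!: derivative_eq_intros\<close>)
  have "((\<lambda>a. l / 2 * (a\<^sup>2 + ((1 - a) / 2)\<^sup>2 + ((1 - a) / 2)\<^sup>2))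
      has_real_derivative l / 2 * (3 * a - 1)) (at a)"
    by (auto intro!: derivative_eq_intros simp: field_simps)
  from DERIV_add[OF DERIV_add[OF DERIV_add[OF DERIV_ent[OF assms(1)] *] *] this]
  have "((\<lambda>a. ent a + ent ((1 - a) / 2) + ent ((1 - a) / 2)
        + l / 2 * (a\<^sup>2 + ((1 - a) / 2)\<^sup>2 + ((1 - a) / 2)\<^sup>2))
      has_real_derivative (- ln a - 1) + (- ln ((1 - a) / 2) - 1) * (- 1 / 2)
        + (- ln ((1 - a) / 2) - 1) * (- 1 / 2) + l / 2 * (3 * a - 1)) (at a)" .
  moreover have "(- ln a - 1) + (- ln ((1 - a) / 2) - 1) * (- 1 / 2)
      + (- ln ((1 - a) / 2) - 1) * (- 1 / 2) + l / 2 * (3 * a - 1) = slope l a"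
    using assms by (simp add: slope_def ln_div)
  ultimately show ?thesis by (simp add: sym_free_def[abs_def] free_def)
qed

lemma DERIV_slope:
  assumes "0 < a" "a < 1"
  shows "(slope l has_real_derivative - 1 / (1 - a) - 1 / a + 3 * l / 2) (at a)"
  unfolding slope_def[abs_def] using assms by (auto intro!: derivative_eq_intros simp: field_simps)

lemma DERIV_slope':
  assumes "0 < a" "a < 1"
  shows "((\<lambda>a. - 1 / (1 - a) - 1 / a + 3 * l / 2) has_real_derivative 1 / a\<^sup>2 - 1 / (1 - a)\<^sup>2) (at a)"
  using assms by (auto intro!: derivative_eq_intros simp: field_simps power2_eq_square)

text \<open>The second derivative 1 / a^2 - 1 / (1 - a)^2 changes sign at 1/2 for every l. Convexity
  to the left and concavity to the right control the sign of the slope without solving for its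
  zeros.\<close>

lemma convex_slope: "convex_on {1/3..1/2} (slope l)"
proof (rule f''_ge0_imp_convex[OF _ DERIV_slope DERIV_slope'])
  fix a :: real assume a: "a \<in> {1/3..1/2}"
  then have "1 / (1 - a)\<^sup>2 \<le> 1 / a\<^sup>2" by (intro divide_left_mono power_mono) auto
  then show "1 / a\<^sup>2 - 1 / (1 - a)\<^sup>2 \<ge> 0" by simp
qed auto

lemma concave_slope: "concave_on {1/2..<1} (slope l)"
  unfolding concave_on_def
proof (rule f''_ge0_imp_convex)
  fix a :: real assume a: "a \<in> {1/2..<1}"
  then have "1 / a\<^sup>2 \<le> 1 / (1 - a)\<^sup>2" by (intro divide_left_mono power_mono) auto
  then show "- (1 / a\<^sup>2 - 1 / (1 - a)\<^sup>2) \<ge> 0" by simp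
  show "((\<lambda>a. - slope l a) has_real_derivative - (- 1 / (1 - a) - 1 / a + 3 * l / 2)) (at a)"
    using a by (intro DERIV_minus DERIV_slope) auto
  show "((\<lambda>a. - (- 1 / (1 - a) - 1 / a + 3 * l / 2)) has_real_derivative - (1 / a\<^sup>2 - 1 / (1 - a)\<^sup>2)) (at a)"
    using a by (intro DERIV_minus DERIV_slope') auto
qed auto

lemma slope_critical: "slope (4 * ln 2) (1/3) = 0" "slope (4 * ln 2) (1/2) = 0"
  by (simp_all add: slope_def ln_div)

text \<open>At 4 ln 2 the slope vanishes at 1/3 and at 1/2; being convex, it lies below the zero
  chord in between.\<close>

lemma sym_free_critical_antimono:
  assumes "1/3 \<le> x" "x \<le> y" "y \<le> 1/2"
  shows "sym_free (4 * ln 2) y \<le> sym_free (4 * ln 2) x"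
proof (rule DERIV_nonpos_imp_nonincreasing[OF assms(2)])
  fix a assume a: "x \<le> a" "a \<le> y"
  define t where "t = 6 * a - 2"
  have t: "0 \<le> t" "t \<le> 1" "a = (1 - t) * (1/3) + t * (1/2)" using a assms by (auto simp: t_def field_simps)
  have "slope (4 * ln 2) ((1 - t) *\<^sub>R (1/3) + t *\<^sub>R (1/2))
      \<le> (1 - t) * slope (4 * ln 2) (1/3) + t * slope (4 * ln 2) (1/2)"
    using t by (intro convex_onD[OF convex_slope]) auto
  then have "slope (4 * ln 2) a \<le> 0" using t(3) by (simp add: slope_critical)
  then show "\<exists>d. (sym_free (4 * ln 2) has_real_derivative d) (at a) \<and> d \<le> 0"
    using DERIV_sym_free[of a "4 * ln 2"] a assms by auto
qed

lemma sym_free_values: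
  "sym_free (4 * ln 2) (1/3) = ln 3 + 2/3 * ln 2"
  "sym_free (4 * ln 2) (1/2) = 9/4 * ln 2"
  "sym_free (4 * ln 2) (2/3) = ln 3 + 2/3 * ln 2"
proof -
  have "ln (4::real) = 2 * ln 2" using ln_realpow[of 2 2] by simp
  moreover have "ln (6::real) = ln 2 + ln 3" using ln_mult[of 2 3] by simp
  ultimately show "sym_free (4 * ln 2) (1/3) = ln 3 + 2/3 * ln 2"
    "sym_free (4 * ln 2) (1/2) = 9/4 * ln 2" "sym_free (4 * ln 2) (2/3) = ln 3 + 2/3 * ln 2"
    by (simp_all add: sym_free_def free_def ent_def ln_div power2_eq_square field_simps)
qed

lemma barrier_eq: "barrier = sym_free (4 * ln 2) (1/3) - sym_free (4 * ln 2) (1/2)"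
  by (simp add: sym_free_values barrier_def)

text \<open>Multiplied by 12 this is 2^19 < 3^12, that is 524288 < 531441.\<close>

lemma barrier_pos: "barrier > 0"
proof -
  have "19 * ln 2 = ln (2 ^ 19 :: real)" "12 * ln 3 = ln (3 ^ 12 :: real)"
    using ln_realpow[of "2::real" 19] ln_realpow[of "3::real" 12] by simp_all
  moreover have "ln (2 ^ 19 :: real) < ln (3 ^ 12)" by simp
  ultimately show ?thesis unfolding barrier_def by linarith
qed

section \<open>The landscape above the transition\<close>

lemma quad_mono:
  fixes x y :: real
  assumes "1/3 \<le> x" "x < y"
  shows "x\<^sup>2 + (1 - x)\<^sup>2 / 2 < y\<^sup>2 + (1 - y)\<^sup>2 / 2"
proof -
  have "(y - x) * (3 * (x + y) - 2) > 0" using assms by (intro mult_pos_pos) auto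
  then show ?thesis by (simp add: power2_eq_square field_simps)
qed

text \<open>At 4 ln 2 no dip on [1/3, 1/2] exceeds \<open>barrier\<close>, as the curve decreases
  from end to end. A stronger field strictly raises the later point against the earlier one, and
  compactness turns this pointwise gain into a uniform \<open>B\<close>.\<close>

lemma dip_bound:
  assumes l: "l > 4 * ln 2"
  obtains B where "0 \<le> B" "B < barrier"
    "\<And>x y. 1/3 \<le> x \<Longrightarrow> x \<le> y \<Longrightarrow> y \<le> 1/2 \<Longrightarrow> sym_free l x - sym_free l y \<le> B"
proof -
  define S where "S = ({1/3..1/2} \<times> {1/3..1/2}) \<inter> {p :: real \<times> real. fst p \<le> snd p}"
  have "compact S" unfolding S_def
    by (intro compact_Int_closed compact_Times closed_Collect_le continuous_intros) auto
  moreover have "(1/3, 1/3) \<in> S" by (auto simp: S_def)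
  moreover have "continuous_on S (\<lambda>p. sym_free l (fst p) - sym_free l (snd p))"
    by (intro continuous_intros continuous_on_compose2[OF continuous_sym_free]) (auto simp: S_def)
  ultimately obtain p where p: "p \<in> S"
      "\<forall>q\<in>S. sym_free l (fst q) - sym_free l (snd q) \<le> sym_free l (fst p) - sym_free l (snd p)"
    using continuous_attains_sup[of S "\<lambda>p. sym_free l (fst p) - sym_free l (snd p)"] by blast
  define B where "B = sym_free l (fst p) - sym_free l (snd p)"
  have "B < barrier"
  proof (cases "fst p = snd p")
    \<comment> \<open>A zero dip gains nothing from the field; strictness comes from positivity of
      \<open>barrier\<close>.\<close>
    case True then show ?thesis using barrier_pos by (simp add: B_def)
  next
    case False
    define q where "q = (\<lambda>x :: real. x\<^sup>2 + (1 - x)\<^sup>2 / 2)"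
    have x: "1/3 \<le> fst p" "fst p < snd p" "snd p \<le> 1/2" using p(1) False by (auto simp: S_def)
    have "(l - 4 * ln 2) / 2 * q (fst p) < (l - 4 * ln 2) / 2 * q (snd p)"
      using quad_mono[OF x(1,2)] l by (intro mult_strict_left_mono) (auto simp: q_def)
    moreover have "sym_free (4 * ln 2) (fst p) \<le> sym_free (4 * ln 2) (1/3)"
      "sym_free (4 * ln 2) (1/2) \<le> sym_free (4 * ln 2) (snd p)"
      using x by (auto intro!: sym_free_critical_antimono)
    ultimately show ?thesis
      unfolding B_def barrier_eq sym_free_shift[of l _ "4 * ln 2"] q_def by linarith
  qed
  moreover have "0 \<le> B" using p(2) \<open>(1/3, 1/3) \<in> S\<close> by (force simp: B_def)
  moreover have "sym_free l x - sym_free l y \<le> B" if "1/3 \<le> x" "x \<le> y" "y \<le> 1/2" for x y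
    using p(2)[rule_format, of "(x, y)"] that by (simp add: S_def B_def)
  ultimately show ?thesis using that by blast
qed

text \<open>Above the transition the slope is positive at 1/2 and negative near 1, and concavity
  permits only one zero in between.\<close>

lemma ordered_peak:
  assumes l: "l > 4 * ln 2"
  obtains m where "1/2 < m" "m < 1"
    "\<And>x y. 1/2 \<le> x \<Longrightarrow> x \<le> y \<Longrightarrow> y \<le> m \<Longrightarrow> sym_free l x \<le> sym_free l y"
    "\<And>x y. m \<le> x \<Longrightarrow> x \<le> y \<Longrightarrow> y \<le> 1 \<Longrightarrow> sym_free l y \<le> sym_free l x"
proof -
  have half: "slope l (1/2) > 0" using l by (simp add: slope_def ln_div)
  have l0: "l > 0" using l by (smt (verit) ln_gt_zero)
  \<comment> \<open>Chosen to make ln (1 - z) = - (l + 1), which outweighs the field term, at most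
    l; for z > 1/2 the remaining logarithms contribute at most 0.\<close>
  define z where "z = 1 - exp (- (l + 1))"
  have z: "1/2 < z" "z < 1"
  proof -
    have "exp (- (l + 1)) \<le> exp (- 1)" using l0 by simp
    also have "exp (- 1 :: real) < 1/2"
      using exp_ge_one_plus_x_over_n_power_n[of 2 1] by (simp add: exp_minus field_simps power2_eq_square)
    finally show "1/2 < z" by (simp add: z_def)
  qed (simp add: z_def)
  have "slope l z < 0"
  proof -
    have "- ln z - ln 2 = - ln (2 * z)" using z by (simp add: ln_mult)
    also have "\<dots> \<le> 0" using z by simp
    finally have "- ln z - ln 2 \<le> 0" .
    moreover have "ln (1 - z) = - (l + 1)" by (simp add: z_def)
    moreover have "l / 2 * (3 * z - 1) \<le> l / 2 * 2" using z l0 by (intro mult_left_mono) auto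
    ultimately show ?thesis unfolding slope_def by linarith
  qed
  moreover have "continuous_on {1/2..z} (slope l)"
  proof (rule DERIV_continuous_on)
    fix a assume "a \<in> {1/2..z}"
    then show "(slope l has_real_derivative - 1 / (1 - a) - 1 / a + 3 * l / 2) (at a within {1/2..z})"
      by (intro has_field_derivative_at_within[OF DERIV_slope]) (use z in auto)
  qed
  ultimately obtain m where m: "1/2 \<le> m" "m \<le> z" "slope l m = 0"
    using IVT2'[of "slope l" z 0 "1/2"] half z by auto
  have "m \<noteq> 1/2" using m(3) half by (metis less_irrefl)
  then have m': "1/2 < m" "m < 1" using m z by auto
  have between: "(1 - t) * slope l u + t * slope l v \<le> slope l ((1 - t) * u + t * v)"
    if "0 \<le> t" "t \<le> 1" "u \<in> {1/2..<1}" "v \<in> {1/2..<1}" for t u v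
    using concave_onD[OF concave_slope[of l] that] by simp
  \<comment> \<open>Up to \<open>m\<close> the slope lies above the chord from a positive value at
    1/2 to 0. Beyond \<open>m\<close> a nonnegative value would, by the same concavity, make the
    slope at \<open>m\<close> positive.\<close>
  have left: "slope l a \<ge> 0" if "1/2 \<le> a" "a \<le> m" for a
  proof -
    define t where "t = (a - 1/2) / (m - 1/2)"
    have "t * (m - 1/2) = a - 1/2" using m' by (simp add: t_def)
    then have "a = (1 - t) * (1/2) + t * m" by (simp add: field_simps)
    moreover have "0 \<le> t" "t \<le> 1" using that m' by (auto simp: t_def field_simps)
    moreover from this have "0 \<le> (1 - t) * slope l (1/2)" using half by simp
    ultimately show ?thesis using between[of t "1/2" m] m m' by auto
  qed
  have right: "slope l a < 0" if "m < a" "a < 1" for a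
  proof (rule ccontr)
    assume "\<not> slope l a < 0"
    define t where "t = (m - 1/2) / (a - 1/2)"
    have "t * (a - 1/2) = m - 1/2" using that m' by (simp add: t_def)
    then have t3: "m = (1 - t) * (1/2) + t * a" by (simp add: field_simps)
    have t: "0 \<le> t" "t < 1" using that m' by (auto simp: t_def field_simps)
    then have "(1 - t) * slope l (1/2) > 0" "t * slope l a \<ge> 0" using half \<open>\<not> slope l a < 0\<close> by auto
    then show False using between[of t "1/2" a] t t3 m m' that by auto
  qed
  show ?thesis
  proof (rule that[OF m'])
    fix x y :: real
    show "sym_free l x \<le> sym_free l y" if "1/2 \<le> x" "x \<le> y" "y \<le> m"
    proof (rule DERIV_nonneg_imp_nondecreasing[OF that(2)])
      fix a assume "x \<le> a" "a \<le> y"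
      then show "\<exists>d. (sym_free l has_real_derivative d) (at a) \<and> 0 \<le> d"
        using left[of a] DERIV_sym_free[of a l] that m' by auto
    qed
    show "sym_free l y \<le> sym_free l x" if "m \<le> x" "x \<le> y" "y \<le> 1"
    proof (cases "x = y")
      case False
      then have "x < y" using that by simp
      have "sym_free l y < sym_free l x"
      \<comment> \<open>The endpoint may be 1, where the entropy has no derivative; continuity is
        enough there.\<close>
      proof (rule DERIV_neg_imp_decreasing_open[of x y])
        fix a assume "x < a" "a < y"
        then show "\<exists>d. (sym_free l has_real_derivative d) (at a) \<and> d < 0"
          using right[of a] DERIV_sym_free[of a l] that m' by auto
      qed (use \<open>x < y\<close> that m' in \<open>auto intro: continuous_on_subset[OF continuous_sym_free]\<close>)
      then show ?thesis by simp
    qed simp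
  qed
qed

text \<open>The one-dimensional form of the route estimate: approaching \<open>m\<close> from either
  side loses at most \<open>B\<close>, and only the stretch below 1/2 can lose anything.\<close>

lemma landscape:
  assumes l: "l > 4 * ln 2"
  obtains m B where "1/2 < m" "m < 1" "0 \<le> B" "B < barrier"
    "\<And>x y. 1/3 \<le> x \<Longrightarrow> x \<le> y \<Longrightarrow> y \<le> m \<Longrightarrow> sym_free l x - sym_free l y \<le> B"
    "\<And>x y. m \<le> y \<Longrightarrow> y \<le> x \<Longrightarrow> x \<le> 1 \<Longrightarrow> sym_free l x - sym_free l y \<le> B"
    "\<And>x. 1/3 \<le> x \<Longrightarrow> x \<le> 1 \<Longrightarrow> sym_free l x \<le> sym_free l m"
proof -
  obtain m where m: "1/2 < m" "m < 1"
    "\<And>x y. 1/2 \<le> x \<Longrightarrow> x \<le> y \<Longrightarrow> y \<le> m \<Longrightarrow> sym_free l x \<le> sym_free l y"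
    "\<And>x y. m \<le> x \<Longrightarrow> x \<le> y \<Longrightarrow> y \<le> 1 \<Longrightarrow> sym_free l y \<le> sym_free l x"
    using ordered_peak[OF l] by blast
  obtain B where B: "0 \<le> B" "B < barrier"
    "\<And>x y. 1/3 \<le> x \<Longrightarrow> x \<le> y \<Longrightarrow> y \<le> 1/2 \<Longrightarrow> sym_free l x - sym_free l y \<le> B"
    using dip_bound[OF l] by blast
  have peak: "sym_free l x \<le> sym_free l m" if "1/2 \<le> x" "x \<le> 1" for x
    using m(3)[of x m] m(4)[of m x] that by linarith
  show ?thesis
  proof (rule that[OF m(1,2) B(1,2)])
    show "sym_free l x - sym_free l y \<le> B" if "1/3 \<le> x" "x \<le> y" "y \<le> m" for x y
    proof -
      consider "y \<le> 1/2" | "1/2 \<le> x" | "x \<le> 1/2" "1/2 \<le> y" by linarith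
      then show ?thesis
      proof cases
        case 1 then show ?thesis using B(3) that by blast
      next
        case 2 then show ?thesis using m(3)[of x y] B(1) that by simp
      next
        case 3 then show ?thesis using m(3)[of "1/2" y] B(3)[of x "1/2"] that by simp
      qed
    qed
    show "sym_free l x - sym_free l y \<le> B" if "m \<le> y" "y \<le> x" "x \<le> 1" for x y
      using m(4)[of y x] B(1) that by simp
    show "sym_free l x \<le> sym_free l m" if "1/3 \<le> x" "x \<le> 1" for x
    proof (cases "1/2 \<le> x")
      case False
      \<comment> \<open>For x below 1/2 the comparison goes through 2/3: it ties with 1/3 at 4 ln 2,
        and the stronger field favours the larger sum of squares.\<close>
      define q where "q = (\<lambda>x :: real. x\<^sup>2 + (1 - x)\<^sup>2 / 2)"
      have "(l - 4 * ln 2) / 2 * q x \<le> (l - 4 * ln 2) / 2 * q (2/3)"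
        using quad_mono[of x "2/3"] that l False by (intro mult_left_mono) (auto simp: q_def)
      moreover have "sym_free (4 * ln 2) x \<le> sym_free (4 * ln 2) (1/3)"
        using that False by (intro sym_free_critical_antimono) auto
      ultimately have "sym_free l x \<le> sym_free l (2/3)"
        unfolding sym_free_shift[of l _ "4 * ln 2"] q_def using sym_free_values by linarith
      also have "\<dots> \<le> sym_free l m" by (rule peak) auto
      finally show ?thesis .
    qed (use peak that in auto)
  qed
qed

text \<open>The mean-field term is outweighed by the entropy gained from balancing two colours
  as long as \<open>l (b + c) \<le> 2\<close>.\<close>

lemma free_balance:
  assumes "0 \<le> c" "c \<le> b" "l \<ge> 0" "l * (b + c) \<le> 2"
  shows "free l a b c \<le> free l a ((b + c) / 2) ((b + c) / 2)"
proof -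
  define s where "s = (b + c) / 2"
  define u where "u = (\<lambda>d. ent (s + d) + ent (s - d) + l / 2 * ((s + d)\<^sup>2 + (s - d)\<^sup>2))"
  have "u ((b - c) / 2) \<le> u 0"
  proof (cases "b = c")
    case False
    then have s: "s > 0" "(b - c) / 2 \<le> s" "0 < (b - c) / 2" using assms by (auto simp: s_def)
    have cont: "continuous_on {0..(b - c) / 2} u" unfolding u_def
      by (intro continuous_intros continuous_on_compose2[OF continuous_ent]) (use s in auto)
    show ?thesis
    proof (rule DERIV_nonpos_imp_decreasing_open[OF _ _ cont])
      fix d assume d: "0 < d" "d < (b - c) / 2"
      then have d': "d < s" using s by simp
      have "(u has_real_derivative (ln (s - d) - ln (s + d) + 2 * l * d)) (at d)"
      proof -
        have 1: "((\<lambda>d. ent (s + d)) has_real_derivative (- ln (s + d) - 1) * 1) (at d)"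
          by (rule DERIV_chain2[OF DERIV_ent]) (use d d' in \<open>auto intro!: derivative_eq_intros\<close>)
        have 2: "((\<lambda>d. ent (s - d)) has_real_derivative (- ln (s - d) - 1) * (- 1)) (at d)"
          by (rule DERIV_chain2[OF DERIV_ent]) (use d d' in \<open>auto intro!: derivative_eq_intros\<close>)
        have "((\<lambda>d. l / 2 * ((s + d)\<^sup>2 + (s - d)\<^sup>2)) has_real_derivative 2 * l * d) (at d)"
          by (auto intro!: derivative_eq_intros simp: field_simps)
        from DERIV_add[OF DERIV_add[OF 1 2] this] show ?thesis
          unfolding u_def by (simp add: algebra_simps)
      qed
      moreover have "ln (s - d) - ln (s + d) + 2 * l * d \<le> 0"
      proof -
        \<comment> \<open>Monotonicity of \<open>g\<close> gives ln (s + d) - ln (s - d) \<ge> 2 d /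
          s. As l s \<le> 1, this absorbs the field term 2 l d.\<close>
        define g where "g = (\<lambda>x. ln (s + x) - ln (s - x) - 2 * x / s)"
        have "g 0 \<le> g d"
        proof (rule DERIV_nonneg_imp_nondecreasing[of 0 d g])
          fix x assume x: "0 \<le> x" "x \<le> d"
          have "(g has_real_derivative (1 / (s + x) + 1 / (s - x) - 2 / s)) (at x)"
            unfolding g_def using x d' s by (auto intro!: derivative_eq_intros)
          moreover have "1 / (s + x) + 1 / (s - x) - 2 / s \<ge> 0"
          proof -
            have sx: "s + x > 0" "s - x > 0" using x d' s by auto
            have "2 / s = 2 * s / (s * s)" using s by simp
            also have "\<dots> \<le> 2 * s / ((s + x) * (s - x))"
              using s sx by (intro divide_left_mono mult_pos_pos) (auto simp: algebra_simps)
            also have "\<dots> = 1 / (s + x) + 1 / (s - x)" using sx by (subst add_frac_eq) auto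
            finally show ?thesis by simp
          qed
          ultimately show "\<exists>y. (g has_real_derivative y) (at x) \<and> 0 \<le> y" by auto
        qed (use d in simp)
        then have "2 * d / s \<le> ln (s + d) - ln (s - d)" by (simp add: g_def)
        moreover have "2 * l * d \<le> 2 * d / s"
          using assms(4) s d mult_right_mono[of "l * s" 1 "2 * d"] by (simp add: s_def field_simps)
        ultimately show ?thesis by linarith
      qed
      ultimately show "\<exists>y. (u has_real_derivative y) (at d) \<and> y \<le> 0" by blast
    qed (use s in simp)
  qed simp
  then show ?thesis by (simp add: u_def s_def free_def field_simps)
qed

section \<open>Weights of macrostates\<close>

lemma macrostate_ones: "macrostate n (triple n 0 0) = {\<lambda>v\<in>{1..n}. 1}"
proof (intro equalityI subsetI)
  fix x assume x: "x \<in> macrostate n (triple n 0 0)"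
  have x': "x \<in> {1..n} \<rightarrow>\<^sub>E spins" "num_spins n x 2 = 0" "num_spins n x 3 = 0"
    using x by (auto simp: macrostate_def)
  have "x v = (\<lambda>v\<in>{1..n}. 1) v" for v
  proof (cases "v \<in> {1..n}")
    case True
    then have "x v \<noteq> 2" "x v \<noteq> 3" "x v \<in> spins" using x' by (auto simp: num_spins_def)
    then show ?thesis using True by (auto simp: spins_def)
  next
    case False
    then show ?thesis using PiE_arb[OF x'(1) False] by auto
  qed
  then show "x \<in> {\<lambda>v\<in>{1..n}. 1}" by auto
next
  fix x :: "nat \<Rightarrow> nat" assume "x \<in> {\<lambda>v\<in>{1..n}. 1}"
  then have x: "x = (\<lambda>v\<in>{1..n}. 1)" by simp
  have *: "{v \<in> {1..n}. x v = m} = (if m = 1 then {1..n} else {})" for m by (auto simp: x)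
  have "num_spins n x m = (if m = 1 then n else 0)" for m unfolding num_spins_def * by simp
  then show "x \<in> macrostate n (triple n 0 0)" by (auto simp: macrostate_def x spins_def)
qed

text \<open>The multinomial coefficient, by recolouring towards 1 until only the constant
  configuration is left.\<close>

lemma card_macrostate:
  assumes "a + b + c = n"
  shows "real (card (macrostate n (triple a b c))) * (fact a * fact b * fact c) = fact n"
  using assms
proof (induction "b + c" arbitrary: a b c)
  case 0
  then show ?case using macrostate_ones[of n] by simp
next
  case (Suc t)
  show ?case
  proof (cases "b = 0")
    case False
    then obtain b' where b: "b = Suc b'" by (cases b) auto
    have *: "real b * card (macrostate n (triple a b c)) = real (a + 1) * card (macrostate n (triple (a + 1) b' c))"
      using card_macrostate_respin[of 2 1 "triple a b c" n] b by simp
    have "real (card (macrostate n (triple a b c))) * (fact a * fact b * fact c)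
        = real b * card (macrostate n (triple a b c)) * (fact a * fact b' * fact c)"
      by (simp add: b mult_ac)
    also have "\<dots> = real (card (macrostate n (triple (a + 1) b' c))) * (fact (a + 1) * fact b' * fact c)"
      unfolding * by (simp add: algebra_simps)
    also have "\<dots> = fact n" using Suc b by (intro Suc.hyps(1)) auto
    finally show ?thesis .
  next
    case True
    with Suc obtain c' where c: "c = Suc c'" by (cases c) auto
    have *: "real c * card (macrostate n (triple a b c)) = real (a + 1) * card (macrostate n (triple (a + 1) b c'))"
      using card_macrostate_respin[of 3 1 "triple a b c" n] c by simp
    have "real (card (macrostate n (triple a b c))) * (fact a * fact b * fact c)
        = real c * card (macrostate n (triple a b c)) * (fact a * fact b * fact c')"
      by (simp add: c mult_ac)
    also have "\<dots> = real (card (macrostate n (triple (a + 1) b c'))) * (fact (a + 1) * fact b * fact c')"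
      unfolding * by (simp add: algebra_simps)
    also have "\<dots> = fact n" using Suc c by (intro Suc.hyps(1)) auto
    finally show ?thesis .
  qed
qed

lemma ln_fact_lower: "real k * ln k - k \<le> ln (fact k)"
proof (induction k)
  case (Suc k)
  show ?case
  proof (cases "k = 0")
    case False
    have "real k * ln (real (Suc k) / k) \<le> real k * (real (Suc k) / k - 1)"
      using False by (intro mult_left_mono ln_le_minus_one) auto
    also have "\<dots> = 1" using False by (simp add: field_simps)
    finally have "real k * (ln (real (Suc k)) - ln k) \<le> 1" using False by (subst (asm) ln_div) auto
    moreover have "ln (fact (Suc k) :: real) = ln (real (Suc k)) + ln (fact k)"
      unfolding fact_Suc by (subst ln_mult) (auto simp del: of_nat_Suc)
    ultimately show ?thesis using Suc by (simp add: algebra_simps del: fact_Suc)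
  qed simp
qed simp

text \<open>Crude Stirling. The induction step is short by 1 / (k + 1), and the growth of 2 ln (k +
  1), at least 2 / (k + 2), pays for it.\<close>

lemma ln_fact_upper: "ln (fact k) \<le> real k * ln k - k + 2 * ln (real k + 1) + 1"
proof (induction k)
  case (Suc k)
  have ln_ge: "ln (y / x) \<ge> 1 - x / y" if "0 < x" "0 < y" for x y :: real
    using ln_le_minus_one[of "x / y"] that by (simp add: ln_div)
  show ?case
  proof (cases "k = 0")
    case False
    have h1: "real k * (1 - real k / (real k + 1)) \<le> real k * ln ((real k + 1) / real k)"
      using False by (intro mult_left_mono ln_ge) auto
    have h2: "2 * (1 - (real k + 1) / (real k + 2)) \<le> 2 * ln ((real k + 2) / (real k + 1))"
      by (intro mult_left_mono ln_ge) auto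
    have "1 \<le> real k * (1 - real k / (real k + 1)) + 2 * (1 - (real k + 1) / (real k + 2))"
    proof -
      have "real k * (1 - real k / (real k + 1)) = 1 - 1 / (real k + 1)"
        "2 * (1 - (real k + 1) / (real k + 2)) = 2 / (real k + 2)" by (simp_all add: field_simps)
      moreover have "1 / (real k + 1) \<le> 2 / (real k + 2)" by (simp add: field_simps)
      ultimately show ?thesis by simp
    qed
    also note add_mono[OF h1 h2]
    finally have "1 \<le> real k * ln ((real k + 1) / real k) + 2 * ln ((real k + 2) / (real k + 1))" .
    then have "1 \<le> real k * (ln (real k + 1) - ln k) + 2 * (ln (real k + 2) - ln (real k + 1))"
      using False by (simp add: ln_div)
    moreover have "ln (fact (Suc k) :: real) = ln (real (Suc k)) + ln (fact k)"
      unfolding fact_Suc by (subst ln_mult) (auto simp del: of_nat_Suc)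
    ultimately show ?thesis using Suc by (simp add: algebra_simps del: fact_Suc)
  qed simp
qed simp

lemma ent_scaled: "n \<ge> 1 \<Longrightarrow> real n * ent (real a / real n) = real a * ln n - real a * ln a"
  by (cases "a = 0") (auto simp: ent_def ln_div algebra_simps)

text \<open>In \<open>e\<close>, 6 ln (n + 1) + 3 covers the upper Stirling errors of the three
  factorials in the denominator, and l / 2 arises because \<open>pair_energy\<close> has k (k - 1)
  in place of k^2.\<close>

lemma weight_bounds:
  assumes abc: "a + b + c = n" and n: "n \<ge> 1" and l: "l \<ge> 0"
  defines "F \<equiv> real n * free l (real a / n) (real b / n) (real c / n)"
    and "e \<equiv> 6 * ln (real n + 1) + 3 + l / 2"
  shows "weight n (l / n) (triple a b c) \<le> exp (F + e)" "exp (F - e) \<le> weight n (l / n) (triple a b c)"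
proof -
  define C where "C = real (card (macrostate n (triple a b c)))"
  have "C * (fact a * fact b * fact c) = fact n" unfolding C_def by (rule card_macrostate[OF abc])
  then have C: "C = fact n / (fact a * fact b * fact c)" by (simp add: field_simps)
  then have C0: "C > 0" by simp
  have lnC: "ln C = ln (fact n) - ln (fact a) - ln (fact b) - ln (fact c)"
    unfolding C by (simp add: ln_div ln_mult)
  define H where "H = real n * (ent (real a / n) + ent (real b / n) + ent (real c / n))"
  have sum: "real a + real b + real c = real n" using abc by (simp flip: of_nat_add)
  have "H = (real a + real b + real c) * ln n - real a * ln a - real b * ln b - real c * ln c"
    unfolding H_def distrib_left ent_scaled[OF n] by (simp add: algebra_simps)
  then have H: "H = real n * ln n - real a * ln a - real b * ln b - real c * ln c" unfolding sum .
  have k: "ln (real k + 1) \<le> ln (real n + 1)" if "k \<le> n" for k using that by simp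
  have ln_n: "ln (real n + 1) \<ge> 0" by simp
  have up: "ln C \<le> H + 6 * ln (real n + 1) + 3"
    using ln_fact_upper[of n] ln_fact_lower[of a] ln_fact_lower[of b] ln_fact_lower[of c] sum
      ln_n unfolding lnC H by linarith
  have le_n: "a \<le> n" "b \<le> n" "c \<le> n" using abc by auto
  have low: "H - (6 * ln (real n + 1) + 3) \<le> ln C"
    using ln_fact_lower[of n] ln_fact_upper[of a] ln_fact_upper[of b] ln_fact_upper[of c] sum
      k[of a] k[of b] k[of c] le_n unfolding lnC H by linarith
  have "l / n * pair_energy (triple a b c) = real n * (l / 2 * ((real a / n)\<^sup>2 + (real b / n)\<^sup>2 + (real c / n)\<^sup>2)) - l / 2"
  proof -
    have "pair_energy (triple a b c) = ((real a)\<^sup>2 + (real b)\<^sup>2 + (real c)\<^sup>2 - real n) / 2"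
      using sum by (simp add: pair_energy_def spins_def power2_eq_square field_simps)
    then show ?thesis using n by (simp only:) (simp add: power2_eq_square field_simps)
  qed
  then have "weight n (l / n) (triple a b c)
      = exp (ln C + (real n * (l / 2 * ((real a / n)\<^sup>2 + (real b / n)\<^sup>2 + (real c / n)\<^sup>2)) - l / 2))"
    unfolding weight_def boltzmann_def C_def[symmetric] exp_add using C0 by simp
  moreover have "F = H + real n * (l / 2 * ((real a / n)\<^sup>2 + (real b / n)\<^sup>2 + (real c / n)\<^sup>2))"
    unfolding F_def H_def free_def by (simp add: algebra_simps)
  ultimately show "weight n (l / n) (triple a b c) \<le> exp (F + e)" "exp (F - e) \<le> weight n (l / n) (triple a b c)"
    using up low l by (simp_all add: e_def)
qed

section \<open>Uniform comparison of weights with the free energy\<close>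

lemma free_uniformly_continuous:
  assumes "\<eta> > 0" "\<mu> \<ge> 0"
  obtains d where "d > 0" "\<And>l a b c a' b' c'. \<lbrakk>0 \<le> l; l \<le> \<mu>; a \<in> {0..1}; b \<in> {0..1}; c \<in> {0..1};
    a' \<in> {0..1}; b' \<in> {0..1}; c' \<in> {0..1}; \<bar>a - a'\<bar> \<le> d; \<bar>b - b'\<bar> \<le> d; \<bar>c - c'\<bar> \<le> d\<rbrakk>
    \<Longrightarrow> \<bar>free l a b c - free l a' b' c'\<bar> \<le> \<eta>"
proof -
  have "uniformly_continuous_on {0..1} ent"
    by (rule compact_uniformly_continuous) (auto intro: continuous_on_subset[OF continuous_ent])
  then obtain d0 where d0: "d0 > 0" "\<And>x y. x \<in> {0..1} \<Longrightarrow> y \<in> {0..1} \<Longrightarrow> \<bar>x - y\<bar> < d0 \<Longrightarrow> \<bar>ent x - ent y\<bar> < \<eta> / 6"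
    unfolding uniformly_continuous_on_def dist_real_def using assms
    by (metis divide_pos_pos zero_less_numeral abs_minus_commute)
  \<comment> \<open>\<open>free\<close> has three entropies and three squares, each allowed \<eta> /
    6. The field touches only the squares, where l \<le> \<mu> makes \<open>d\<close> uniform in
    l.\<close>
  define e where "e = \<eta> / 6"
  define d where "d = min (d0 / 2) (e / (\<mu> + 1))"
  have d: "d > 0" "d < d0" "d * (\<mu> + 1) \<le> \<eta> / 6"
  proof -
    show "d > 0" "d < d0" using d0 assms by (auto simp: d_def e_def)
    have "d * (\<mu> + 1) \<le> e / (\<mu> + 1) * (\<mu> + 1)"
      using assms by (intro mult_right_mono) (auto simp: d_def)
    also have "\<dots> = \<eta> / 6" unfolding e_def[symmetric] using assms by simp
    finally show "d * (\<mu> + 1) \<le> \<eta> / 6" .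
  qed
  have sq: "\<bar>l / 2 * x\<^sup>2 - l / 2 * y\<^sup>2\<bar> \<le> \<eta> / 6"
    if "0 \<le> l" "l \<le> \<mu>" "x \<in> {0..1}" "y \<in> {0..1}" "\<bar>x - y\<bar> \<le> d" for l x y
  proof -
    have "\<bar>l / 2 * x\<^sup>2 - l / 2 * y\<^sup>2\<bar> = l / 2 * (x + y) * \<bar>x - y\<bar>"
    proof -
      have "l / 2 * x\<^sup>2 - l / 2 * y\<^sup>2 = (l / 2 * (x + y)) * (x - y)"
        by (simp add: power2_eq_square algebra_simps)
      then show ?thesis using that by (simp only: abs_mult) simp
    qed
    also have "\<dots> \<le> (\<mu> / 2 * 2) * d" using that assms by (intro mult_mono) auto
    also have "\<dots> \<le> \<eta> / 6" using d by (simp add: algebra_simps)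
    finally show ?thesis .
  qed
  show ?thesis
  proof (rule that[OF d(1)])
    fix l a b c a' b' c' :: real
    assume *: "0 \<le> l" "l \<le> \<mu>" "a \<in> {0..1}" "b \<in> {0..1}" "c \<in> {0..1}" "a' \<in> {0..1}" "b' \<in> {0..1}"
      "c' \<in> {0..1}" "\<bar>a - a'\<bar> \<le> d" "\<bar>b - b'\<bar> \<le> d" "\<bar>c - c'\<bar> \<le> d"
    have "\<bar>ent a - ent a'\<bar> \<le> \<eta> / 6" "\<bar>ent b - ent b'\<bar> \<le> \<eta> / 6" "\<bar>ent c - ent c'\<bar> \<le> \<eta> / 6"
      using d0(2)[of a a'] d0(2)[of b b'] d0(2)[of c c'] * d(2) by auto
    moreover have "\<bar>l / 2 * a\<^sup>2 - l / 2 * a'\<^sup>2\<bar> \<le> \<eta> / 6" "\<bar>l / 2 * b\<^sup>2 - l / 2 * b'\<^sup>2\<bar> \<le> \<eta> / 6"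
      "\<bar>l / 2 * c\<^sup>2 - l / 2 * c'\<^sup>2\<bar> \<le> \<eta> / 6" using sq * by auto
    ultimately show "\<bar>free l a b c - free l a' b' c'\<bar> \<le> \<eta>"
      unfolding free_def distrib_left by linarith
  qed
qed

text \<open>An odd remainder favours colour 2, which keeps colours 2 and 3 ordered and puts
  consecutive values of \<open>r\<close> one recolouring apart.\<close>

definition sym_type :: "nat \<Rightarrow> nat \<Rightarrow> nat \<Rightarrow> nat" where
  "sym_type n r = triple r ((n - r + 1) div 2) ((n - r) div 2)"

lemma sym_type_sum:
  fixes r n :: nat
  assumes "r \<le> n"
  shows "r + (n - r + 1) div 2 + (n - r) div 2 = n"
proof -
  have "(d + 1) div 2 + d div 2 = d" for d :: nat by presburger
  then show ?thesis using assms by (metis add.assoc le_add_diff_inverse)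
qed

lemma sym_type_in_types: "r \<le> n \<Longrightarrow> sym_type n r \<in> types n \<longleftrightarrow> (n - r + 1) div 2 \<le> r"
  using sym_type_sum[of r n] by (auto simp: sym_type_def triple_in_types)

text \<open>Half of \<eta> pays for rounding the proportions, half for the Stirling error. The
  threshold in n is uniform in l, since all tempering levels are treated together.\<close>

lemma sym_type_weight:
  assumes \<eta>: "\<eta> > 0" and \<mu>: "\<mu> \<ge> 0"
  shows "\<forall>\<^sub>F n in sequentially. \<forall>l r. 0 \<le> l \<and> l \<le> \<mu> \<and> r \<le> n \<longrightarrow>
    weight n (l / n) (sym_type n r) \<le> exp (real n * (sym_free l (real r / n) + \<eta>)) \<and>
    exp (real n * (sym_free l (real r / n) - \<eta>)) \<le> weight n (l / n) (sym_type n r)"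
proof -
  have "\<eta> / 2 > 0" using \<eta> by simp
  then obtain d where d: "d > 0" "\<And>l a b c a' b' c'. \<lbrakk>0 \<le> l; l \<le> \<mu>; a \<in> {0..1}; b \<in> {0..1}; c \<in> {0..1};
    a' \<in> {0..1}; b' \<in> {0..1}; c' \<in> {0..1}; \<bar>a - a'\<bar> \<le> d; \<bar>b - b'\<bar> \<le> d; \<bar>c - c'\<bar> \<le> d\<rbrakk>
    \<Longrightarrow> \<bar>free l a b c - free l a' b' c'\<bar> \<le> \<eta> / 2"
    by (rule free_uniformly_continuous[OF _ \<mu>]) (rule that)
  have "(\<lambda>n. (6 * ln (real n + 1) + 3 + \<mu> / 2) / real n) \<longlonglongrightarrow> 0" by real_asymp
  from order_tendstoD(2)[OF this \<open>\<eta> / 2 > 0\<close>] eventually_gt_at_top[of 0]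
  have "\<forall>\<^sub>F n in sequentially. 6 * ln (real n + 1) + 3 + \<mu> / 2 \<le> real n * (\<eta> / 2)"
    by eventually_elim (simp add: field_simps)
  moreover have "\<forall>\<^sub>F n in sequentially. 1 / real n \<le> d"
    using order_tendstoD(2)[OF lim_1_over_n d(1)] by eventually_elim simp
  ultimately show ?thesis using eventually_ge_at_top[of 1]
  proof eventually_elim
    case (elim n)
    show ?case
    proof (intro allI impI)
      fix l r assume *: "0 \<le> l \<and> l \<le> \<mu> \<and> r \<le> n"
      let ?b = "(n - r + 1) div 2" and ?c = "(n - r) div 2"
      let ?F = "free l (real r / n) (real ?b / n) (real ?c / n)" and ?w = "weight n (l / n) (sym_type n r)" and ?f = "sym_free l (real r / n)"
      have s: "r + ?b + ?c = n" using sym_type_sum * by blast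
      have frac: "real k / n \<in> {0..1}" if "k \<le> n" for k using that elim by (auto simp: field_simps)
      have half: "(1 - real r / n) / 2 = real (n - r) / 2 / n" using elim * by (simp add: field_simps of_nat_diff)
      have close: "\<bar>x / n - (1 - real r / n) / 2\<bar> \<le> d" if "\<bar>x - real (n - r) / 2\<bar> \<le> 1" for x
      proof -
        have "\<bar>x / n - (1 - real r / n) / 2\<bar> = \<bar>x - real (n - r) / 2\<bar> / n"
          unfolding half diff_divide_distrib[symmetric] by simp
        also have "\<dots> \<le> 1 / n" using that by (intro divide_right_mono) auto
        finally show ?thesis using elim by simp
      qed
      have "\<bar>?F
          - free l (real r / n) ((1 - real r / n) / 2) ((1 - real r / n) / 2)\<bar> \<le> \<eta> / 2"
      proof (rule d(2))
        have "real ?b \<le> real (n - r) / 2 + 1" "real (n - r) / 2 \<le> real ?b" by linarith+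
        then have "\<bar>real ?b - real (n - r) / 2\<bar> \<le> 1" by linarith
        then show "\<bar>real ?b / n - (1 - real r / n) / 2\<bar> \<le> d" by (rule close)
        have "real ?c \<le> real (n - r) / 2" "real (n - r) / 2 \<le> real ?c + 1" by linarith+
        then have "\<bar>real ?c - real (n - r) / 2\<bar> \<le> 1" by linarith
        then show "\<bar>real ?c / n - (1 - real r / n) / 2\<bar> \<le> d" by (rule close)
        have "(1 - x) / 2 \<in> {0..1}" if "x \<in> {0..1}" for x :: real using that by simp
        from this[OF frac] show "(1 - real r / n) / 2 \<in> {0..1}" "(1 - real r / n) / 2 \<in> {0..1}"
          using * by simp_all
      qed (use frac s * d(1) in auto)
      then have "\<bar>?F - ?f\<bar> \<le> \<eta> / 2"
        by (simp add: sym_free_def)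
      then have f: "real n * (?f - \<eta> / 2) \<le> real n * ?F"
        "real n * ?F \<le> real n * (?f + \<eta> / 2)"
        unfolding abs_diff_le_iff by (auto intro!: mult_left_mono)
      have e: "6 * ln (real n + 1) + 3 + l / 2 \<le> real n * (\<eta> / 2)" using elim * by simp
      note w = weight_bounds[OF s elim(3), of l]
      show "?w \<le> exp (real n * (?f + \<eta>)) \<and>
        exp (real n * (?f - \<eta>)) \<le> ?w"
      proof
        have "?w
            \<le> exp (real n * ?F + (6 * ln (real n + 1) + 3 + l / 2))"
          using w(1) * by (simp add: sym_type_def)
        also have "\<dots> \<le> exp (real n * (?f + \<eta>))"
          using f(2) e by (simp add: algebra_simps)
        finally show "?w \<le> exp (real n * (?f + \<eta>))" .
        have "exp (real n * (?f - \<eta>))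
            \<le> exp (real n * ?F - (6 * ln (real n + 1) + 3 + l / 2))"
          using f(1) e by (simp add: algebra_simps)
        also have "\<dots> \<le> ?w"
          using w(2) * by (simp add: sym_type_def)
        finally show "exp (real n * (?f - \<eta>)) \<le> ?w" .
      qed
    qed
  qed
qed

section \<open>Routes to the dominant macrostate\<close>

text \<open>With x = k i and y = k j + 1 the weights have ratio (x / y) exp ((y - x) l / n). Since y
  / x \<le> exp ((y - x) / x), it is enough that (y - x) / x \<le> (y - x) l / n, and
  \<open>side\<close> lists the two ways in which this happens.\<close>

lemma weight_respin_mono:
  assumes n: "n \<ge> 1" and l: "l > 0" and ij: "i \<noteq> j" "i \<in> spins" "j \<in> spins" "k i > 0"
    and side: "real n / l \<le> k i \<and> k i \<le> k j + 1 \<or> k i \<le> real n / l \<and> k j + 1 \<le> k i"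
  shows "weight n (l / n) k \<le> weight n (l / n) (respin i j k)"
proof -
  define x y where "x = real (k i)" and "y = real (k j + 1)"
  have x: "x > 0" "y > 0" using ij by (auto simp: x_def y_def)
  have "y / x \<le> exp (y / x - 1)" using exp_ge_add_one_self[of "y / x - 1"] by simp
  also have "y / x - 1 = (y - x) / x" using x by (simp add: field_simps)
  also have "(y - x) / x \<le> (y - x) * (l / n)"
  proof -
    from side consider "real n / l \<le> x" "x \<le> y" | "x \<le> real n / l" "y \<le> x"
      by (auto simp: x_def y_def)
    then show ?thesis
    proof cases
      case 1
      then have "1 / x \<le> l / n" using l n x by (simp add: field_simps)
      then show ?thesis using mult_left_mono[of "1 / x" "l / n" "y - x"] 1 by simp
    next
      case 2
      then have "l / n \<le> 1 / x" using l n x by (simp add: field_simps)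
      then show ?thesis using mult_left_mono_neg[of "l / n" "1 / x" "y - x"] 2 by simp
    qed
  qed
  finally have *: "y \<le> x * exp ((y - x) * (l / n))" using x by (simp add: field_simps)
  define N N' where "N = real (card (macrostate n k))" and "N' = real (card (macrostate n (respin i j k)))"
  have N: "x * N = y * N'"
    using card_macrostate_respin[of i j k n, OF ij] by (simp add: x_def y_def N_def N'_def)
  have "y * (N * boltzmann (l / n) k) \<le> x * exp ((y - x) * (l / n)) * (N * boltzmann (l / n) k)"
    using * by (intro mult_right_mono) (auto simp: N_def boltzmann_def)
  also have "\<dots> = y * (N' * (exp ((y - x) * (l / n)) * boltzmann (l / n) k))"
    using N by (simp add: mult_ac)
  also have "exp ((y - x) * (l / n)) * boltzmann (l / n) k = boltzmann (l / n) (respin i j k)"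
    unfolding boltzmann_def pair_energy_respin[of i j k, OF ij] exp_add[symmetric] x_def y_def
    by (simp add: algebra_simps)
  finally show ?thesis using x by (simp add: weight_def N_def N'_def)
qed

text \<open>The single-site weight ratio is governed by \<open>t \<mapsto> l t / n - ln t\<close>, which decreases up to
  \<open>n / l\<close> and increases afterwards. Hence draining the second colour into the first while it
  exceeds \<open>n / l\<close>, and into the third afterwards, never decreases the weight.\<close>

lemma route_to_symmetric:
  assumes n: "n \<ge> 1" and l: "l > 0"
  shows "b \<le> a \<Longrightarrow> c \<le> b \<Longrightarrow> a + b + c = n \<Longrightarrow>
    \<exists>r len. len \<le> (n - a) * (n + 2) + (b - c) \<and> r \<le> n \<and> sym_type n r \<in> types n \<and>
      weight n (l / n) (triple a b c) \<le> weight n (l / n) (sym_type n r) \<and>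
      route n (l / n) (weight n (l / n) (triple a b c)) len (triple a b c) (sym_type n r)"
proof (induction "(n - a) * (n + 2) + (b - c)" arbitrary: a b c rule: less_induct)
  case less
  let ?w = "weight n (l / n)" and ?k = "triple a b c"
  have ind: ?case
    if ij: "i \<noteq> j" "i \<in> spins" "j \<in> spins" "?k i > 0"
      and k': "respin i j ?k = triple a' b' c'" "b' \<le> a'" "c' \<le> b'" "a' + b' + c' = n"
      and w: "?w ?k \<le> ?w (triple a' b' c')"
      and m: "(n - a') * (n + 2) + (b' - c') < (n - a) * (n + 2) + (b - c)" for i j a' b' c'
  proof -
    obtain r len where r: "len \<le> (n - a') * (n + 2) + (b' - c')" "r \<le> n" "sym_type n r \<in> types n"
      "?w (triple a' b' c') \<le> ?w (sym_type n r)"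
      "route n (l / n) (?w (triple a' b' c')) len (triple a' b' c') (sym_type n r)"
      using less.hyps[OF m k'(2-4)] by blast
    have "route n (l / n) (?w ?k) (Suc len) ?k (sym_type n r)"
      by (rule route_step[of i j])
         (use ij k' w r route_mono[OF r(5) w] in \<open>auto simp: triple_in_types\<close>)
    then show ?thesis using r w m by (intro exI[of _ r] exI[of _ "Suc len"]) auto
  qed
  show ?case
  \<comment> \<open>Counts differing by at most one are already balanced up to rounding, so the
    route ends.\<close>
  proof (cases "b \<le> c + 1")
    case True
    then have "(n - a + 1) div 2 = b" "(n - a) div 2 = c" using less.prems by auto
    then have "sym_type n a = ?k" by (simp add: sym_type_def)
    then show ?thesis using less.prems
      by (intro exI[of _ a] exI[of _ 0]) (auto simp: triple_in_types intro: route_refl)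
  next
    case False
    show ?thesis
    proof (cases "real n / l \<le> b")
      case True
      show ?thesis
      proof (rule ind[of 2 1 "a + 1" "b - 1" c])
        show "?w ?k \<le> ?w (triple (a + 1) (b - 1) c)"
          using weight_respin_mono[OF n l, of 2 1 ?k] True False less.prems by simp
        have "n - a = Suc (n - (a + 1))" using less.prems False by auto
        then have "(n - a) * (n + 2) = (n - (a + 1)) * (n + 2) + (n + 2)" by simp
        then show "(n - (a + 1)) * (n + 2) + (b - 1 - c) < (n - a) * (n + 2) + (b - c)" by linarith
      qed (use False less.prems in auto)
    next
      case F2: False
      show ?thesis
      proof (rule ind[of 2 3 a "b - 1" "c + 1"])
        show "?w ?k \<le> ?w (triple a (b - 1) (c + 1))"
          using weight_respin_mono[OF n l, of 2 3 ?k] F2 False less.prems by simp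
      qed (use False less.prems in auto)
    qed
  qed
qed

text \<open>The parity of n - r decides which colour gives up a vertex: colour 3 if the remainder is
  even, colour 2 if it is odd.\<close>

lemma sym_type_up:
  assumes "r < n"
  obtains i j where "i \<noteq> j" "i \<in> spins" "j \<in> spins" "sym_type n r i > 0"
    "respin i j (sym_type n r) = sym_type n (Suc r)"
proof (cases "even (n - r)")
  case True
  then obtain p where p: "n - r = 2 * p" by (elim evenE)
  then have "n - Suc r = 2 * (p - 1) + 1" "p > 0" using assms by auto
  then have "sym_type n (Suc r) = triple (Suc r) p (p - 1)" unfolding sym_type_def by simp
  moreover have "sym_type n r = triple r p p" unfolding sym_type_def p by simp
  ultimately show ?thesis using \<open>p > 0\<close> by (intro that[of 3 1]) auto
next
  case False
  then obtain p where p: "n - r = 2 * p + 1" by (elim oddE)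
  then have "n - Suc r = 2 * p" by simp
  then have "sym_type n (Suc r) = triple (Suc r) p p" unfolding sym_type_def by simp
  moreover have "sym_type n r = triple r (Suc p) p" unfolding sym_type_def p by simp
  ultimately show ?thesis by (intro that[of 2 1]) auto
qed

lemma sym_type_down:
  assumes "r < n"
  obtains i j where "i \<noteq> j" "i \<in> spins" "j \<in> spins" "sym_type n (Suc r) i > 0"
    "respin i j (sym_type n (Suc r)) = sym_type n r"
proof -
  obtain i j where ij: "i \<noteq> j" "i \<in> spins" "j \<in> spins" "sym_type n r i > 0"
    "respin i j (sym_type n r) = sym_type n (Suc r)"
    using sym_type_up[OF assms] by blast
  then have "respin j i (sym_type n (Suc r)) = sym_type n r" using respin_respin by metis
  moreover have "sym_type n (Suc r) j > 0" using ij(1) by (simp add: ij(5)[symmetric] respin_def)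
  ultimately show ?thesis using that[of j i] ij by auto
qed

lemma route_up:
  assumes "r \<le> s" "s \<le> n"
    "\<And>t. r \<le> t \<Longrightarrow> t \<le> s \<Longrightarrow> sym_type n t \<in> types n \<and> m \<le> weight n \<beta> (sym_type n t)"
  shows "route n \<beta> m (s - r) (sym_type n r) (sym_type n s)"
  using assms
proof (induction "s - r" arbitrary: r)
  case 0
  then show ?case by (simp add: route_refl)
next
  case (Suc d)
  then have r: "r < n" "d = s - Suc r" "s - r = Suc (s - Suc r)" by auto
  obtain i j where ij: "i \<noteq> j" "i \<in> spins" "j \<in> spins" "sym_type n r i > 0"
    "respin i j (sym_type n r) = sym_type n (Suc r)" using sym_type_up[OF r(1)] by blast
  have "route n \<beta> m (s - Suc r) (sym_type n (Suc r)) (sym_type n s)"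
    using Suc r by (intro Suc.hyps(1)) auto
  then show ?case unfolding r(3) using Suc ij by (intro route_step[of i j]) auto
qed

lemma route_down:
  assumes "s \<le> r" "r \<le> n"
    "\<And>t. s \<le> t \<Longrightarrow> t \<le> r \<Longrightarrow> sym_type n t \<in> types n \<and> m \<le> weight n \<beta> (sym_type n t)"
  shows "route n \<beta> m (r - s) (sym_type n r) (sym_type n s)"
  using assms
proof (induction "r - s" arbitrary: r)
  case 0
  then show ?case by (simp add: route_refl)
next
  case (Suc d)
  then obtain r' where r': "r = Suc r'" by (cases r) auto
  then have r: "r' < n" "d = r' - s" "r - s = Suc (r' - s)" using Suc by auto
  obtain i j where ij: "i \<noteq> j" "i \<in> spins" "j \<in> spins" "sym_type n r i > 0"
    "respin i j (sym_type n r) = sym_type n r'" using sym_type_down[OF r(1)] r' by blast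
  have "route n \<beta> m (r' - s) (sym_type n r') (sym_type n s)"
    using Suc r r' by (intro Suc.hyps(1)) auto
  then show ?case unfolding r(3) using Suc ij r' by (intro route_step[of i j]) auto
qed

text \<open>Serves both mixing bounds. The tempering bound uses \<open>n div 2 < a\<close> and the
  near-maximal weight; the Metropolis bound uses the near-maximal weight, the routes, and
  \<open>b + 2 \<le> a\<close> for colour swaps.\<close>

definition accessible_hub :: "real \<Rightarrow> real \<Rightarrow> real \<Rightarrow> nat \<Rightarrow> nat \<Rightarrow> nat \<Rightarrow> nat \<Rightarrow> bool" where
  "accessible_hub \<mu> B \<eta> n a b c \<longleftrightarrow> triple a b c \<in> types n \<and> b + 2 \<le> a \<and> n div 2 < a \<and>
    (\<forall>k\<in>types n. exp (- \<eta> * real n) * weight n (\<mu> / n) k \<le> weight n (\<mu> / n) (triple a b c) \<and>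
      (\<exists>len\<le>(n + 2) * (n + 2). route n (\<mu> / n) (exp (- (B + \<eta>) * n) * weight n (\<mu> / n) k)
        len k (triple a b c)))"

text \<open>The hub is the symmetric type closest below the peak \<open>m\<close>. Any macrostate
  first reaches a symmetric type without losing weight, and the walk along the symmetric types to
  the hub dips by at most \<open>B\<close> up to rounding.\<close>

lemma hub_routes:
  assumes \<mu>: "\<mu> > 4 * ln 2"
  obtains B where "0 \<le> B" "B < barrier" "\<And>\<eta>. \<eta> > 0 \<Longrightarrow> \<forall>\<^sub>F n in sequentially. \<exists>a b c. accessible_hub \<mu> B \<eta> n a b c"
proof -
  have \<mu>0: "\<mu> > 0" using \<mu> by (smt (verit) ln_gt_zero)
  obtain m B where m: "1/2 < m" "m < 1" and B: "0 \<le> B" "B < barrier"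
    and up: "\<And>x y. 1/3 \<le> x \<Longrightarrow> x \<le> y \<Longrightarrow> y \<le> m \<Longrightarrow> sym_free \<mu> x - sym_free \<mu> y \<le> B"
    and down: "\<And>x y. m \<le> y \<Longrightarrow> y \<le> x \<Longrightarrow> x \<le> 1 \<Longrightarrow> sym_free \<mu> x - sym_free \<mu> y \<le> B"
    and peak: "\<And>x. 1/3 \<le> x \<Longrightarrow> x \<le> 1 \<Longrightarrow> sym_free \<mu> x \<le> sym_free \<mu> m"
    using landscape[OF \<mu>] by blast
  show ?thesis
  proof (rule that[OF B])
    fix \<eta>0 :: real assume \<eta>0: "\<eta>0 > 0"
    \<comment> \<open>Two parts convert weights to free energies at both ends of a comparison, the
      third covers the rounding of \<open>m\<close>.\<close>
    define \<eta> where "\<eta> = \<eta>0 / 3"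
    have \<eta>: "\<eta> > 0" using \<eta>0 by (simp add: \<eta>_def)
    have "isCont (sym_free \<mu>) m" using DERIV_isCont[OF DERIV_sym_free[of m \<mu>]] m by simp
    then obtain d where d: "d > 0" "\<And>x. \<bar>x - m\<bar> < d \<Longrightarrow> \<bar>sym_free \<mu> x - sym_free \<mu> m\<bar> < \<eta>"
      using \<eta> unfolding continuous_at_eps_delta dist_real_def by blast
    have "\<forall>\<^sub>F n in sequentially. 1 / real n < d" using order_tendstoD(2)[OF lim_1_over_n d(1)] .
    then show "\<forall>\<^sub>F n in sequentially. \<exists>a b c. accessible_hub \<mu> B \<eta>0 n a b c"
      using sym_type_weight[OF \<eta> less_imp_le[OF \<mu>0]] eventually_ge_at_top[of 20]
        eventually_gt_at_top[of "nat \<lceil>1 / (m - 1/2)\<rceil>"]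
    proof eventually_elim
      case (elim n)
      let ?w = "weight n (\<mu> / n)"
      have n: "n \<ge> 20" "n \<ge> 1" using elim by auto
      have w: "?w (sym_type n r) \<le> exp (real n * (sym_free \<mu> (real r / n) + \<eta>))"
        "exp (real n * (sym_free \<mu> (real r / n) - \<eta>)) \<le> ?w (sym_type n r)" if "r \<le> n" for r
        using elim(2) that \<mu>0 by auto
      define s where "s = nat \<lfloor>m * real n\<rfloor>"
      have s: "real s \<le> m * n" "m * n < real s + 1" using m n by (auto simp: s_def)
      have sn: "s \<le> n"
      proof -
        have "m * real n \<le> 1 * real n" using m by (intro mult_right_mono) auto
        then show ?thesis using s by simp
      qed
      have s_close: "\<bar>real s / n - m\<bar> < d"
      proof -
        have "real s / n - m = (real s - m * n) / n" using n by (simp add: diff_divide_distrib)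
        then have "\<bar>real s / n - m\<bar> = \<bar>real s - m * n\<bar> / n" by (simp only: abs_divide)
        also have "\<dots> \<le> 1 / n" using s by (intro divide_right_mono) auto
        finally show ?thesis using elim(1) by simp
      qed
      \<comment> \<open>A margin of one keeps the first colour above n / 2 after rounding
        down.\<close>
      have mn: "m * n > real n / 2 + 1"
      proof -
        have "1 / (m - 1/2) < real n" using elim(4) by linarith
        then show ?thesis using m by (simp add: field_simps)
      qed
      then have s2: "2 * s \<ge> n + 1" using s by linarith
      have s3: "(n - s + 1) div 2 + 2 \<le> s" using s2 n by linarith
      define h where "h = sym_type n s"
      have h: "h = triple s ((n - s + 1) div 2) ((n - s) div 2)" by (simp add: h_def sym_type_def)
      have hT: "h \<in> types n" unfolding h_def using s3 sn by (simp add: sym_type_in_types)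
      have dip: "sym_free \<mu> (real r / n) - sym_free \<mu> (real t / n) \<le> B + \<eta>"
        if r: "n \<le> 3 * r" "r \<le> n" and t: "r \<le> t \<and> t \<le> s \<or> s \<le> t \<and> t \<le> r" for r t
      proof -
        have rr: "1/3 \<le> real r / n" "real r / n \<le> 1" using r n by (auto simp: field_simps)
        \<comment> \<open>The endpoint \<open>t = s\<close> is separate because s / n may lie below
          \<open>m\<close>, where the estimate from above does not apply; closeness to the maximum
          replaces it.\<close>
        consider "r \<le> t" "t \<le> s" | "t = s" | "s < t" "t \<le> r" using t by linarith
        then show ?thesis
        proof cases
          case 1
          then have "real t / n \<le> m" using s n by (simp add: field_simps)
          moreover have "real r / n \<le> real t / n" using 1 by (simp add: divide_right_mono)
          ultimately show ?thesis using up[OF rr(1)] \<eta> by fastforce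
        next
          case 2
          then show ?thesis using d(2)[OF s_close] peak[OF rr] B by simp
        next
          case 3
          then have "m \<le> real t / n" using s n by (simp add: field_simps)
          moreover have "real t / n \<le> real r / n" using 3 by (simp add: divide_right_mono)
          ultimately show ?thesis using down[OF _ _ rr(2)] \<eta> by fastforce
        qed
      qed
      have main: "exp (- \<eta>0 * real n) * ?w k \<le> ?w h \<and>
        (\<exists>len\<le>(n + 2) * (n + 2). route n (\<mu> / n) (exp (- (B + \<eta>0) * real n) * ?w k) len k h)"
        if k: "k \<in> types n" for k
      proof -
        let ?v = "exp (- (B + \<eta>0) * real n) * ?w k"
        obtain a b c where abc: "k = triple a b c" "b \<le> a" "c \<le> b" "a + b + c = n" using k by (rule types_E)
        obtain r len where r: "len \<le> (n - a) * (n + 2) + (b - c)" "r \<le> n" "sym_type n r \<in> types n"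
          "?w k \<le> ?w (sym_type n r)" "route n (\<mu> / n) (?w k) len k (sym_type n r)"
          using route_to_symmetric[OF n(2) \<mu>0 abc(2-4)] unfolding abc(1) by blast
        have r3: "(n - r + 1) div 2 \<le> r" using r(2,3) by (simp add: sym_type_in_types)
        then have rn: "n \<le> 3 * r" by linarith
        have rr: "1/3 \<le> real r / n" "real r / n \<le> 1" using rn r(2) n by (auto simp: field_simps)
        have w_le: "exp (- (e + \<eta>0) * real n) * ?w k \<le> ?w (sym_type n t)"
          if "t \<le> n" "sym_free \<mu> (real r / n) - sym_free \<mu> (real t / n) \<le> e + \<eta>" for e t
        proof -
          have "exp (- (e + \<eta>0) * real n) * ?w k
              \<le> exp (- (e + \<eta>0) * real n) * exp (real n * (sym_free \<mu> (real r / n) + \<eta>))"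
            using r(4) w(1)[OF r(2)] by (intro mult_left_mono) auto
          also have "\<dots> = exp (real n * (sym_free \<mu> (real r / n) + \<eta> - e - 3 * \<eta>))"
            by (simp add: exp_add[symmetric] \<eta>_def algebra_simps)
          also have "\<dots> \<le> exp (real n * (sym_free \<mu> (real t / n) - \<eta>))"
            using that(2) by (auto intro!: mult_left_mono)
          also have "\<dots> \<le> ?w (sym_type n t)" by (rule w(2)[OF that(1)])
          finally show ?thesis .
        qed
        have between: "sym_type n t \<in> types n \<and> ?v \<le> ?w (sym_type n t)"
          if "r \<le> t \<and> t \<le> s \<or> s \<le> t \<and> t \<le> r" for t
        proof
          have "t \<le> n" using that sn r(2) by auto
          then show "?v \<le> ?w (sym_type n t)"
            using w_le dip[OF rn r(2) that] by blast
          have "(n - t + 1) div 2 \<le> t" using that r3 s3 by linarith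
          then show "sym_type n t \<in> types n" using \<open>t \<le> n\<close> by (simp add: sym_type_in_types)
        qed
        have "sym_free \<mu> (real r / n) - sym_free \<mu> (real s / n) \<le> 0 + \<eta>"
          using d(2)[OF s_close] peak[OF rr] by linarith
        then have 1: "exp (- \<eta>0 * real n) * ?w k \<le> ?w h"
          using w_le[OF sn, of 0] by (simp add: h_def)
        have "\<exists>l2\<le>n. route n (\<mu> / n) (?v) l2 (sym_type n r) h"
        proof (cases "r \<le> s")
          case True
          then show ?thesis unfolding h_def
            using route_up[OF True sn, of "?v"] between sn
            by (intro exI[of _ "s - r"]) auto
        next
          case False
          then show ?thesis unfolding h_def
            using route_down[of s r n "?v"] between r(2)
            by (intro exI[of _ "r - s"]) auto
        qed
        then obtain l2 where l2: "l2 \<le> n"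
          "route n (\<mu> / n) (?v) l2 (sym_type n r) h" by blast
        have "- (B + \<eta>0) * real n \<le> 0" using B \<eta>0 by (intro mult_nonpos_nonneg) auto
        then have "?v \<le> 1 * ?w k"
          by (intro mult_right_mono) simp_all
        then have "route n (\<mu> / n) (?v) (len + l2) k h"
          using route_trans[OF route_mono[OF r(5)] l2(2)] by simp
        moreover have "len + l2 \<le> (n + 2) * (n + 2)"
        proof -
          have "(n - a) * (n + 2) \<le> n * (n + 2)" by (intro mult_right_mono) auto
          then show ?thesis using r(1) l2(1) abc by (simp add: algebra_simps)
        qed
        ultimately show ?thesis using 1 by blast
      qed
      show ?case
        using main hT s2 s3 unfolding h accessible_hub_def
        by (intro exI[of _ s] exI[of _ "(n - s + 1) div 2"] exI[of _ "(n - s) div 2"]) auto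
    qed
  qed
qed

section \<open>The critical slice\<close>

lemma sym_free_uniformly_continuous:
  assumes "\<eta> > 0" "\<mu> \<ge> 0"
  obtains d where "d > 0" "\<And>l x y. \<lbrakk>0 \<le> l; l \<le> \<mu>; x \<in> {0..1}; y \<in> {0..1}; \<bar>x - y\<bar> \<le> d\<rbrakk>
    \<Longrightarrow> \<bar>sym_free l x - sym_free l y\<bar> \<le> \<eta>"
proof -
  obtain d where d: "d > 0" "\<And>l a b c a' b' c'. \<lbrakk>0 \<le> l; l \<le> \<mu>; a \<in> {0..1}; b \<in> {0..1}; c \<in> {0..1};
    a' \<in> {0..1}; b' \<in> {0..1}; c' \<in> {0..1}; \<bar>a - a'\<bar> \<le> d; \<bar>b - b'\<bar> \<le> d; \<bar>c - c'\<bar> \<le> d\<rbrakk>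
    \<Longrightarrow> \<bar>free l a b c - free l a' b' c'\<bar> \<le> \<eta>"
    by (rule free_uniformly_continuous[OF assms]) (rule that)
  show ?thesis
  proof (rule that[OF d(1)])
    fix l x y :: real
    assume *: "0 \<le> l" "l \<le> \<mu>" "x \<in> {0..1}" "y \<in> {0..1}" "\<bar>x - y\<bar> \<le> d"
    have "\<bar>(1 - x) / 2 - (1 - y) / 2\<bar> \<le> d" using *(5) d(1) by argo
    then show "\<bar>sym_free l x - sym_free l y\<bar> \<le> \<eta>"
      unfolding sym_free_def using * by (intro d(2)) auto
  qed
qed

lemma weight_le_Z: "k \<in> types n \<Longrightarrow> weight n \<beta> k \<le> Z_RGB n \<beta>"
  unfolding Z_eq by (rule member_le_sum) auto

text \<open>Below the transition the comparison state is the disordered one, above it the ordered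
  state \<open>(2/3, 1/6, 1/6)\<close>; both have the same free energy at \<open>4 ln 2\<close>.\<close>

lemma free_slice_bound:
  assumes x: "1/3 \<le> x" "x \<le> 1/2" and yz: "0 \<le> z" "z \<le> y" "y \<le> x" "x + y + z = 1" and l: "0 \<le> l"
    and close: "sym_free (4 * ln 2) x \<le> sym_free (4 * ln 2) (1/2) + \<eta>"
  shows "free l x y z \<le> max (sym_free l (1/3)) (sym_free l (2/3)) - barrier + \<eta>"
proof -
  let ?c = "4 * ln 2 :: real"
  define Q where "Q = x\<^sup>2 + y\<^sup>2 + z\<^sup>2"
  \<comment> \<open>Here y + z = 1 - x \<le> 2/3, so the balancing condition holds at 4 ln
    2.\<close>
  have "?c * (y + z) \<le> ?c * (2/3)" using x yz by (intro mult_left_mono) auto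
  also have "\<dots> \<le> 2" using ln2_le_25_over_36 by simp
  finally have "free ?c x y z \<le> free ?c x ((y + z) / 2) ((y + z) / 2)"
    using yz by (intro free_balance) auto
  also have "\<dots> = sym_free ?c x"
  proof -
    have "y + z = 1 - x" using yz by simp
    then show ?thesis by (simp add: sym_free_def)
  qed
  finally have c: "free ?c x y z \<le> sym_free ?c (1/2) + \<eta>" using close by simp
  have shift: "free l x y z = free ?c x y z + (l - ?c) / 2 * Q"
    by (simp add: free_def Q_def field_simps)
  \<comment> \<open>At fixed proportions the free energy is affine in l with slope Q / 2. Here Q
    lies between 1/3 and 1/2, its values at the disordered and the ordered state, so leaving 4 ln 2
    in either direction favours the corresponding comparison state.\<close>
  have Q1: "Q \<ge> 1/3"
  proof -
    have "(x + y + z)\<^sup>2 \<le> 3 * Q"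
      using sum_squares_ge_zero[of "x - y" "y - z"] zero_le_power2[of "x - z"]
      by (simp add: Q_def power2_eq_square algebra_simps)
    then show ?thesis using yz by simp
  qed
  have Q2: "Q \<le> 1/2"
  proof -
    have "Q \<le> x * x + x * y + x * z" unfolding Q_def power2_eq_square
      using x yz by (intro add_mono mult_right_mono) auto
    also have "\<dots> = x * (x + y + z)" by (simp add: algebra_simps)
    finally show ?thesis using x yz by simp
  qed
  show ?thesis
  proof (cases "l \<le> ?c")
    case True
    then have "(l - ?c) / 2 * Q \<le> (l - ?c) / 2 * (1/3)" using Q1 by (intro mult_left_mono_neg) auto
    moreover have "sym_free l (1/3) = sym_free ?c (1/3) + (l - ?c) / 2 * (1/3)"
      by (subst sym_free_shift[of l _ ?c]) (simp add: power2_eq_square)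
    ultimately show ?thesis using c shift unfolding barrier_eq by linarith
  next
    case False
    then have "(l - ?c) / 2 * Q \<le> (l - ?c) / 2 * (1/2)" using Q2 by (intro mult_left_mono) auto
    moreover have "sym_free l (2/3) = sym_free ?c (2/3) + (l - ?c) / 2 * (1/2)"
      by (subst sym_free_shift[of l _ ?c]) (simp add: power2_eq_square)
    ultimately show ?thesis using c shift sym_free_values unfolding barrier_eq by linarith
  qed
qed

text \<open>The number of levels grows with n, so one threshold has to serve every l. The partition
  function is bounded below by a rounded version of the heavier comparison state.\<close>

lemma critical_slice:
  assumes \<eta>0: "\<eta>0 > 0" and \<mu>: "\<mu> \<ge> 4 * ln 2"
  shows "\<forall>\<^sub>F n in sequentially. \<forall>l k. 0 \<le> l \<and> l \<le> \<mu> \<and> k \<in> types n \<and> k 1 = n div 2 \<longrightarrow>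
    weight n (l / n) k \<le> exp (- (barrier - \<eta>0) * real n) * Z_RGB n (l / n)"
proof -
  \<comment> \<open>One part for n div 2 against n / 2, one for Stirling on the slice, two for the
    lower bound on the partition function.\<close>
  define \<eta> where "\<eta> = \<eta>0 / 4"
  have \<eta>: "\<eta> > 0" using \<eta>0 by (simp add: \<eta>_def)
  have ln2: "0 \<le> 4 * ln (2 :: real)" by simp
  then have \<mu>0: "\<mu> \<ge> 0" using \<mu> by linarith
  obtain d where d: "d > 0" "\<And>l x y. \<lbrakk>0 \<le> l; l \<le> \<mu>; x \<in> {0..1}; y \<in> {0..1}; \<bar>x - y\<bar> \<le> d\<rbrakk>
    \<Longrightarrow> \<bar>sym_free l x - sym_free l y\<bar> \<le> \<eta>"
    by (rule sym_free_uniformly_continuous[OF \<eta> \<mu>0]) (rule that)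
  have "(\<lambda>n. (6 * ln (real n + 1) + 3 + \<mu> / 2) / real n) \<longlonglongrightarrow> 0" by real_asymp
  from order_tendstoD(2)[OF this \<eta>] eventually_gt_at_top[of 0]
  have "\<forall>\<^sub>F n in sequentially. 6 * ln (real n + 1) + 3 + \<mu> / 2 \<le> real n * \<eta>"
    by eventually_elim (simp add: field_simps)
  then show ?thesis
    using order_tendstoD(2)[OF lim_1_over_n d(1)] sym_type_weight[OF \<eta> \<mu>0] eventually_ge_at_top[of 4]
  proof eventually_elim
    case (elim n)
    have n: "n \<ge> 4" "n \<ge> 1" "real n > 0" using elim by auto
    show ?case
    proof (intro allI impI)
      fix l k assume *: "0 \<le> l \<and> l \<le> \<mu> \<and> k \<in> types n \<and> k 1 = n div 2"
      let ?m = "max (sym_free l (1/3)) (sym_free l (2/3))"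
      obtain a b c where abc: "k = triple a b c" "b \<le> a" "c \<le> b" "a + b + c = n"
        using * by (auto elim: types_E)
      have a: "a = n div 2" using * abc by simp
      have xa: "real n / 2 - 1 / 2 \<le> real a" "real a \<le> real n / 2" unfolding a by linarith+
      have sum1: "real a / n + real b / n + real c / n = 1"
        using abc n by (simp add: add_divide_distrib[symmetric] flip: of_nat_add)
      have Z_ge: "exp (real n * (sym_free l x - 2 * \<eta>)) \<le> Z_RGB n (l / n)"
        if r: "r \<le> n" "(n - r + 1) div 2 \<le> r" "\<bar>real r - x * n\<bar> \<le> 1" and x: "x \<in> {0..1}" for r and x :: real
      proof -
        have "real r / n - x = (real r - x * n) / n" using n by (simp add: diff_divide_distrib)
        then have "\<bar>real r / n - x\<bar> = \<bar>real r - x * n\<bar> / n" by (simp only: abs_divide)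
        also have "\<dots> \<le> 1 / n" using r by (intro divide_right_mono) auto
        finally have "\<bar>sym_free l (real r / n) - sym_free l x\<bar> \<le> \<eta>"
          using elim(2) * x r(1) n by (intro d(2)) auto
        then have "real n * (sym_free l x - 2 * \<eta>) \<le> real n * (sym_free l (real r / n) - \<eta>)"
          by (intro mult_left_mono) auto
        then have "exp (real n * (sym_free l x - 2 * \<eta>)) \<le> exp (real n * (sym_free l (real r / n) - \<eta>))"
          by simp
        also have "\<dots> \<le> weight n (l / n) (sym_type n r)" using elim(3) * r by blast
        also have "\<dots> \<le> Z_RGB n (l / n)" using r by (intro weight_le_Z) (simp add: sym_type_in_types)
        finally show ?thesis .
      qed
      have "exp (real n * (sym_free l (1/3) - 2 * \<eta>)) \<le> Z_RGB n (l / n)"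
      \<comment> \<open>The ceiling of n / 3; rounding down could let the second colour overtake the
        first.\<close>
      proof (rule Z_ge[of "(n + 2) div 3" "1/3"])
        have "3 * ((n + 2) div 3) \<ge> n" "3 * ((n + 2) div 3) \<le> n + 2" by linarith+
        then show "\<bar>real ((n + 2) div 3) - 1/3 * n\<bar> \<le> 1" by linarith
      qed (use n in auto)
      moreover have "exp (real n * (sym_free l (2/3) - 2 * \<eta>)) \<le> Z_RGB n (l / n)"
      proof (rule Z_ge[of "2 * n div 3" "2/3"])
        have "3 * (2 * n div 3) \<le> 2 * n" "3 * (2 * n div 3) + 2 \<ge> 2 * n" by linarith+
        then show "\<bar>real (2 * n div 3) - 2/3 * n\<bar> \<le> 1" by linarith
        show "(n - 2 * n div 3 + 1) div 2 \<le> 2 * n div 3" using n by linarith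
      qed (use n in auto)
      ultimately have Z: "exp (real n * (?m - 2 * \<eta>)) \<le> Z_RGB n (l / n)"
        by (cases "sym_free l (1/3) \<le> sym_free l (2/3)") (auto simp: max_def)
      have F: "free l (real a / n) (real b / n) (real c / n)
          \<le> ?m - barrier + \<eta>"
      proof (rule free_slice_bound)
        show "real c / n \<le> real b / n" "real b / n \<le> real a / n"
          using abc by (auto intro: divide_right_mono)
        show "1/3 \<le> real a / n" "real a / n \<le> 1/2" using xa n by (auto simp: field_simps)
        have "\<bar>real a / n - 1/2\<bar> \<le> d"
        proof -
          have "\<bar>real a / n - 1/2\<bar> = 1/2 - real a / n" using xa n by (simp add: field_simps)
          also have "\<dots> = (real n / 2 - real a) / n" using n by (simp add: diff_divide_distrib)
          also have "\<dots> \<le> 1 / n" using xa by (intro divide_right_mono) auto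
          finally show ?thesis using elim(2) by simp
        qed
        then have "\<bar>sym_free (4 * ln 2) (real a / n) - sym_free (4 * ln 2) (1/2)\<bar> \<le> \<eta>"
          using \<mu> ln2 xa n by (intro d(2)) (auto simp: field_simps)
        then show "sym_free (4 * ln 2) (real a / n) \<le> sym_free (4 * ln 2) (1/2) + \<eta>" by linarith
      qed (use * sum1 in auto)
      have "weight n (l / n) k
          \<le> exp (real n * free l (real a / n) (real b / n) (real c / n) + (6 * ln (real n + 1) + 3 + l / 2))"
        using weight_bounds(1)[OF abc(4) n(2), of l] * by (simp add: abc(1))
      also have "\<dots> \<le> exp (real n * (?m - barrier + \<eta>) + real n * \<eta>)"
        using F elim(1) * by (auto intro!: add_mono mult_left_mono)
      also have "\<dots> = exp (- (barrier - \<eta>0) * real n) * exp (real n * (?m - 2 * \<eta>))"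
        unfolding exp_add[symmetric] by (simp add: \<eta>_def algebra_simps)
      also have "\<dots> \<le> exp (- (barrier - \<eta>0) * real n) * Z_RGB n (l / n)"
        using Z by (intro mult_left_mono) auto
      finally show "weight n (l / n) k \<le> exp (- (barrier - \<eta>0) * real n) * Z_RGB n (l / n)" .
    qed
  qed
qed

section \<open>The disordered mass at infinite temperature\<close>

lemma Z_zero_le: "Z_RGB n 0 \<le> exp (real n * ln 3)"
proof -
  have "card (\<Omega>_RGB n) \<le> card ({1..n} \<rightarrow>\<^sub>E spins)"
    by (rule card_mono) (auto simp: \<Omega>_RGB_def spins_def intro!: finite_PiE)
  also have "\<dots> = 3 ^ n" by (simp add: card_PiE)
  finally have "real (card (\<Omega>_RGB n)) \<le> real (3 ^ n)" by (rule of_nat_mono)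
  also have "\<dots> = exp (real n * ln 3)" by (simp add: exp_of_nat_mult)
  finally show ?thesis by (simp add: Z_RGB_def)
qed

text \<open>At l = 0 the partition function counts at most 3^n configurations, and the balanced
  macrostate alone has entropy ln 3 per vertex.\<close>

lemma disordered_at_zero:
  assumes \<eta>0: "\<eta>0 > 0"
  shows "\<forall>\<^sub>F n in sequentially. \<exists>k\<in>types n. k 1 \<le> n div 2 \<and> exp (- \<eta>0 * real n) * Z_RGB n 0 \<le> weight n 0 k"
proof -
  define \<eta> where "\<eta> = \<eta>0 / 2"
  have \<eta>: "\<eta> > 0" using \<eta>0 by (simp add: \<eta>_def)
  obtain d where d: "d > 0" "\<And>l x y. \<lbrakk>0 \<le> l; l \<le> 0; x \<in> {0..1}; y \<in> {0..1}; \<bar>x - y\<bar> \<le> d\<rbrakk>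
    \<Longrightarrow> \<bar>sym_free l x - sym_free l y\<bar> \<le> \<eta>"
    by (rule sym_free_uniformly_continuous[OF \<eta> order_refl]) (rule that)
  have third: "sym_free 0 (1/3) = ln 3"
    using sym_free_shift[of 0 "1/3" "4 * ln 2"] sym_free_values(1) by (simp add: power2_eq_square)
  show ?thesis
    using order_tendstoD(2)[OF lim_1_over_n d(1)] sym_type_weight[OF \<eta> order_refl] eventually_ge_at_top[of 6]
  proof eventually_elim
    case (elim n)
    define r where "r = (n + 2) div 3"
    have n: "real n > 0" using elim by simp
    have r: "r \<le> n" "(n - r + 1) div 2 \<le> r" "r \<le> n div 2" using elim(3) by (auto simp: r_def)
    have "3 * r \<ge> n" "3 * r \<le> n + 2" unfolding r_def by linarith+
    then have "\<bar>real r - 1/3 * n\<bar> \<le> 1" by linarith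
    moreover have "real r / n - 1/3 = (real r - 1/3 * n) / n" using n by (simp add: diff_divide_distrib)
    ultimately have "\<bar>real r / n - 1/3\<bar> \<le> 1 / n" using n by (simp only: abs_divide) (simp add: divide_right_mono)
    then have "\<bar>sym_free 0 (real r / n) - sym_free 0 (1/3)\<bar> \<le> \<eta>"
      using elim(1) r n by (intro d(2)) auto
    then have *: "ln 3 - \<eta> \<le> sym_free 0 (real r / n)" using third by linarith
    have "exp (- \<eta>0 * real n) * Z_RGB n 0 \<le> exp (- \<eta>0 * real n) * exp (real n * ln 3)"
      using Z_zero_le by (intro mult_left_mono) auto
    also have "\<dots> = exp (real n * (ln 3 - 2 * \<eta>))"
      by (simp add: exp_add[symmetric] \<eta>_def algebra_simps)
    also have "\<dots> \<le> exp (real n * (sym_free 0 (real r / n) - \<eta>))"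
      using * by (auto intro!: mult_left_mono)
    also have "\<dots> \<le> weight n 0 (sym_type n r)"
      using elim(2)[rule_format, of 0 r] r(1) by simp
    finally show ?case using r
      by (intro bexI[of _ "sym_type n r"]) (auto simp: sym_type_in_types, simp add: sym_type_def)
  qed
qed

section \<open>Mixing times\<close>

lemma energy_bounds: "0 \<le> energy n x" "energy n x \<le> (real n)\<^sup>2"
proof -
  show "0 \<le> energy n x" unfolding energy_def by (intro sum_nonneg) auto
  have "energy n x \<le> (\<Sum>i\<in>{1..n}. \<Sum>j\<in>{i<..n}. 1)" unfolding energy_def by (intro sum_mono) auto
  also have "\<dots> \<le> (\<Sum>i\<in>{1..n}. real n)" by (intro sum_mono) auto
  finally show "energy n x \<le> (real n)\<^sup>2" by (simp add: power2_eq_square)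
qed

text \<open>Makes ln (1 / \<pi>) linear in n, so the starting state costs the mixing time only one
  polynomial factor.\<close>

lemma gibbs_lower:
  assumes "\<mu> \<ge> 0" "n \<ge> 1"
  shows "exp (- (ln 3 + \<mu>) * real n) \<le> gibbs n (\<mu> / n) x"
proof -
  have "Z_RGB n (\<mu> / n) \<le> (\<Sum>x\<in>\<Omega>_RGB n. exp (\<mu> * n))"
    unfolding Z_RGB_def
  proof (rule sum_mono)
    fix x
    have "\<mu> / n * energy n x \<le> \<mu> / n * (real n)\<^sup>2" using assms energy_bounds by (intro mult_left_mono) auto
    then show "exp (\<mu> / n * energy n x) \<le> exp (\<mu> * n)" using assms by (simp add: power2_eq_square)
  qed
  also have "\<dots> = Z_RGB n 0 * exp (\<mu> * n)" by (simp add: Z_RGB_def)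
  also have "\<dots> \<le> exp (real n * ln 3) * exp (\<mu> * n)" using Z_zero_le by (intro mult_right_mono) auto
  also have "\<dots> = exp ((ln 3 + \<mu>) * real n)" by (simp add: exp_add[symmetric] algebra_simps)
  finally have Z: "Z_RGB n (\<mu> / n) \<le> exp ((ln 3 + \<mu>) * real n)" .
  have "exp (- (ln 3 + \<mu>) * real n) = 1 / exp ((ln 3 + \<mu>) * real n)"
    unfolding mult_minus_left exp_minus inverse_eq_divide ..
  also have "\<dots> \<le> exp (\<mu> / n * energy n x) / Z_RGB n (\<mu> / n)"
    using Z Z_pos energy_bounds(1)[of n x] assms by (intro frac_le) auto
  finally show ?thesis by (simp add: gibbs_def)
qed

text \<open>The power 8 is 2 from the number of macrostates, 5 from hub and routes, and 1 from ln (1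
  / \<pi>). The condition \<open>\<eta> \<le> D\<close> lets one loss \<open>q\<close> serve for the
  hub weight and for the routes.\<close>

lemma metropolis_mixing_upper:
  assumes n: "n \<ge> 1" and \<mu>: "\<mu> \<ge> 0" and \<epsilon>: "\<epsilon> > 0" "\<epsilon> < 1" and D: "D \<ge> 0" "\<eta> \<le> D"
    and hub: "triple a b c \<in> types n" "b + 2 \<le> a"
    and W: "\<And>k. k \<in> types n \<Longrightarrow> exp (- \<eta> * real n) * weight n (\<mu> / n) k \<le> weight n (\<mu> / n) (triple a b c)"
    and routes: "\<And>k. k \<in> types n \<Longrightarrow> \<exists>l\<le>(n + 2) * (n + 2).
      route n (\<mu> / n) (exp (- D * real n) * weight n (\<mu> / n) k) l k (triple a b c)"
  shows "real (metropolis_mixing_time n (\<mu> / n) \<epsilon>)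
    \<le> (3 * (24 * exp \<mu> + 96) * (ln 3 + \<mu> + 2 * ln (1 / \<epsilon>)) + 1) * ((real n + 1) ^ 8 * exp (D * real n))"
proof -
  interpret reversible_chain "\<Omega>_RGB n" "metropolis n (gibbs n (\<mu> / n))" "gibbs n (\<mu> / n)"
    by (rule metropolis_chain[OF n])
  let ?K = "metropolis n (gibbs n (\<mu> / n))"
  define q where "q = exp (- D * real n)"
  define L where "L = (n + 2) * (n + 2)"
  define C where "C = (real n + 1)\<^sup>2 / q * (24 * real n ^ 3 * exp (\<mu> / n * real n) + 6 * real n * (real L)\<^sup>2)"
  have q: "q > 0" by (simp add: q_def)
  have q\<eta>: "q \<le> exp (- \<eta> * real n)" using D by (simp add: q_def mult_right_mono)
  have poincare: "\<exists>e. (\<Sum>x\<in>\<Omega>_RGB n. gibbs n (\<mu> / n) x * (f x - e)\<^sup>2) \<le> C * dirichlet f" for f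
    unfolding C_def
  proof (rule metropolis_poincare[OF n _ refl hub q])
    show "0 \<le> \<mu> / n" using \<mu> by simp
    show "q * weight n (\<mu> / n) k \<le> weight n (\<mu> / n) (triple a b c)" if "k \<in> types n" for k
      using W[OF that] mult_right_mono[OF q\<eta>, of "weight n (\<mu> / n) k"] by simp
    show "\<exists>l\<le>L. route n (\<mu> / n) (q * weight n (\<mu> / n) k) l k (triple a b c)" if "k \<in> types n" for k
      using routes[OF that] by (simp add: q_def L_def)
  qed
  define N where "N = real n + 1"
  have N: "N \<ge> 1" "real n \<le> N" by (simp_all add: N_def)
  have "24 * real n ^ 3 * exp (\<mu> / n * real n) + 6 * real n * (real L)\<^sup>2 \<le> (24 * exp \<mu> + 96) * N ^ 5"
  proof -
    have "real n ^ 3 \<le> N ^ 3" using N by (intro power_mono) auto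
    also have "\<dots> \<le> N ^ 5" using N by (intro power_increasing) auto
    finally have 1: "24 * exp \<mu> * real n ^ 3 \<le> 24 * exp \<mu> * N ^ 5" by (intro mult_left_mono) auto
    \<comment> \<open>The bound L \<le> (2 N)^2 turns 6 n L^2 into 96 N^5.\<close>
    have "real L = (real n + 2) * (real n + 2)"
      unfolding L_def of_nat_mult of_nat_add of_nat_numeral ..
    also have "\<dots> \<le> (2 * N) * (2 * N)" by (intro mult_mono) (auto simp: N_def)
    finally have "(real L)\<^sup>2 \<le> (4 * N\<^sup>2)\<^sup>2" by (intro power_mono) (auto simp: power2_eq_square)
    then have "real n * (real L)\<^sup>2 \<le> N * (4 * N\<^sup>2)\<^sup>2" using N by (intro mult_mono) auto
    also have "\<dots> = 16 * N ^ 5" by (simp add: power_mult_distrib eval_nat_numeral)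
    finally have 2: "6 * real n * (real L)\<^sup>2 \<le> 96 * N ^ 5" by simp
    have "\<mu> / n * real n = \<mu>" using n by simp
    moreover have "24 * real n ^ 3 * exp \<mu> \<le> 24 * exp \<mu> * N ^ 5" using 1 by (simp only: mult_ac)
    ultimately show ?thesis using add_mono[OF _ 2] unfolding distrib_right by metis
  qed
  then have "C \<le> N\<^sup>2 / q * ((24 * exp \<mu> + 96) * N ^ 5)"
    unfolding C_def N_def using q by (intro mult_left_mono) auto
  also have "\<dots> = (24 * exp \<mu> + 96) * (N\<^sup>2 * N ^ 5) * (1 / q)" by simp
  also have "N\<^sup>2 * N ^ 5 = N ^ 7" by (simp flip: power_add)
  also have "1 / q = exp (D * real n)" by (simp add: q_def exp_minus inverse_eq_divide)
  finally have C_le: "C \<le> (24 * exp \<mu> + 96) * N ^ 7 * exp (D * real n)" .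
  have C_ge: "C \<ge> 1/3"
  proof -
    have "q \<le> 1" using D by (simp add: q_def)
    also have "1 \<le> (real n + 1)\<^sup>2" by simp
    finally have "1 \<le> (real n + 1)\<^sup>2 / q" using q by (simp add: le_divide_eq)
    moreover have "1/3 \<le> 24 * real n ^ 3 * exp (\<mu> / n * real n) + 6 * real n * (real L)\<^sup>2"
    proof -
      have "1 * 1 \<le> real n ^ 3 * exp (\<mu> / n * real n)" using n \<mu> by (intro mult_mono) auto
      moreover have "0 \<le> 6 * real n * (real L)\<^sup>2" by simp
      ultimately show ?thesis by linarith
    qed
    ultimately show ?thesis unfolding C_def using mult_mono[of 1 "(real n + 1)\<^sup>2 / q" "1/3"] by simp
  qed
  define R where "R = (ln 3 + \<mu>) * real n"
  define T where "T = nat \<lceil>C / (1/3) * (R + 2 * ln (1 / \<epsilon>))\<rceil>"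
  have "mixing_time (\<Omega>_RGB n) (?K) (gibbs n (\<mu> / n)) \<epsilon> \<le> T"
  proof (rule mixing_time_bound[OF _ _ C_ge poincare _ \<epsilon>(1)])
    show "1/3 \<le> pmf (?K x) x" if "x \<in> \<Omega>_RGB n" for x
      by (rule pmf_metropolis_self[OF n that])
    show "exp (- R) \<le> gibbs n (\<mu> / n) x" for x using gibbs_lower[OF \<mu> n, of x] by (simp add: R_def algebra_simps)
  qed (auto simp: T_def, linarith)
  then have "real (metropolis_mixing_time n (\<mu> / n) \<epsilon>) \<le> real T"
    by (simp add: metropolis_mixing_time_def)
  also have "real T \<le> 3 * C * (R + 2 * ln (1 / \<epsilon>)) + 1"
  proof -
    have "0 \<le> C / (1/3) * (R + 2 * ln (1 / \<epsilon>))"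
      using C_ge \<mu> \<epsilon> by (intro mult_nonneg_nonneg add_nonneg_nonneg) (auto simp: R_def)
    moreover have "real (nat \<lceil>y\<rceil>) \<le> y + 1" if "0 \<le> y" for y :: real using that by linarith
    ultimately have "real T \<le> C / (1/3) * (R + 2 * ln (1 / \<epsilon>)) + 1" unfolding T_def by blast
    then show ?thesis by simp
  qed
  finally have upper: "real (metropolis_mixing_time n (\<mu> / n) \<epsilon>) \<le> 3 * C * (R + 2 * ln (1 / \<epsilon>)) + 1" .
  have main: "3 * C * (R + 2 * ln (1 / \<epsilon>))
      \<le> 3 * ((24 * exp \<mu> + 96) * N ^ 7 * exp (D * real n)) * ((ln 3 + \<mu> + 2 * ln (1 / \<epsilon>)) * N)"
  proof (intro mult_mono mult_left_mono C_le)
    have "2 * ln (1 / \<epsilon>) * 1 \<le> 2 * ln (1 / \<epsilon>) * N" using \<epsilon> N by (intro mult_left_mono) auto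
    moreover have "(ln 3 + \<mu>) * real n \<le> (ln 3 + \<mu>) * N" using \<mu> N by (intro mult_left_mono) auto
    ultimately show "R + 2 * ln (1 / \<epsilon>) \<le> (ln 3 + \<mu> + 2 * ln (1 / \<epsilon>)) * N"
      by (simp add: R_def algebra_simps)
    show "0 \<le> R + 2 * ln (1 / \<epsilon>)" using \<mu> \<epsilon> by (auto simp: R_def intro!: add_nonneg_nonneg)
  qed (use N C_ge in auto)
  have one: "1 * 1 \<le> N ^ 8 * exp (D * real n)" using N D by (intro mult_mono one_le_power) auto
  have "real (metropolis_mixing_time n (\<mu> / n) \<epsilon>)
      \<le> 3 * ((24 * exp \<mu> + 96) * N ^ 7 * exp (D * real n)) * ((ln 3 + \<mu> + 2 * ln (1 / \<epsilon>)) * N)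
        + N ^ 8 * exp (D * real n)"
    using upper main one by (simp only: mult_1_left)
  also have "3 * ((24 * exp \<mu> + 96) * N ^ 7 * exp (D * real n)) * ((ln 3 + \<mu> + 2 * ln (1 / \<epsilon>)) * N)
        + N ^ 8 * exp (D * real n)
      = (3 * (24 * exp \<mu> + 96) * (ln 3 + \<mu> + 2 * ln (1 / \<epsilon>)) + 1) * (N ^ 8 * exp (D * real n))"
  proof -
    have "3 * (u * N ^ 7 * e) * (v * N) + N ^ 8 * e = (3 * u * v + 1) * (N ^ 8 * e)" for u v e :: real
      by (simp add: algebra_simps eval_nat_numeral)
    then show ?thesis .
  qed
  finally show ?thesis unfolding N_def .
qed

section \<open>Irreducibility of the tempering chain\<close>

lemma metropolis_reach_ones:
  assumes n: "n \<ge> 1"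
  shows "x \<in> \<Omega>_RGB n \<Longrightarrow> (\<lambda>x y. x \<in> \<Omega>_RGB n \<and> y \<in> \<Omega>_RGB n \<and> x \<noteq> y \<and> pmf (metropolis n (gibbs n \<beta>) x) y > 0)\<^sup>*\<^sup>*
    x (\<lambda>v\<in>{1..n}. 1)"
proof (induction "n - num_spins n x 1" arbitrary: x rule: less_induct)
  case less
  obtain k where k: "k \<in> types n" "x \<in> macrostate n k" using less.prems by (auto simp: Omega_eq)
  obtain a b c where abc: "k = triple a b c" "b \<le> a" "c \<le> b" "a + b + c = n" using k(1) by (rule types_E)
  have num: "num_spins n x 1 = a" "num_spins n x 2 = b" "num_spins n x 3 = c"
    using k(2) by (auto simp: abc(1) macrostate_def)
  have move: ?case
    if v: "v \<in> {1..n}" "x v = i" "i \<noteq> 1" and t: "respin i 1 k \<in> types n" and a: "a < n" for v i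
  proof -
    have y: "x(v := 1) \<in> macrostate n (respin i 1 k)" using k v by (intro macrostate_upd) auto
    then have y\<Omega>: "x(v := 1) \<in> \<Omega>_RGB n" using t by (auto simp: Omega_eq)
    have "num_spins n (x(v := 1)) 1 = Suc a" using num_spins_upd[of v n x i 1 1] v num by (simp add: respin_def)
    then have "(\<lambda>x y. x \<in> \<Omega>_RGB n \<and> y \<in> \<Omega>_RGB n \<and> x \<noteq> y \<and> pmf (metropolis n (gibbs n \<beta>) x) y > 0)\<^sup>*\<^sup>*
        (x(v := 1)) (\<lambda>v\<in>{1..n}. 1)"
      using a num y\<Omega> by (intro less.hyps) auto
    moreover have "pmf (metropolis n (gibbs n \<beta>) x) (x(v := 1)) > 0"
    proof -
      have "0 < min (gibbs n \<beta> x) (gibbs n \<beta> (x(v := 1))) / (3 * real n)" using n by (simp add: gibbs_pos)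
      also have "\<dots> \<le> gibbs n \<beta> x * pmf (metropolis n (gibbs n \<beta>) x) (x(v := 1))"
        using gibbs_metropolis_ge[OF n less.prems y\<Omega>] v by simp
      finally show ?thesis using gibbs_pos[of n \<beta> x] by (simp add: zero_less_mult_iff)
    qed
    moreover have "x \<noteq> x(v := 1)" using v by (metis fun_upd_same)
    ultimately show ?thesis using less.prems y\<Omega> by (intro converse_rtranclp_into_rtranclp[of _ x]) auto
  qed
  \<comment> \<open>Colour 3 is emptied before colour 2, which keeps the counts ordered all the
    way.\<close>
  consider "c > 0" | "c = 0" "b > 0" | "b = 0" "c = 0" by auto
  then show ?case
  proof cases
    case 1
    then obtain v where "v \<in> {1..n}" "x v = 3" using num(3) by (fastforce simp: num_spins_def card_gt_0_iff)
    then show ?thesis using 1 abc by (intro move) (auto simp: triple_in_types)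
  next
    case 2
    then obtain v where "v \<in> {1..n}" "x v = 2" using num(2) by (fastforce simp: num_spins_def card_gt_0_iff)
    then show ?thesis using 2 abc by (intro move) (auto simp: triple_in_types)
  next
    case 3
    then show ?thesis using k macrostate_ones[of n] abc by auto
  qed
qed

lemma tempering_connected:
  assumes n: "n \<ge> 1" and z: "z \<in> tempering_states n M"
  shows "(\<lambda>z z'. z \<in> tempering_states n M \<and> z' \<in> tempering_states n M \<and> pmf (tempering n \<beta> M z) z' > 0)\<^sup>*\<^sup>*
    z ((\<lambda>v\<in>{1..n}. 1), 0)"
proof -
  let ?R = "\<lambda>z z'. z \<in> tempering_states n M \<and> z' \<in> tempering_states n M \<and> pmf (tempering n \<beta> M z) z' > 0"
  obtain x i where [simp]: "z = (x, i)" and x: "x \<in> \<Omega>_RGB n" and i: "i \<le> M"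
    using z by (auto simp: tempering_states_def)
  have "?R\<^sup>*\<^sup>* (x, i) (x, 0)"
    using i
  proof (induction i)
    case (Suc i)
    have "?R (x, Suc i) (x, i)"
      using Suc x gibbs_pos[of n] by (auto simp: tempering_states_def pmf_tempering)
    then show ?case using Suc by (intro converse_rtranclp_into_rtranclp[of _ "(x, Suc i)"]) auto
  qed simp
  moreover have "?R\<^sup>*\<^sup>* (x, 0) ((\<lambda>v\<in>{1..n}. 1), 0)"
    using metropolis_reach_ones[OF n x, of "inv_temp \<beta> M 0"]
  proof (induction rule: converse_rtranclp_induct)
    case (step y z)
    \<comment> \<open>\<open>pmf_tempering\<close> is an off-diagonal formula; the clause
      \<open>x \<noteq> y\<close> in the Metropolis relation makes it applicable.\<close>
    then have "?R (y, 0) (z, 0)" by (auto simp: tempering_states_def pmf_tempering)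
    then show ?case using step by (intro converse_rtranclp_into_rtranclp[of _ "(y, 0)"]) auto
  qed simp
  ultimately show ?thesis by (auto intro: rtranclp_trans)
qed

text \<open>One step raises a count by at most one, so the cut can be crossed only from its boundary
  slice.\<close>

lemma num_spins_sites:
  assumes "sites n x y \<noteq> {}"
  shows "num_spins n y m \<le> num_spins n x m + 1"
proof -
  obtain v where v: "\<And>u. u \<noteq> v \<Longrightarrow> x u = y u" using assms by (auto simp: sites_def)
  have "{u \<in> {1..n}. y u = m} \<subseteq> insert v {u \<in> {1..n}. x u = m}" using v by auto
  then have "num_spins n y m \<le> card (insert v {u \<in> {1..n}. x u = m})"
    unfolding num_spins_def by (intro card_mono) auto
  also have "\<dots> \<le> num_spins n x m + 1" unfolding num_spins_def by (simp add: card_insert_if)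
  finally show ?thesis .
qed

lemma sum_gibbs_types:
  "(\<Sum>x\<in>{x \<in> \<Omega>_RGB n. P (num_spins n x 1)}. gibbs n \<beta> x)
    = (\<Sum>k\<in>{k \<in> types n. P (k 1)}. weight n \<beta> k / Z_RGB n \<beta>)"
proof -
  have "(\<Sum>x\<in>{x \<in> \<Omega>_RGB n. P (num_spins n x 1)}. gibbs n \<beta> x)
      = (\<Sum>x\<in>\<Omega>_RGB n. if P (num_spins n x 1) then gibbs n \<beta> x else 0)"
    by (simp add: sum.inter_filter)
  also have "\<dots> = (\<Sum>k\<in>types n. if P (k 1) then weight n \<beta> k / Z_RGB n \<beta> else 0)"
    unfolding sum_Omega sum_gibbs_macrostate[symmetric]
    by (intro sum.cong refl) (auto simp: macrostate_def intro!: sum.neutral)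
  finally show ?thesis by (simp add: sum.inter_filter)
qed

text \<open>The cut separates configurations with at most half of the vertices in the dominant colour.
  At every temperature its boundary lies on the critical slice.\<close>

lemma tempering_mixing_lower:
  assumes n: "n \<ge> 1" and M: "M \<ge> 1" and \<mu>: "\<mu> \<ge> 0" and \<epsilon>: "0 < \<epsilon>" "\<epsilon> < 1/2"
    and slice: "\<And>l k. 0 \<le> l \<Longrightarrow> l \<le> \<mu> \<Longrightarrow> k \<in> types n \<Longrightarrow> k 1 = n div 2 \<Longrightarrow>
      weight n (l / n) k \<le> s * Z_RGB n (l / n)"
    and dis: "k0 \<in> types n" "k0 1 \<le> n div 2" "p * Z_RGB n 0 \<le> weight n 0 k0"
    and ord: "k1 \<in> types n" "n div 2 < k1 1" "\<And>k. k \<in> types n \<Longrightarrow> p * weight n (\<mu> / n) k \<le> weight n (\<mu> / n) k1"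
    and p: "p > 0" and s: "s \<ge> 0"
  shows "(1/2 - \<epsilon>) * p \<le> real (tempering_mixing_time n (\<mu> / n) M \<epsilon>) * ((real M + 1) * (real n + 1) ^ 4 * s)"
proof -
  let ?S = "tempering_states n M" and ?\<beta> = "inv_temp (\<mu> / n) M" and ?K = "tempering n (\<mu> / n) M" and ?\<pi> = "tempering_stationary n (\<mu> / n) M"
  interpret reversible_chain ?S ?K ?\<pi> by (rule tempering_chain[OF n])
  define \<tau> where "\<tau> = tempering_mixing_time n (\<mu> / n) M \<epsilon>"
  have tv: "tv_dist ?S (?K) ?\<pi> \<tau> x \<le> \<epsilon>" if "x \<in> ?S" for x
    unfolding \<tau>_def tempering_mixing_time_def
    by (rule mixing_time_attained[OF pmf_tempering_self _ tempering_connected[OF n] \<epsilon>(1) that]) auto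
  have T: "real (card (types n)) \<le> (real n + 1)\<^sup>2"
    using of_nat_mono[OF card_types[of n], where 'a = real] by (simp add: add.commute)
  define U where "U = (\<lambda>P. {x \<in> \<Omega>_RGB n. P (num_spins n x 1)})"
  have mass: "(\<Sum>z\<in>U P \<times> {0..M}. ?\<pi> z)
      = (\<Sum>i\<in>{0..M}. \<Sum>k\<in>{k \<in> types n. P (k 1)}. weight n (?\<beta> i) k / Z_RGB n (?\<beta> i)) / real (M + 1)"
    for P
  proof -
    have "(\<Sum>z\<in>U P \<times> {0..M}. ?\<pi> z) = (\<Sum>i\<in>{0..M}. \<Sum>x\<in>U P. gibbs n (?\<beta> i) x / real (M + 1))"
      unfolding tempering_stationary_def by (subst sum.swap) (simp add: sum.cartesian_product case_prod_beta)
    then show ?thesis unfolding U_def sum_divide_distrib[symmetric] sum_gibbs_types .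
  qed
  have mass_ge: "weight n (?\<beta> i) k / Z_RGB n (?\<beta> i) / real (M + 1)
      \<le> (\<Sum>z\<in>U P \<times> {0..M}. ?\<pi> z)" if "i \<le> M" "k \<in> types n" "P (k 1)" for P i k
  proof -
    let ?w = "\<lambda>i k. weight n (?\<beta> i) k / Z_RGB n (?\<beta> i)"
    have nn: "?w i k \<ge> 0" for i k using Z_pos by (simp add: less_imp_le)
    have "?w i k \<le> (\<Sum>k\<in>{k \<in> types n. P (k 1)}. ?w i k)"
      using that nn by (intro member_le_sum[of k _ "?w i"]) auto
    also have "\<dots> \<le> (\<Sum>i\<in>{0..M}. \<Sum>k\<in>{k \<in> types n. P (k 1)}. ?w i k)"
      using that nn by (intro member_le_sum[of i _ "\<lambda>i. \<Sum>k\<in>{k \<in> types n. P (k 1)}. ?w i k"]) (auto intro: sum_nonneg)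
    finally show ?thesis unfolding mass by (intro divide_right_mono) auto
  qed
  define A where "A = U (\<lambda>m. m \<le> n div 2) \<times> {0..M}"
  have A: "A \<subseteq> ?S" by (auto simp: A_def U_def tempering_states_def)
  have A': "?S - A = U (\<lambda>m. n div 2 < m) \<times> {0..M}" by (auto simp: A_def U_def tempering_states_def)
  define B where "B = U (\<lambda>m. m = n div 2) \<times> {0..M}"
  have flow: "flow A (?S - A) \<le> (real n + 1)\<^sup>2 * s"
  proof -
    \<comment> \<open>Below the slice a level move cannot reach the other side, and a temperature
      move does not change the configuration.\<close>
    have zero: "pmf (?K z) z' = 0" if "z \<in> A - B" "z' \<in> ?S - A" for z z'
    proof -
      obtain x i y j where z: "z = (x, i)" "z' = (y, j)" by fastforce
      have x: "num_spins n x 1 < n div 2" "x \<in> \<Omega>_RGB n" using that z by (auto simp: A_def B_def U_def)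
      have y: "num_spins n y 1 > n div 2" "y \<in> \<Omega>_RGB n" using that(2) z unfolding A' by (auto simp: U_def)
      have xy: "x \<noteq> y" using x y by auto
      have "sites n x y = {}" using num_spins_sites[of n x y 1] x y by force
      then have "pmf (metropolis n (gibbs n (?\<beta> i)) x) y = 0"
        using pmf_metropolis[OF n x(2) y(2) xy, of "gibbs n (?\<beta> i)"] gibbs_pos by simp
      then show ?thesis using xy by (auto simp: z pmf_tempering)
    qed
    have BA: "B \<subseteq> A" by (auto simp: A_def B_def U_def)
    have finA: "finite A" using A fin finite_subset by blast
    have "flow A (?S - A) = (\<Sum>z\<in>B. \<Sum>z'\<in>?S - A. ?\<pi> z * pmf (?K z) z')"
      unfolding flow_def using zero finA BA
      by (intro sum.mono_neutral_right) (auto intro!: sum.neutral)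
    also have "\<dots> \<le> (\<Sum>z\<in>B. ?\<pi> z * 1)"
    proof (rule sum_mono)
      fix z assume "z \<in> B"
      then have z: "z \<in> ?S" using BA A by auto
      have "(\<Sum>z'\<in>?S - A. pmf (?K z) z') \<le> (\<Sum>z'\<in>?S. pmf (?K z) z')"
        using fin by (intro sum_mono2) auto
      also have "\<dots> = 1" by (rule row_sum[OF z])
      finally show "(\<Sum>z'\<in>?S - A. ?\<pi> z * pmf (?K z) z') \<le> ?\<pi> z * 1"
        unfolding sum_distrib_left[symmetric] using pos[OF z] by (intro mult_left_mono) auto
    qed
    also have "(\<Sum>z\<in>B. ?\<pi> z * 1) \<le> (\<Sum>i\<in>{0..M}. (real n + 1)\<^sup>2 * s) / real (M + 1)"
      unfolding B_def mult_1_right mass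
    proof (intro divide_right_mono sum_mono)
      fix i assume i: "i \<in> {0..M}"
      define l where "l = real i * \<mu> / real M"
      have li: "?\<beta> i = l / n" by (simp add: inv_temp_def l_def)
      have l: "0 \<le> l" "l \<le> \<mu>"
        using i \<mu> M mult_right_mono[of "real i" "real M" \<mu>] by (auto simp: l_def field_simps)
      have each: "weight n (l / n) k / Z_RGB n (l / n) \<le> s" if "k \<in> types n" "k 1 = n div 2" for k
        using slice[OF l that] Z_pos[of n "l / n"] by (simp add: field_simps)
      let ?T = "{k \<in> types n. k 1 = n div 2}"
      show "(\<Sum>k\<in>?T. weight n (?\<beta> i) k / Z_RGB n (?\<beta> i)) \<le> (real n + 1)\<^sup>2 * s"
      proof -
        have "(\<Sum>k\<in>?T. weight n (?\<beta> i) k / Z_RGB n (?\<beta> i)) \<le> real (card ?T) * s"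
          unfolding li using each by (intro sum_bounded_above) auto
        also have "\<dots> \<le> real (card (types n)) * s"
          using s by (intro mult_right_mono of_nat_mono card_mono) auto
        also have "\<dots> \<le> (real n + 1)\<^sup>2 * s" using T s by (intro mult_right_mono)
        finally show ?thesis .
      qed
    qed auto
    finally show ?thesis by simp
  qed
  \<comment> \<open>Stated for either side, since it is unknown which one has mass at most 1/2. The
    flow and the lower bound on the mass contribute (n + 1)^2 each, the weight of a level M +
    1.\<close>
  have final: "(1/2 - \<epsilon>) * p \<le> real \<tau> * ((real M + 1) * (real n + 1) ^ 4 * s)"
    if X: "X \<subseteq> ?S" "(\<Sum>z\<in>X. ?\<pi> z) \<le> 1/2" "flow X (?S - X) \<le> (real n + 1)\<^sup>2 * s"
      "p / (real n + 1)\<^sup>2 / real (M + 1) \<le> (\<Sum>z\<in>X. ?\<pi> z)" for X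
  proof -
    have "(1/2 - \<epsilon>) * (p / (real n + 1)\<^sup>2 / real (M + 1)) \<le> (1/2 - \<epsilon>) * (\<Sum>z\<in>X. ?\<pi> z)"
      using X(4) \<epsilon> by (intro mult_left_mono) auto
    also have "\<dots> \<le> real \<tau> * flow X (?S - X)" by (rule bottleneck[OF X(1,2) tv])
    also have "\<dots> \<le> real \<tau> * ((real n + 1)\<^sup>2 * s)" using X(3) by (intro mult_left_mono) auto
    finally have "(1/2 - \<epsilon>) * p / ((real n + 1)\<^sup>2 * (real M + 1)) \<le> real \<tau> * ((real n + 1)\<^sup>2 * s)"
      by (simp add: add.commute)
    moreover have "(real n + 1)\<^sup>2 * (real M + 1) > 0" by simp
    ultimately have "(1/2 - \<epsilon>) * p \<le> real \<tau> * ((real n + 1)\<^sup>2 * s) * ((real n + 1)\<^sup>2 * (real M + 1))"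
      by (simp only: pos_divide_le_eq)
    also have "\<dots> = real \<tau> * ((real M + 1) * (real n + 1) ^ 4 * s)"
      by (simp add: power2_eq_square eval_nat_numeral)
    finally show ?thesis .
  qed
  have n2: "1 \<le> (real n + 1)\<^sup>2" by simp
  have massA: "p / (real n + 1)\<^sup>2 / real (M + 1) \<le> (\<Sum>z\<in>A. ?\<pi> z)"
  proof -
    have i0: "?\<beta> 0 = 0" by (simp add: inv_temp_def)
    have "p / (real n + 1)\<^sup>2 \<le> p / 1" using p n2 by (intro divide_left_mono) auto
    also have "\<dots> \<le> weight n 0 k0 / Z_RGB n 0" using dis(3) Z_pos[of n 0] by (simp add: field_simps)
    finally have "p / (real n + 1)\<^sup>2 / real (M + 1) \<le> weight n 0 k0 / Z_RGB n 0 / real (M + 1)"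
      by (intro divide_right_mono) auto
    also have "\<dots> \<le> (\<Sum>z\<in>A. ?\<pi> z)"
      using mass_ge[of 0 k0 "\<lambda>m. m \<le> n div 2"] dis unfolding A_def i0 by simp
    finally show ?thesis .
  qed
  have massA': "p / (real n + 1)\<^sup>2 / real (M + 1) \<le> (\<Sum>z\<in>?S - A. ?\<pi> z)"
  proof -
    have iM: "?\<beta> M = \<mu> / n" using M by (simp add: inv_temp_def)
    \<comment> \<open>Unlike \<open>k0\<close>, the macrostate \<open>k1\<close> is compared with
      single macrostates; summing over all types costs (n + 1)^2.\<close>
    have "p * Z_RGB n (\<mu> / n) \<le> real (card (types n)) * weight n (\<mu> / n) k1"
      unfolding Z_eq sum_distrib_left using ord(3) by (rule sum_bounded_above)
    also have "\<dots> \<le> (real n + 1)\<^sup>2 * weight n (\<mu> / n) k1" using T by (intro mult_right_mono) auto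
    finally have "p / (real n + 1)\<^sup>2 \<le> weight n (\<mu> / n) k1 / Z_RGB n (\<mu> / n)"
      using Z_pos[of n "\<mu> / n"] by (simp add: divide_le_eq le_divide_eq mult_ac)
    then have "p / (real n + 1)\<^sup>2 / real (M + 1) \<le> weight n (\<mu> / n) k1 / Z_RGB n (\<mu> / n) / real (M + 1)"
      by (intro divide_right_mono) auto
    also have "\<dots> \<le> (\<Sum>z\<in>?S - A. ?\<pi> z)"
      using mass_ge[of M k1 "\<lambda>m. n div 2 < m"] ord unfolding A' iM by simp
    finally show ?thesis .
  qed
  have "(\<Sum>z\<in>A. ?\<pi> z) + (\<Sum>z\<in>?S - A. ?\<pi> z) = 1" using sum.subset_diff[OF A fin, of ?\<pi>] total by simp
  then consider "(\<Sum>z\<in>A. ?\<pi> z) \<le> 1/2" | "(\<Sum>z\<in>?S - A. ?\<pi> z) \<le> 1/2" by linarith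
  then show ?thesis
  proof cases
    case 1
    show ?thesis by (rule final[OF A 1 flow massA, unfolded \<tau>_def])
  next
    case 2
    have "?S - (?S - A) = A" using A by auto
    then have "flow (?S - A) (?S - (?S - A)) = flow A (?S - A)" using flow_sym[of A "?S - A"] A by simp
    then show ?thesis using final[OF _ 2 _ massA', unfolded \<tau>_def] flow by simp
  qed
qed

theorem theorem8p1:
  fixes \<mu> :: real
  assumes "\<mu> > 4 * ln 2"
  shows "\<exists>\<delta>>0. \<exists>\<alpha><0. \<forall>(M :: nat \<Rightarrow> nat) (\<epsilon> :: real).
    (\<lambda>n. real (M n)) \<in> \<Theta>(\<lambda>n. real n) \<and> 0 < \<epsilon> \<and> \<epsilon> < 1/2 \<longrightarrow>
      (\<lambda>n. real (tempering_mixing_time n (\<mu> / real n) (M n) \<epsilon>))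
        \<in> \<Omega>(\<lambda>n. exp ((- \<alpha> + \<delta>) * real n)) \<and>
      (\<exists>r :: nat \<Rightarrow> real. r \<in> o(\<lambda>_. 1) \<and>
        (\<lambda>n. real (metropolis_mixing_time n (\<mu> / real n) \<epsilon>))
          \<in> O(\<lambda>n. exp (- \<alpha> * real n + r n)))"
proof -
  have "0 < 4 * ln (2 :: real)" by simp
  then have \<mu>0: "\<mu> > 0" using assms by linarith
  obtain B where B: "0 \<le> B" "B < barrier" and hub: "\<And>\<eta>. \<eta> > 0 \<Longrightarrow> \<forall>\<^sub>F n in sequentially. \<exists>a b c. accessible_hub \<mu> B \<eta> n a b c"
    by (rule hub_routes[OF assms]) (rule that)
  \<comment> \<open>With barrier = B + 6 \<eta>, tempering loses 3 \<eta> (slice, mass, polynomial)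
    and Metropolis 2 \<eta> (route, polynomial). The exponents B + 3 \<eta> and B + 2 \<eta> leave
    \<open>\<delta> = \<eta>\<close> and \<open>\<alpha> = - (B + 2 * \<eta>)\<close>.\<close>
  define \<eta> where "\<eta> = (barrier - B) / 6"
  have \<eta>: "\<eta> > 0" using B by (simp add: \<eta>_def)
  note ev_hub = hub[OF \<eta>]
  have exp5: "\<forall>\<^sub>F n in sequentially. (real n + 1) ^ 5 \<le> exp (\<eta> * real n)" using \<eta> by real_asymp
  have exp8: "\<forall>\<^sub>F n in sequentially. (real n + 1) ^ 8 \<le> exp (\<eta> * real n)" using \<eta> by real_asymp
  show ?thesis
  proof (rule exI[of _ \<eta>], rule conjI[OF \<eta>], rule exI[of _ "- (B + 2 * \<eta>)"], intro conjI allI impI)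
    show "- (B + 2 * \<eta>) < 0" using B \<eta> by simp
  next
    fix M :: "nat \<Rightarrow> nat" and \<epsilon> :: real
    assume asm: "(\<lambda>n. real (M n)) \<in> \<Theta>(\<lambda>n. real n) \<and> 0 < \<epsilon> \<and> \<epsilon> < 1/2"
    then have \<epsilon>: "0 < \<epsilon>" "\<epsilon> < 1/2" by auto
    obtain c where c: "c > 0" "\<forall>\<^sub>F n in sequentially. norm (real (M n)) \<le> c * norm (real n)"
      using asm by (auto elim!: landau_o.bigE dest!: bigthetaD1)
    obtain c' where c': "c' > 0" "\<forall>\<^sub>F n in sequentially. norm (real (M n)) \<ge> c' * norm (real n)"
      using asm by (auto elim!: landau_omega.bigE dest!: bigthetaD2)
    have lower: "\<forall>\<^sub>F n in sequentially. (1/2 - \<epsilon>) / (c + 1) * exp ((barrier - 3 * \<eta>) * real n)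
        \<le> real (tempering_mixing_time n (\<mu> / n) (M n) \<epsilon>)"
      using ev_hub critical_slice[OF \<eta> less_imp_le[OF assms]] disordered_at_zero[OF \<eta>] c(2) c'(2) exp5
        eventually_ge_at_top[of 1]
    proof eventually_elim
      case (elim n)
      let ?\<tau> = "real (tempering_mixing_time n (\<mu> / n) (M n) \<epsilon>)"
      let ?s = "exp (- (barrier - \<eta>) * real n)"
      have n: "n \<ge> 1" using elim by simp
      obtain k1 where h: "k1 \<in> types n" "n div 2 < k1 1"
        "\<And>k. k \<in> types n \<Longrightarrow> exp (- \<eta> * real n) * weight n (\<mu> / n) k \<le> weight n (\<mu> / n) k1"
      proof -
        obtain a b c where "triple a b c \<in> types n" "n div 2 < a"
          "\<forall>k\<in>types n. exp (- \<eta> * real n) * weight n (\<mu> / n) k \<le> weight n (\<mu> / n) (triple a b c)"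
          using elim(1) unfolding accessible_hub_def by blast
        then show ?thesis by (intro that[of "triple a b c"]) auto
      qed
      obtain k0 where k0: "k0 \<in> types n" "k0 1 \<le> n div 2" "exp (- \<eta> * real n) * Z_RGB n 0 \<le> weight n 0 k0"
        using elim(3) by blast
      \<comment> \<open>The linear lower bound on the number of levels ensures at least one step, so
        that the top level is at \<mu> / n; the upper bound costs only a factor n + 1.\<close>
      have "0 < c' * real n" using c'(1) n by simp
      then have "real (M n) > 0" using elim(5) by simp
      then have M: "M n \<ge> 1" by simp
      have "(1/2 - \<epsilon>) * exp (- \<eta> * real n) \<le> ?\<tau> * ((real (M n) + 1) * (real n + 1) ^ 4 * ?s)"
      proof (rule tempering_mixing_lower[OF n M _ \<epsilon> _ k0 h(1) _ h(3)])
        show "weight n (l / n) k \<le> ?s * Z_RGB n (l / n)"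
          if "0 \<le> l" "l \<le> \<mu>" "k \<in> types n" "k 1 = n div 2" for l k
          using elim(2) that by blast
      qed (use \<mu>0 h(2) in auto)
      also have "\<dots> \<le> ?\<tau> * ((c + 1) * exp (\<eta> * real n) * ?s)"
      proof (intro mult_left_mono mult_right_mono)
        have "(real (M n) + 1) * (real n + 1) ^ 4 \<le> ((c + 1) * (real n + 1)) * (real n + 1) ^ 4"
          using elim(4) c(1) by (intro mult_right_mono) (auto simp: algebra_simps)
        also have "\<dots> = (c + 1) * (real n + 1) ^ 5" by (simp add: eval_nat_numeral)
        also have "\<dots> \<le> (c + 1) * exp (\<eta> * real n)" using elim(6) c(1) by (intro mult_left_mono) auto
        finally show "(real (M n) + 1) * (real n + 1) ^ 4 \<le> (c + 1) * exp (\<eta> * real n)" .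
      qed auto
      also have "\<dots> = ?\<tau> * (c + 1) * exp (- (barrier - 2 * \<eta>) * real n)"
        by (simp add: exp_add[symmetric] algebra_simps)
      finally have "(1/2 - \<epsilon>) * exp (- \<eta> * real n) * exp ((barrier - 2 * \<eta>) * real n)
          \<le> ?\<tau> * (c + 1) * exp (- (barrier - 2 * \<eta>) * real n) * exp ((barrier - 2 * \<eta>) * real n)"
        by (rule mult_right_mono) simp
      moreover have "exp (- \<eta> * real n) * exp ((barrier - 2 * \<eta>) * real n) = exp ((barrier - 3 * \<eta>) * real n)"
        "exp (- (barrier - 2 * \<eta>) * real n) * exp ((barrier - 2 * \<eta>) * real n) = 1"
        by (simp_all add: exp_add[symmetric] algebra_simps)
      ultimately have "(1/2 - \<epsilon>) * exp ((barrier - 3 * \<eta>) * real n) \<le> ?\<tau> * (c + 1)"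
        by (simp only: mult.assoc mult_1_right)
      then show ?case using c(1) by (simp add: field_simps)
    qed
    show "(\<lambda>n. real (tempering_mixing_time n (\<mu> / n) (M n) \<epsilon>))
        \<in> \<Omega>(\<lambda>n. exp ((- (- (B + 2 * \<eta>)) + \<eta>) * real n))"
    proof (rule landau_omega.bigI)
      show "(1/2 - \<epsilon>) / (c + 1) > 0" using c \<epsilon> by simp
      have eq: "- (- (B + 2 * \<eta>)) + \<eta> = barrier - 3 * \<eta>" by (simp add: \<eta>_def field_simps)
      show "\<forall>\<^sub>F n in sequentially. (1/2 - \<epsilon>) / (c + 1) * norm (exp ((- (- (B + 2 * \<eta>)) + \<eta>) * real n))
          \<le> norm (real (tempering_mixing_time n (\<mu> / n) (M n) \<epsilon>))"
        unfolding eq using lower by simp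
    qed
    define K where "K = 3 * (24 * exp \<mu> + 96) * (ln 3 + \<mu> + 2 * ln (1 / \<epsilon>)) + 1"
    have K: "K > 0"
    proof -
      have "0 \<le> 3 * (24 * exp \<mu> + 96) * (ln 3 + \<mu> + 2 * ln (1 / \<epsilon>))"
        using \<mu>0 \<epsilon> by (intro mult_nonneg_nonneg add_nonneg_nonneg) auto
      then show ?thesis by (simp add: K_def)
    qed
    have "\<forall>\<^sub>F n in sequentially. real (metropolis_mixing_time n (\<mu> / n) \<epsilon>) \<le> K * exp ((B + 2 * \<eta>) * real n)"
      using ev_hub exp8 eventually_ge_at_top[of 1]
    proof eventually_elim
      case (elim n)
      obtain a b c where h: "triple a b c \<in> types n" "b + 2 \<le> a"
        "\<And>k. k \<in> types n \<Longrightarrow> exp (- \<eta> * real n) * weight n (\<mu> / n) k \<le> weight n (\<mu> / n) (triple a b c)"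
        "\<And>k. k \<in> types n \<Longrightarrow> \<exists>len\<le>(n + 2) * (n + 2).
          route n (\<mu> / n) (exp (- (B + \<eta>) * n) * weight n (\<mu> / n) k) len k (triple a b c)"
        using elim(1) unfolding accessible_hub_def by blast
      have "real (metropolis_mixing_time n (\<mu> / n) \<epsilon>) \<le> K * ((real n + 1) ^ 8 * exp ((B + \<eta>) * real n))"
        unfolding K_def
        by (rule metropolis_mixing_upper[OF elim(3) _ \<epsilon>(1) _ _ _ h]) (use \<mu>0 \<epsilon> B \<eta> in auto)
      also have "\<dots> \<le> K * (exp (\<eta> * real n) * exp ((B + \<eta>) * real n))"
        using elim(2) K by (intro mult_left_mono mult_right_mono) auto
      also have "\<dots> = K * exp ((B + 2 * \<eta>) * real n)" by (simp add: exp_add[symmetric] algebra_simps)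
      finally show ?case .
    qed
    then have "(\<lambda>n. real (metropolis_mixing_time n (\<mu> / n) \<epsilon>)) \<in> O(\<lambda>n. exp (- (- (B + 2 * \<eta>)) * real n + 0))"
      by (intro bigoI[of _ K]) (simp add: add.commute)
    then show "\<exists>r :: nat \<Rightarrow> real. r \<in> o(\<lambda>_. 1) \<and> (\<lambda>n. real (metropolis_mixing_time n (\<mu> / n) \<epsilon>))
        \<in> O(\<lambda>n. exp (- (- (B + 2 * \<eta>)) * real n + r n))"
      \<comment> \<open>The polynomial factor is already absorbed into \<open>\<alpha>\<close>, so
        the correction can be zero.\<close>
      by (intro exI[of _ "\<lambda>_. 0"]) simp
  qed
qed

end
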